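(* (Orlicz isoperimetric inequality) Let $K\subset\mathbb{R}^n$ be a convex body with the origin in its interior and let $\phi:(0,\infty)\to(0,\infty)$ be an increasing convex function. Then $$S_\phi(K)\geq S_\phi(B_K).$$ If $\phi$ is strictly convex, equality holds if and only if $K$ is an origin-symmetric Euclidean ball.
   Context: A convex body is a compact convex subset of $\mathbb{R}^n$ with nonempty interior. $B_2^n$ is the closed unit Euclidean ball, $|\cdot|$ volume, $\mathrm{vrad}(K)=(|K|/|B_2^n|)^{1/n}$ and $B_K=\mathrm{vrad}(K)B_2^n$. $h_K(u)=\max_{x\in K}\langle x,u\rangle$ is the support function and $S(K,\cdot)$ the surface area measure of $K$ on the unit sphere $S^{n-1}$. For convex bodies $K,Q$ with the origin in their interiors, the Orlicz $\phi$-mixed volume is $$V_\phi(K,Q)=\frac1n\int_{S^{n-1}}\phi\!\left(\frac{h_Q(u)}{h_K(u)}\right)h_K(u)\,dS(K,u),$$ and the Orlicz $\phi$-surface area of $K$ is $S_\phi(K)=nV_\phi(K,B_2^n)$. An origin-symmetric Euclidean ball is $rB_2^n$ with $r>0$. *)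

theory Defs
  imports "HOL-Analysis.Analysis"
begin

definition strictly_convex_on :: "'a::real_vector set \<Rightarrow> ('a \<Rightarrow> real) \<Rightarrow> bool" where
  "strictly_convex_on S f \<longleftrightarrow> convex S \<and>
    (\<forall>x\<in>S. \<forall>y\<in>S. \<forall>u>0. \<forall>v>0. x \<noteq> y \<longrightarrow> u + v = 1 \<longrightarrow>
      f (u *\<^sub>R x + v *\<^sub>R y) < u * f x + v * f y)"

definition convex_body :: "'a::euclidean_space set \<Rightarrow> bool" where
  "convex_body K \<longleftrightarrow> compact K \<and> convex K \<and> interior K \<noteq> {}"

definition vrad :: "'a::euclidean_space set \<Rightarrow> real" where
  "vrad K = (measure lebesgue K / measure lebesgue (cball (0::'a) 1)) powr (1 / real DIM('a))"

definition ball_of :: "'a::euclidean_space set \<Rightarrow> 'a set" where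
  "ball_of K = (\<lambda>x. vrad K *\<^sub>R x) ` cball 0 1"

definition support_fun :: "'a::euclidean_space set \<Rightarrow> 'a \<Rightarrow> real" where
  "support_fun K u = (SUP x\<in>K. x \<bullet> u)"

text \<open>
  The \<open>s\<close>-dimensional Hausdorff (outer) measure, normalised so that it extends Lebesgue measure
  on \<open>s\<close>-dimensional subspaces. The empty set gets weight 0 explicitly, since for \<open>s = 0\<close> the
  power \<open>(diameter {} / 2) ^ s\<close> would be 1. Boundedness of the covering sets is
  required because \<^const>\<open>diameter\<close> is unspecified on unbounded sets.
\<close>

definition hausdorff_weight :: "nat \<Rightarrow> 'a::metric_space set \<Rightarrow> ennreal" where
  "hausdorff_weight s C =
    (if C = {} then 0 else ennreal (unit_ball_vol (real s) * (diameter C / 2) ^ s))"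

definition hausdorff_pre :: "nat \<Rightarrow> real \<Rightarrow> 'a::metric_space set \<Rightarrow> ennreal" where
  "hausdorff_pre s \<delta> A =
    (INF C \<in> {C :: nat \<Rightarrow> 'a set. A \<subseteq> (\<Union>i. C i) \<and> (\<forall>i. bounded (C i) \<and> diameter (C i) \<le> \<delta>)}.
      \<Sum>i. hausdorff_weight s (C i))"

definition hausdorff_outer_measure :: "nat \<Rightarrow> 'a::metric_space set \<Rightarrow> ennreal" where
  "hausdorff_outer_measure s A = (SUP \<delta>\<in>{0<..}. hausdorff_pre s \<delta> A)"

definition outer_unit_normal :: "'a::euclidean_space set \<Rightarrow> 'a \<Rightarrow> 'a \<Rightarrow> bool" where
  "outer_unit_normal K x u \<longleftrightarrow> norm u = 1 \<and> (\<forall>y\<in>K. y \<bullet> u \<le> x \<bullet> u)"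

definition regular_boundary :: "'a::euclidean_space set \<Rightarrow> 'a set" where
  "regular_boundary K = {x \<in> frontier K. \<exists>!u. outer_unit_normal K x u}"

definition gauss_map :: "'a::euclidean_space set \<Rightarrow> 'a \<Rightarrow> 'a" where
  "gauss_map K x = (THE u. outer_unit_normal K x u)"

text \<open>
  \<open>S(K, \<omega>)\<close> is the \<open>(n - 1)\<close>-dimensional Hausdorff measure of the preimage of \<open>\<omega>\<close>
  under the Gauss map, which is defined at the boundary points having a unique outer unit normal
  (for a convex body, at almost all of them).
\<close>

definition surface_area_measure :: "'a::euclidean_space set \<Rightarrow> 'a measure" where
  "surface_area_measure K =
    measure_of (sphere 0 1) (sets (restrict_space borel (sphere 0 1)))
      (\<lambda>\<omega>. hausdorff_outer_measure (DIM('a) - 1) {x \<in> regular_boundary K. gauss_map K x \<in> \<omega>})"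

definition orlicz_mixed_volume ::
    "(real \<Rightarrow> real) \<Rightarrow> 'a::euclidean_space set \<Rightarrow> 'a set \<Rightarrow> real" where
  "orlicz_mixed_volume \<phi> K Q =
    1 / real DIM('a) *
      (LINT u|surface_area_measure K. \<phi> (support_fun Q u / support_fun K u) * support_fun K u)"

definition orlicz_surface_area :: "(real \<Rightarrow> real) \<Rightarrow> 'a::euclidean_space set \<Rightarrow> real" where
  "orlicz_surface_area \<phi> K = real DIM('a) * orlicz_mixed_volume \<phi> K (cball 0 1)"

definition origin_symmetric_ball :: "'a::euclidean_space set \<Rightarrow> bool" where
  "origin_symmetric_ball K \<longleftrightarrow> (\<exists>r>0. K = (\<lambda>x. r *\<^sub>R x) ` cball 0 1)"

end

theory Submission
  imports Defs
begin

text \<open>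
  Let \<open>g\<close> be the gauge of \<open>K\<close> (the support function of the polar body) and \<open>r x = x / g x\<close> the radial
  projection onto the boundary. The heart of the proof is the cone-volume formula: up to a constant
  \<open>\<kappa>\<close> depending only on the dimension, the measure \<open>\<langle>x, \<nu> x\<rangle> dH x\<close> on the
  regular boundary (\<open>H\<close> is the Hausdorff measure of codimension one, \<open>\<nu>\<close> the Gauss map) is the image of
  Lebesgue measure on \<open>K\<close> under \<open>r\<close>. On a piece of the boundary where \<open>\<nu>\<close> varies little, the central projection
  to a tangent hyperplane is nearly isometric, and on a hyperplane Hausdorff measure and pyramid volume
  are both translation invariant, hence proportional. The value of \<open>\<kappa>\<close> is irrelevant because it
  multiplies both sides of the inequality; in particular no isodiametric inequality is needed.

  Since the gradient of \<open>g\<close> has norm \<open>1 / \<langle>r x, \<nu> (r x)\<rangle>\<close>, the formula turns the Orlicz surface area into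
  \<open>\<kappa>\<close> times the integral of \<open>\<phi> \<parallel>\<nabla> g\<parallel>\<close> over \<open>K\<close>. Every point \<open>y\<close> of the parallel body \<open>K + e B\<close> satisfies
  \<open>g y \<le> 1 + e \<parallel>\<nabla> g y\<parallel>\<close>, so the Brunn-Minkowski inequality gives a lower bound \<open>t\<^sub>0 |K|\<close> for the integral
  of \<open>\<parallel>\<nabla> g\<parallel>\<close>, where \<open>t\<^sub>0\<close> is the reciprocal of the volume radius. The supporting line of \<open>\<phi>\<close> at \<open>t\<^sub>0\<close> yields
  the inequality. If \<open>\<phi>\<close> is strictly convex, equality forces \<open>\<parallel>\<nabla> g\<parallel> = t\<^sub>0\<close> almost everywhere; then \<open>K\<close>
  contains the ball with its own volume and must be that ball.
\<close>

section \<open>Hausdorff measures\<close>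

text \<open>The surface area measure is built with \<open>measure_of\<close>, which returns the zero
  measure when the given set function is not countably additive. So Caratheodory's criterion and the
  Borel measurability of the Gauss map must be in place before the integral over the sphere can be
  evaluated. Of Hausdorff measure on a hyperplane three facts enter: it is invariant under
  isometries, finite on bounded sets and positive on a disc; the last two come from crude packing
  and covering estimates.

  Two measures are compared by one pattern: on countably many small pieces they agree up to a factor
  \<open>\<tau>\<close>, and then \<open>\<tau>\<close> tends to 1.

  The volume of the parallel body is bounded above by that of a star-shaped set containing almost
  all of it. Integration along rays bounds that volume by the integral over \<open>K\<close> of
  \<open>(1 + e * grad_norm x) ^ n\<close>, where \<open>n\<close> is the dimension, and the terms
  linear in \<open>e\<close> are compared with Brunn-Minkowski. Strict convexity enters only through
  the points of contact of \<open>\<phi>\<close> with its supporting line.\<close>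

lemma hausdorff_weight_empty [simp]: "hausdorff_weight s {} = 0"
  by (simp add: hausdorff_weight_def)

lemma hausdorff_weight_le:
  assumes "bounded C" "diameter C \<le> d"
  shows "hausdorff_weight s C \<le> ennreal (unit_ball_vol (real s) * (d / 2) ^ s)"
  using assms diameter_ge_0[OF assms(1)]
  by (auto simp: hausdorff_weight_def intro!: ennreal_leI mult_left_mono power_mono)

lemma hausdorff_pre_le:
  assumes "A \<subseteq> (\<Union>i. C i)" "\<And>i. bounded (C i)" "\<And>i. diameter (C i) \<le> \<delta>"
  shows "hausdorff_pre s \<delta> A \<le> (\<Sum>i. hausdorff_weight s (C i))"
  unfolding hausdorff_pre_def using assms by (intro INF_lower) auto

text \<open>The bound is divided by \<open>q\<close>, passed to the infimum over covers and
  multiplied back. Lipschitz images and volumes of cones are both estimated cover by cover in this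
  way.\<close>

lemma le_mult_hausdorff_pre:
  assumes q: "0 < q"
    and le: "\<And>C :: nat \<Rightarrow> _. A \<subseteq> (\<Union>i. C i) \<Longrightarrow> (\<And>i. bounded (C i)) \<Longrightarrow> (\<And>i. diameter (C i) \<le> \<delta>) \<Longrightarrow>
      a \<le> ennreal q * (\<Sum>i. hausdorff_weight s (C i))"
  shows "a \<le> ennreal q * hausdorff_pre s \<delta> A"
proof -
  have "ennreal (1 / q) * a \<le> hausdorff_pre s \<delta> A"
    unfolding hausdorff_pre_def
  proof (intro INF_greatest)
    fix C :: "nat \<Rightarrow> 'a set"
    assume "C \<in> {C. A \<subseteq> \<Union> (range C) \<and> (\<forall>i. bounded (C i) \<and> diameter (C i) \<le> \<delta>)}"
    then have "ennreal (1 / q) * a \<le> ennreal (1 / q) * (ennreal q * (\<Sum>i. hausdorff_weight s (C i)))"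
      by (intro mult_left_mono le) auto
    also have "\<dots> = (\<Sum>i. hausdorff_weight s (C i))"
      using q by (simp add: mult.assoc[symmetric] ennreal_mult[symmetric])
    finally show "ennreal (1 / q) * a \<le> (\<Sum>i. hausdorff_weight s (C i))" .
  qed
  then have "ennreal q * (ennreal (1 / q) * a) \<le> ennreal q * hausdorff_pre s \<delta> A"
    by (rule mult_left_mono) simp
  then show ?thesis using q by (simp add: mult.assoc[symmetric] ennreal_mult[symmetric])
qed

lemma hausdorff_pre_mono: "A \<subseteq> B \<Longrightarrow> hausdorff_pre s \<delta> A \<le> hausdorff_pre s \<delta> B"
  unfolding hausdorff_pre_def by (intro INF_superset_mono) auto

lemma hausdorff_pre_antimono: "\<delta>' \<le> \<delta> \<Longrightarrow> hausdorff_pre s \<delta> A \<le> hausdorff_pre s \<delta>' A"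
  unfolding hausdorff_pre_def by (intro INF_superset_mono) (auto intro: order_trans)

lemma hausdorff_pre_empty [simp]: "0 \<le> \<delta> \<Longrightarrow> hausdorff_pre s \<delta> {} = 0"
  using hausdorff_pre_le[of "{}" "\<lambda>_. {}" \<delta> s] by simp

lemma hausdorff_pre_UN_le:
  "hausdorff_pre s \<delta> (\<Union>i. A i) \<le> (\<Sum>i. hausdorff_pre s \<delta> (A (i::nat)))"
proof (rule ennreal_le_epsilon)
  fix e :: real assume e: "0 < e" and fin: "(\<Sum>n. hausdorff_pre s \<delta> (A n)) < top"
  have *: "hausdorff_pre s \<delta> (A n) < hausdorff_pre s \<delta> (A n) + e * (1/2)^Suc n" for n
    using fin e by (auto simp add: less_top dest!: ennreal_suminf_lessD)
  have "\<exists>B. A n \<subseteq> (\<Union>i. B i) \<and> (\<forall>i. bounded (B i) \<and> diameter (B i) \<le> \<delta>) \<and>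
      (\<Sum>i. hausdorff_weight s (B i)) \<le> hausdorff_pre s \<delta> (A n) + e * (1/2)^Suc n" for n
    using *[of n] less_imp_le unfolding hausdorff_pre_def[of s \<delta> "A n"] INF_less_iff by blast
  then obtain B where B: "\<And>n. A n \<subseteq> (\<Union>i. B n i)"
      "\<And>n i. bounded (B n i)" "\<And>n i. diameter (B n i) \<le> \<delta>"
      "\<And>n. (\<Sum>i. hausdorff_weight s (B n i)) \<le> hausdorff_pre s \<delta> (A n) + e * (1/2)^Suc n"
    by metis
  define C where "C = case_prod B o prod_decode"
  have A_C: "(\<Union>i. A i) \<subseteq> (\<Union>i. C i)"
    using B(1) by (auto simp add: C_def subset_eq) (metis prod.case prod_encode_inverse)
  have "hausdorff_pre s \<delta> (\<Union>i. A i) \<le> (\<Sum>i. hausdorff_weight s (C i))"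
    using A_C B by (intro hausdorff_pre_le) (auto simp: C_def split: prod.split)
  also have "\<dots> = (\<Sum>n. \<Sum>i. hausdorff_weight s (B n i))"
    unfolding C_def comp_def by (intro suminf_ennreal_2dimen) auto
  also have "\<dots> \<le> (\<Sum>n. hausdorff_pre s \<delta> (A n) + e * (1/2) ^ Suc n)"
    by (intro suminf_le allI B) auto
  also have "... = (\<Sum>n. hausdorff_pre s \<delta> (A n)) + (\<Sum>n. ennreal e * ennreal ((1/2) ^ Suc n))"
    using \<open>0 < e\<close> by (subst suminf_add[symmetric])
       (auto simp del: ennreal_suminf_cmult simp add: ennreal_mult[symmetric])
  also have "\<dots> = (\<Sum>n. hausdorff_pre s \<delta> (A n)) + e"
    unfolding ennreal_suminf_cmult
    by (subst suminf_ennreal_eq[OF zero_le_power power_half_series]) auto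
  finally show "hausdorff_pre s \<delta> (\<Union>i. A i) \<le> (\<Sum>n. hausdorff_pre s \<delta> (A n)) + e" .
qed

lemma hausdorff_pre_le_outer:
  "0 < \<delta> \<Longrightarrow> hausdorff_pre s \<delta> A \<le> hausdorff_outer_measure s A"
  unfolding hausdorff_outer_measure_def by (intro SUP_upper) auto

lemma hausdorff_outer_measure_mono:
  "A \<subseteq> B \<Longrightarrow> hausdorff_outer_measure s A \<le> hausdorff_outer_measure s B"
  unfolding hausdorff_outer_measure_def by (intro SUP_mono) (auto intro: hausdorff_pre_mono)

lemma hausdorff_outer_measure_empty [simp]: "hausdorff_outer_measure s {} = 0"
  unfolding hausdorff_outer_measure_def
  by (metis (mono_tags, lifting) SUP_bot SUP_cong bot_ennreal greaterThan_iff hausdorff_pre_empty less_imp_le)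

lemma hausdorff_outer_measure_UN_le:
  "hausdorff_outer_measure s (\<Union>i. A i) \<le> (\<Sum>i. hausdorff_outer_measure s (A (i::nat)))"
  unfolding hausdorff_outer_measure_def[of s "\<Union>i. A i"]
  by (intro SUP_least order_trans[OF hausdorff_pre_UN_le] suminf_le)
     (auto intro: hausdorff_pre_le_outer)

lemma hausdorff_outer_measure_Un_le:
  "hausdorff_outer_measure s (A \<union> B) \<le> hausdorff_outer_measure s A + hausdorff_outer_measure s B"
proof -
  have "A \<union> B = (\<Union>i. case i of 0 \<Rightarrow> A | Suc 0 \<Rightarrow> B | _ \<Rightarrow> {})"
    by (auto split: nat.splits)
  also have "hausdorff_outer_measure s \<dots> \<le>
      (\<Sum>i. hausdorff_outer_measure s (case i of 0 \<Rightarrow> A | Suc 0 \<Rightarrow> B | _ \<Rightarrow> {}))"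
    by (rule hausdorff_outer_measure_UN_le)
  also have "\<dots> = hausdorff_outer_measure s A + hausdorff_outer_measure s B"
    by (subst suminf_finite[of "{0,Suc 0}"]) (auto split: nat.splits)
  finally show ?thesis .
qed

section \<open>Caratheodory's criterion and the Hausdorff measure on Borel sets\<close>

text \<open>A covering set of diameter at most \<open>\<delta>\<close>, hence below
  \<open>d\<close>, meets at most one of the two sets. Discarding from a cover of the union the sets
  that miss \<open>A\<close>, or those that miss \<open>B\<close>, gives covers of \<open>A\<close>
  and of \<open>B\<close> that share no nonempty set.\<close>

lemma hausdorff_pre_separated:
  assumes "\<delta> < d" and sep: "\<And>x y. x \<in> A \<Longrightarrow> y \<in> B \<Longrightarrow> d \<le> dist x y"
  shows "hausdorff_pre s \<delta> A + hausdorff_pre s \<delta> B \<le> hausdorff_pre s \<delta> (A \<union> B)"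
  unfolding hausdorff_pre_def[of s \<delta> "A \<union> B"]
proof (intro INF_greatest)
  fix C :: "nat \<Rightarrow> 'a set"
  assume "C \<in> {C. A \<union> B \<subseteq> \<Union> (range C) \<and> (\<forall>i. bounded (C i) \<and> diameter (C i) \<le> \<delta>)}"
  then have C: "A \<subseteq> (\<Union>i. C i)" "B \<subseteq> (\<Union>i. C i)" "\<And>i. bounded (C i)" "\<And>i. diameter (C i) \<le> \<delta>"
    by auto
  have 0: "0 \<le> \<delta>" using C diameter_ge_0 order_trans by blast
  let ?A = "\<lambda>i. if C i \<inter> A = {} then {} else C i"
  let ?B = "\<lambda>i. if C i \<inter> B = {} then {} else C i"
  have disj: "C i \<inter> A = {} \<or> C i \<inter> B = {}" for i
  proof (rule ccontr)
    assume "\<not> ?thesis"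
    then obtain x y where xy: "x \<in> C i" "x \<in> A" "y \<in> C i" "y \<in> B" by blast
    then have "d \<le> diameter (C i)"
      using sep[of x y] diameter_bounded_bound[OF C(3), of x i y] by linarith
    then show False using C(4)[of i] assms(1) by linarith
  qed
  have "hausdorff_pre s \<delta> A \<le> (\<Sum>i. hausdorff_weight s (?A i))"
    using C 0 by (intro hausdorff_pre_le) (auto simp: subset_eq, metis disjoint_iff)
  moreover have "hausdorff_pre s \<delta> B \<le> (\<Sum>i. hausdorff_weight s (?B i))"
    using C 0 by (intro hausdorff_pre_le) (auto simp: subset_eq, metis disjoint_iff)
  ultimately have "hausdorff_pre s \<delta> A + hausdorff_pre s \<delta> B \<le>
     (\<Sum>i. hausdorff_weight s (?A i)) + (\<Sum>i. hausdorff_weight s (?B i))"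
    by (rule add_mono)
  also have "\<dots> = (\<Sum>i. hausdorff_weight s (?A i) + hausdorff_weight s (?B i))"
    by (rule suminf_add) auto
  also have "\<dots> \<le> (\<Sum>i. hausdorff_weight s (C i))"
    using disj by (intro suminf_le) auto
  finally show "hausdorff_pre s \<delta> A + hausdorff_pre s \<delta> B \<le> (\<Sum>i. hausdorff_weight s (C i))" .
qed

lemma hausdorff_outer_measure_separated:
  assumes "0 < d" and sep: "\<And>x y. x \<in> A \<Longrightarrow> y \<in> B \<Longrightarrow> d \<le> dist x y"
  shows "hausdorff_outer_measure s A + hausdorff_outer_measure s B \<le> hausdorff_outer_measure s (A \<union> B)"
proof -
  have *: "hausdorff_pre s a A + hausdorff_pre s b B \<le> hausdorff_outer_measure s (A \<union> B)"
    if "0 < a" "0 < b" for a b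
  proof -
    \<comment> \<open>A common scale for the two independent suprema; halving \<open>d\<close> makes
      it strictly smaller than the separation.\<close>
    define e where "e = min (min a b) (d / 2)"
    have e: "0 < e" "e \<le> a" "e \<le> b" "e < d" using that assms(1) by (auto simp: e_def)
    have "hausdorff_pre s a A + hausdorff_pre s b B \<le> hausdorff_pre s e A + hausdorff_pre s e B"
      using e by (intro add_mono hausdorff_pre_antimono) auto
    also have "\<dots> \<le> hausdorff_pre s e (A \<union> B)"
      by (rule hausdorff_pre_separated[OF e(4) sep])
    also have "\<dots> \<le> hausdorff_outer_measure s (A \<union> B)"
      using e by (intro hausdorff_pre_le_outer)
    finally show ?thesis .
  qed
  have "hausdorff_outer_measure s A + hausdorff_outer_measure s B =
    (SUP a\<in>{0<..}. SUP b\<in>{0<..}. hausdorff_pre s a A + hausdorff_pre s b B)"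
    unfolding hausdorff_outer_measure_def
    by (subst ennreal_SUP_add_left[symmetric], simp,
        subst ennreal_SUP_add_right[symmetric]) auto
  also have "\<dots> \<le> hausdorff_outer_measure s (A \<union> B)"
    using * by (intro SUP_least) auto
  finally show ?thesis .
qed

text \<open>Points of \<open>A - C\<close> have positive distance to the closed set
  \<open>C\<close>, so the sets \<open>D k\<close> exhaust \<open>A - C\<close>, and each
  \<open>D k\<close> is separated from \<open>C\<close>. What \<open>D k\<close> misses lies in the
  shells \<open>R i\<close> with \<open>i \<ge> k\<close>; their measures have a finite sum, so the
  loss tends to 0.\<close>

lemma hausdorff_outer_measure_closed_split:
  assumes C: "closed C"
  shows "hausdorff_outer_measure s (A \<inter> C) + hausdorff_outer_measure s (A - C) \<le> hausdorff_outer_measure s A"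
proof (cases "hausdorff_outer_measure s A = \<infinity> \<or> C = {}")
  case True
  then show ?thesis by auto
next
  case False
  let ?H = "hausdorff_outer_measure s"
  have fin: "?H A < \<infinity>" and ne: "C \<noteq> {}" using False by (auto simp: less_top)
  define D where "D k = {x \<in> A. 1 / real (Suc k) \<le> infdist x C}" for k
  define R where "R k = D (Suc k) - D k" for k
  have D_mono: "D k \<subseteq> D l" if "k \<le> l" for k l
  proof
    fix x assume "x \<in> D k"
    then show "x \<in> D l" using that unfolding D_def
      by (auto intro: order_trans[rotated] simp: frac_le)
  qed
  have UD: "A - C \<subseteq> D k \<union> (\<Union>i. R (k + i))" for k
  proof
    fix x assume x: "x \<in> A - C"
    then have "0 < infdist x C" using C ne
      by (metis DiffD2 in_closed_iff_infdist_zero infdist_nonneg less_le)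
    then obtain m where m: "1 / real (Suc m) < infdist x C"
      using nat_approx_posE by blast
    then have ex: "x \<in> D m" using x by (auto simp: D_def)
    define l where "l = (LEAST l. x \<in> D l)"
    have l: "x \<in> D l" "\<And>j. j < l \<Longrightarrow> x \<notin> D j"
      unfolding l_def using ex LeastI not_less_Least by metis+
    show "x \<in> D k \<union> (\<Union>i. R (k + i))"
    proof (cases "l \<le> k")
      case True then show ?thesis using l D_mono by blast
    next
      case False
      \<comment> \<open>\<open>l\<close> is the first index with \<open>x \<in> D l\<close>, so
        \<open>x\<close> lies in the shell of index \<open>l - 1\<close>; as \<open>k < l\<close>,
        that index is \<open>k + (l - k - 1)\<close>.\<close>
      then have "x \<in> R (k + (l - k - 1))" using l by (auto simp: R_def)
      then show ?thesis by blast
    qed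
  qed
  have inf_far: "1 / real (Suc k) \<le> dist x y" if "x \<in> D k" "y \<in> C" for x y k
    using that infdist_le[of y C x] by (auto simp: D_def)
  have sepR: "1 / real (Suc k) - 1 / real (Suc (Suc k)) \<le> dist x y"
    if "x \<in> D k" "y \<in> A" "y \<notin> D (Suc k)" for x y k
    using that infdist_triangle[of x C y] by (auto simp: D_def)
  \<comment> \<open>Shells of the same parity are at positive distance from each other, so their measures add up.\<close>
  have alternate: "(\<Sum>i<n. ?H (R (Suc (2 * i + p)))) \<le> ?H (D (2 * n + p))" for n p
  proof (induction n)
    case (Suc n)
    have "(\<Sum>i<Suc n. ?H (R (Suc (2 * i + p)))) \<le> ?H (D (2 * n + p)) + ?H (R (Suc (2 * n + p)))"
      using Suc by (auto simp: add_right_mono)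
    also have "\<dots> \<le> ?H (D (2 * n + p) \<union> R (Suc (2 * n + p)))"
      by (rule hausdorff_outer_measure_separated
            [of "1 / real (Suc (2 * n + p)) - 1 / real (Suc (Suc (2 * n + p)))"])
         (auto simp: R_def D_def[of "Suc (Suc (2 * n + p))"] simp del: of_nat_Suc
           intro!: frac_less2 sepR)
    also have "\<dots> \<le> ?H (D (2 * Suc n + p))"
      by (intro hausdorff_outer_measure_mono)
         (use D_mono[of "2 * n + p" "2 * Suc n + p"] in \<open>auto simp: R_def\<close>)
    finally show ?case .
  qed auto
  have half: "(\<Sum>i<n. ?H (R (Suc (2 * i + p)))) \<le> ?H A" for n p
    by (rule order_trans[OF alternate], rule hausdorff_outer_measure_mono) (auto simp: D_def)
  \<comment> \<open>The shift by one matches \<open>half\<close>, whose shells start at index 1, and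
    \<open>bound\<close>, which keeps \<open>D (Suc k)\<close>.\<close>
  define F where "F i = ?H (R (Suc i))" for i
  have two: "(\<Sum>i<2*n. F i) = (\<Sum>i<n. F (2*i)) + (\<Sum>i<n. F (2*i+1))" for n
    by (induction n) (auto simp: algebra_simps)
  have "(\<Sum>i<n. F i) \<le> ?H A + ?H A" for n
  proof -
    have "(\<Sum>i<n. F i) \<le> (\<Sum>i<2*n. F i)" by (intro sum_mono2) auto
    also have "\<dots> \<le> ?H A + ?H A"
      unfolding two using half[of 0 n] half[of 1 n] by (intro add_mono) (auto simp: F_def)
    finally show ?thesis .
  qed
  then have "suminf F \<le> ?H A + ?H A" by (intro suminf_le_const summableI) auto
  then have T: "suminf F < \<infinity>" using fin by (metis ennreal_add_less_top infinity_ennreal_def order.strict_trans1)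
  \<comment> \<open>The tail of the series is completed by its initial part, so that the finite
    number \<open>suminf F\<close> can be cancelled at the end in place of a limit of tails.\<close>
  have bound: "?H (A \<inter> C) + ?H (A - C) + (\<Sum>i<k. F i) \<le> ?H A + suminf F" for k
  proof -
    have "?H (A - C) \<le> ?H (D (Suc k) \<union> (\<Union>i. R (Suc k + i)))"
      by (rule hausdorff_outer_measure_mono[OF UD])
    also have "\<dots> \<le> ?H (D (Suc k)) + (\<Sum>i. F (k + i))"
      unfolding F_def
      by (intro order_trans[OF hausdorff_outer_measure_Un_le] add_mono)
         (auto intro!: hausdorff_outer_measure_UN_le[THEN order_trans])
    finally have "?H (A \<inter> C) + ?H (A - C) + (\<Sum>i<k. F i) \<le>
        (?H (A \<inter> C) + ?H (D (Suc k))) + ((\<Sum>i. F (i + k)) + (\<Sum>i<k. F i))"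
      by (simp add: add_mono ac_simps)
    also have "(\<Sum>i. F (i + k)) + (\<Sum>i<k. F i) = suminf F"
      using suminf_offset[of F k] by (simp add: ac_simps)
    also have "?H (A \<inter> C) + ?H (D (Suc k)) \<le> ?H (A \<inter> C \<union> D (Suc k))"
      by (intro hausdorff_outer_measure_separated[of "1 / real (Suc (Suc k))"])
         (auto simp del: of_nat_Suc intro: inf_far[of _ "Suc k", THEN order_trans] simp: dist_commute)
    also have "\<dots> \<le> ?H A"
      by (intro hausdorff_outer_measure_mono) (auto simp: D_def)
    finally show ?thesis by (simp add: add_right_mono)
  qed
  have "?H (A \<inter> C) + ?H (A - C) + suminf F \<le> ?H A + suminf F"
  proof -
    have "?H (A \<inter> C) + ?H (A - C) + suminf F = (SUP k. ?H (A \<inter> C) + ?H (A - C) + (\<Sum>i<k. F i))"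
      unfolding suminf_eq_SUP[of F] by (rule ennreal_SUP_add_right) simp
    also have "\<dots> \<le> ?H A + suminf F" by (intro SUP_least bound)
    finally show ?thesis .
  qed
  then show ?thesis using T
    by (metis ennreal_add_left_cancel_le add.commute infinity_ennreal_def less_top)
qed

definition hausdorff_measure :: "nat \<Rightarrow> 'a::metric_space measure" where
  "hausdorff_measure s = measure_of UNIV (sets borel) (hausdorff_outer_measure s)"

text \<open>By Caratheodory's theorem the sets that split every set additively form a
  \<sigma>-algebra on which the outer measure is a measure; it contains the closed sets and
  therefore the Borel sets.\<close>

lemma measure_space_hausdorff:
  "measure_space UNIV (sets (borel :: 'a::metric_space measure)) (hausdorff_outer_measure s)"
proof -
  let ?H = "hausdorff_outer_measure s :: 'a set \<Rightarrow> ennreal"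
  interpret sigma_algebra UNIV "Pow (UNIV :: 'a set)" by (rule sigma_algebra_Pow)
  have oms: "outer_measure_space (Pow UNIV) ?H"
    using hausdorff_outer_measure_mono hausdorff_outer_measure_UN_le
    by (auto simp: outer_measure_space_def positive_def increasing_def countably_subadditive_def)
  have ms: "measure_space UNIV (lambda_system UNIV (Pow UNIV) ?H) ?H"
    by (rule caratheodory_lemma[OF oms])
  have closed: "C \<in> lambda_system UNIV (Pow UNIV) ?H" if "closed C" for C
  proof -
    have "?H (A \<inter> C) + ?H (A - C) = ?H A" for A
      using hausdorff_outer_measure_closed_split[OF that, of s A]
        hausdorff_outer_measure_Un_le[of s "A \<inter> C" "A - C"] by (simp add: Int_Diff_Un antisym)
    then show ?thesis by (auto simp: lambda_system_def Diff_eq Int_commute)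
  qed
  have "sets borel \<subseteq> lambda_system UNIV (Pow UNIV) ?H"
    unfolding borel_eq_closed sets_measure_of[OF subset_UNIV[of "Collect closed", folded Pow_UNIV]]
    by (rule sigma_algebra.sigma_sets_subset)
       (use ms closed in \<open>auto simp: measure_space_def\<close>)
  then show ?thesis
    using ms by (rule measure_down[rotated 2]) (metis sets.sigma_algebra_axioms space_borel)
qed

lemma sets_hausdorff_measure [simp, measurable_cong]: "sets (hausdorff_measure s) = sets borel"
  unfolding hausdorff_measure_def by (metis sets.sets_measure_of_eq space_borel)

lemma space_hausdorff_measure [simp]: "space (hausdorff_measure s) = UNIV"
  unfolding hausdorff_measure_def by (simp add: space_measure_of_conv)

lemma emeasure_hausdorff_measure [simp]:
  "A \<in> sets borel \<Longrightarrow> emeasure (hausdorff_measure s) A = hausdorff_outer_measure s A"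
  unfolding hausdorff_measure_def
  by (rule emeasure_measure_of_sigma)
     (use measure_space_hausdorff[of s] in \<open>auto simp: measure_space_def\<close>)

section \<open>Upper and lower bounds for Hausdorff measure\<close>

text \<open>The map is Lipschitz only on \<open>A\<close>, so a cover at scale
  \<open>\<delta> / L\<close> is cut down to \<open>A\<close> before its image is used as a cover at
  scale \<open>\<delta>\<close>.\<close>

lemma hausdorff_outer_measure_lipschitz_image:
  fixes f :: "'a::metric_space \<Rightarrow> 'b::real_normed_vector"
  assumes L: "0 < L" and lip: "\<And>x y. x \<in> A \<Longrightarrow> y \<in> A \<Longrightarrow> dist (f x) (f y) \<le> L * dist x y"
  shows "hausdorff_outer_measure s (f ` A) \<le> ennreal (L ^ s) * hausdorff_outer_measure s A"
proof -
  have cover: "hausdorff_pre s \<delta> (f ` A) \<le> ennreal (L ^ s) * (\<Sum>i. hausdorff_weight s (C i))"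
    if C: "A \<subseteq> (\<Union>i. C i)" "\<And>i. bounded (C i)" "\<And>i. diameter (C i) \<le> \<delta> / L" for \<delta> C
  proof -
    have d: "diameter (f ` (C i \<inter> A)) \<le> L * diameter (C i)" for i
      using L by (intro diameter_le)
        (auto simp flip: dist_norm intro!: order_trans[OF lip] mult_nonneg_nonneg
            diameter_ge_0 C diameter_bounded_bound)
    have b: "bounded (f ` (C i \<inter> A))" for i
    proof -
      have "dist (f x) (f y) \<le> L * diameter (C i)" if "x \<in> C i \<inter> A" "y \<in> C i \<inter> A" for x y
        using that L lip[of x y] diameter_bounded_bound[OF C(2), of x i y]
        by (meson Int_iff less_imp_le mult_left_mono order_trans)
      then show ?thesis by (auto simp: bounded_two_points)
    qed
    have "hausdorff_pre s \<delta> (f ` A) \<le> (\<Sum>i. hausdorff_weight s (f ` (C i \<inter> A)))"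
    proof (rule hausdorff_pre_le)
      show "f ` A \<subseteq> (\<Union>i. f ` (C i \<inter> A))" using C(1) by blast
      show "diameter (f ` (C i \<inter> A)) \<le> \<delta>" for i
        using d[of i] C(3)[of i] L by (auto simp: field_simps)
    qed (rule b)
    also have "\<dots> \<le> (\<Sum>i. ennreal (L ^ s) * hausdorff_weight s (C i))"
    proof (intro suminf_le allI)
      fix i
      show "hausdorff_weight s (f ` (C i \<inter> A)) \<le> ennreal (L ^ s) * hausdorff_weight s (C i)"
      proof (cases "C i \<inter> A = {}")
        case False
        then have "hausdorff_weight s (C i) = ennreal (unit_ball_vol (real s) * (diameter (C i) / 2) ^ s)"
          by (auto simp: hausdorff_weight_def)
        moreover have "unit_ball_vol (real s) * (L * diameter (C i) / 2) ^ s =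
            L ^ s * (unit_ball_vol (real s) * (diameter (C i) / 2) ^ s)"
          by (simp add: power_mult_distrib power_divide)
        ultimately show ?thesis using hausdorff_weight_le[OF b d, of s i] L
          by (simp only:) (simp add: ennreal_mult[symmetric] diameter_ge_0 C)
      qed auto
    qed auto
    also have "\<dots> = ennreal (L ^ s) * (\<Sum>i. hausdorff_weight s (C i))"
      by (rule ennreal_suminf_cmult)
    finally show ?thesis .
  qed
  have "hausdorff_pre s \<delta> (f ` A) \<le> ennreal (L ^ s) * hausdorff_outer_measure s A"
    if "0 < \<delta>" for \<delta>
  proof -
    have "hausdorff_pre s \<delta> (f ` A) \<le> ennreal (L ^ s) * hausdorff_pre s (\<delta> / L) A"
      using cover L by (intro le_mult_hausdorff_pre) auto
    also have "\<dots> \<le> ennreal (L ^ s) * hausdorff_outer_measure s A"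
      using that L by (intro mult_left_mono hausdorff_pre_le_outer) auto
    finally show ?thesis .
  qed
  then show ?thesis unfolding hausdorff_outer_measure_def[of s "f ` A"]
    by (intro SUP_least) auto
qed


text \<open>A packing argument: balls of radius \<open>d / 2\<close> about a
  \<open>d\<close>-separated subset of \<open>A\<close> are disjoint and fit into a neighbourhood of
  volume at most \<open>C * (d / 2)\<close>, which limits the number of points to the order of
  \<open>(1 / d) ^ (n - 1)\<close>. A subset of greatest cardinality gives a cover by balls of
  radius \<open>d\<close>.\<close>

lemma hausdorff_outer_measure_lt_top:
  fixes A :: "'a::euclidean_space set"
  assumes bnd: "bounded A" and d0: "0 < d0"
    and vol: "\<And>d. 0 < d \<Longrightarrow> d \<le> d0 \<Longrightarrow> measure lebesgue (\<Union>x\<in>A. ball x d) \<le> C * d"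
  shows "hausdorff_outer_measure (DIM('a) - 1) A < \<infinity>"
proof -
  let ?s = "DIM('a) - 1"
  let ?w = "unit_ball_vol (real DIM('a))" and ?v = "unit_ball_vol (real ?s)"
  have w: "0 < ?w" and v: "0 < ?v" by auto
  have nbd: "bounded (\<Union>x\<in>A. ball x d)" for d
  proof -
    obtain M where M: "\<And>x. x \<in> A \<Longrightarrow> norm x \<le> M" using bnd by (auto simp: bounded_iff)
    have "norm y \<le> M + d" if "x \<in> A" "y \<in> ball x d" for x y
      using M[OF that(1)] that(2) norm_triangle_ineq[of x "y - x"] by (auto simp: dist_norm norm_minus_commute)
    then show ?thesis unfolding bounded_iff by blast
  qed
  \<comment> \<open>The bound \<open>C / (?w * (d / 2) ^ ?s)\<close> for the cardinality times the
    weight \<open>?v * d ^ ?s\<close> of a set of diameter \<open>2 * d\<close>; the powers of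
    \<open>d\<close> cancel.\<close>
  define M where "M = C * 2 ^ ?s * ?v / ?w"
  have main: "hausdorff_pre ?s (2 * d) A \<le> ennreal M" if d: "0 < d" "d \<le> d0" for d
  proof -
    define sep where "sep X \<longleftrightarrow> X \<subseteq> A \<and> finite X \<and> (\<forall>x\<in>X. \<forall>y\<in>X. x \<noteq> y \<longrightarrow> d \<le> dist x y)" for X
    have pow: "(d/2) ^ DIM('a) = (d/2) * (d/2) ^ ?s"
      by (metis DIM_positive Suc_diff_1 power_Suc)
    have card: "real (card X) * (?w * (d / 2) ^ ?s) \<le> C" if "sep X" for X
    proof -
      have X: "X \<subseteq> A" "finite X" using that by (auto simp: sep_def)
      have disj: "disjoint_family_on (\<lambda>x. ball x (d/2)) X"
        unfolding disjoint_family_on_def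
      proof (intro ballI impI)
        fix x y assume "x \<in> X" "y \<in> X" "x \<noteq> y"
        then have "d \<le> dist x y" using that by (auto simp: sep_def)
        then show "ball x (d/2) \<inter> ball y (d/2) = {}"
          by (intro disjoint_ballI) auto
      qed
      have "real (card X) * (?w * (d / 2) ^ DIM('a)) = (\<Sum>x\<in>X. measure lebesgue (ball x (d/2)))"
        using d by (simp add: content_ball)
      also have "\<dots> = measure lebesgue (\<Union>x\<in>X. ball x (d/2))"
        using X disj emeasure_lborel_ball_finite by (intro measure_finite_Union[symmetric]) (auto simp: less_top)
      also have "\<dots> \<le> measure lebesgue (\<Union>x\<in>A. ball x (d/2))"
        using X by (intro measure_mono_fmeasurable) (auto intro: lmeasurable_open nbd)
      also have "\<dots> \<le> C * (d/2)" using d by (intro vol) auto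
      finally have "(d / 2) * (real (card X) * (?w * (d / 2) ^ ?s)) \<le> (d / 2) * C"
        unfolding pow by (simp add: ac_simps)
      then show ?thesis using d by (subst (asm) mult_le_cancel_left_pos) auto
    qed
    have bound: "real (card X) \<le> C / (?w * (d / 2) ^ ?s)" if "sep X" for X
      using card[OF that] w d by (simp add: pos_le_divide_eq)
    have "\<exists>X. sep X \<and> (\<forall>Y. sep Y \<longrightarrow> card Y \<le> card X)"
      using bound by (intro ex_has_greatest_nat[of sep "{}" card "Suc (nat \<lfloor>C / (?w * (d / 2) ^ ?s)\<rfloor>)"])
        (auto simp: le_nat_floor less_Suc_eq_le, simp add: sep_def)
    then obtain X where X: "sep X" "\<And>Y. sep Y \<Longrightarrow> card Y \<le> card X" by blast
    have cov: "\<exists>x\<in>X. dist x a \<le> d" if "a \<in> A" for a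
    proof (rule ccontr)
      assume *: "\<not> ?thesis"
      then have "sep (insert a X)" using X(1) that by (auto simp: sep_def dist_commute)
      moreover have "a \<notin> X" using * d by force
      ultimately show False using X(2)[of "insert a X"] X(1) by (simp add: sep_def)
    qed
    have finX: "finite X" using X(1) by (simp add: sep_def)
    obtain h where h: "bij_betw h {..<card X} X"
      using ex_bij_betw_nat_finite[OF finX] by (auto simp: atLeast0LessThan)
    define D where "D i = (if i < card X then cball (h i) d else {})" for i
    have "hausdorff_pre ?s (2 * d) A \<le> (\<Sum>i. hausdorff_weight ?s (D i))"
    proof (rule hausdorff_pre_le)
      show "A \<subseteq> (\<Union>i. D i)"
      proof
        fix a assume "a \<in> A"
        then obtain x where "x \<in> X" "dist x a \<le> d" using cov by blast
        moreover then obtain i where "i < card X" "h i = x"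
          using h by (metis bij_betw_imp_surj_on imageE lessThan_iff)
        ultimately show "a \<in> (\<Union>i. D i)" by (auto simp: D_def)
      qed
    qed (use d in \<open>auto simp: D_def\<close>)
    also have "\<dots> = (\<Sum>i<card X. hausdorff_weight ?s (D i))"
      by (rule suminf_finite) (auto simp: D_def)
    also have "\<dots> \<le> (\<Sum>i<card X. ennreal (?v * d ^ ?s))"
      using d by (intro sum_mono order_trans[OF hausdorff_weight_le[of _ "2 * d"]]) (auto simp: D_def)
    also have "\<dots> = ennreal (real (card X) * (?v * d ^ ?s))"
      using d by (simp add: ennreal_mult ennreal_of_nat_eq_real_of_nat)
    also have "\<dots> \<le> ennreal M"
    proof (rule ennreal_leI)
      have "real (card X) * (?v * d ^ ?s) \<le> (C / (?w * (d / 2) ^ ?s)) * (?v * d ^ ?s)"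
        using bound[OF X(1)] d by (intro mult_right_mono) auto
      also have "\<dots> = M" using d w by (simp add: M_def power_divide field_simps)
      finally show "real (card X) * (?v * d ^ ?s) \<le> M" .
    qed
    finally show ?thesis .
  qed
  have "hausdorff_outer_measure ?s A \<le> ennreal M"
    unfolding hausdorff_outer_measure_def
  proof (intro SUP_least)
    fix e :: real assume e: "e \<in> {0<..}"
    define d where "d = min (e / 2) d0"
    have "hausdorff_pre ?s e A \<le> hausdorff_pre ?s (2 * d) A"
      by (rule hausdorff_pre_antimono) (auto simp: d_def)
    also have "\<dots> \<le> ennreal M" using e d0 by (intro main) (auto simp: d_def)
    finally show "hausdorff_pre ?s e A \<le> ennreal M" .
  qed
  then show ?thesis by (metis ennreal_less_top infinity_ennreal_def order.strict_trans1)
qed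

text \<open>The segment from 0 to \<open>x\<close> thickened by a ball of radius \<open>d\<close>.
  It contains the cone with apex 0 over any bounded set that contains \<open>x\<close> and has
  diameter at most \<open>d\<close>; as a continuous image of a compact set it is
  measurable.\<close>

definition segment_tube :: "'a::euclidean_space \<Rightarrow> real \<Rightarrow> 'a set" where
  "segment_tube x d = (\<lambda>(t, z). t *\<^sub>R x + z) ` ({0..1} \<times> cball 0 d)"

lemma compact_segment_tube: "compact (segment_tube x d)"
  unfolding segment_tube_def
  by (intro compact_continuous_image continuous_intros compact_Times)
     (auto simp: case_prod_unfold intro!: continuous_intros)

text \<open>For a positive radius \<open>e\<close>, about \<open>R / e\<close> balls of radius
  \<open>2 * e\<close> centred at equally spaced points of the segment cover the tube.\<close>

lemma measure_segment_tube_le: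
  fixes x :: "'a::euclidean_space"
  assumes R: "norm x \<le> R" and d: "0 \<le> d"
  shows "measure lebesgue (segment_tube x d) \<le>
    unit_ball_vol (real DIM('a)) * 2 ^ DIM('a) * ((R + 3 * d) * d ^ (DIM('a) - 1))"
proof -
  let ?w = "unit_ball_vol (real DIM('a))" and ?s = "DIM('a) - 1"
  have R0: "0 \<le> R" using R norm_ge_zero order_trans by blast
  have pos: "measure lebesgue (segment_tube x e) \<le> ?w * 2 ^ DIM('a) * ((R + 3 * e) * e ^ ?s)"
    if e: "0 < e" for e
  proof -
    define N where "N = nat \<lceil>R / e\<rceil> + 1"
    have N: "R / e \<le> real N" "real N \<le> R / e + 2" "0 < N"
      unfolding N_def using R0 e by (auto simp: of_nat_ceiling) linarith+
    have sub: "segment_tube x e \<subseteq> (\<Union>j\<in>{..N}. cball ((real j / real N) *\<^sub>R x) (2 * e))"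
    proof
      fix y assume "y \<in> segment_tube x e"
      then obtain t z where y: "y = t *\<^sub>R x + z" "0 \<le> t" "t \<le> 1" "norm z \<le> e"
        by (auto simp: segment_tube_def)
      define j where "j = nat \<lfloor>t * real N\<rfloor>"
      have j: "real j \<le> t * real N" "t * real N \<le> real j + 1"
        unfolding j_def using y by (auto simp: of_nat_floor, linarith?)
      have "j \<le> N"
        using j(1) mult_right_mono[OF y(3), of "real N"] by simp
      have "\<bar>real j / real N - t\<bar> \<le> 1 / real N"
        using j N(3) by (simp add: abs_le_iff divide_simps)
      then have "\<bar>real j / real N - t\<bar> * norm x \<le> 1 / real N * R"
        using R by (intro mult_mono) auto
      also have "\<dots> \<le> e" using N e by (simp add: field_simps)
      finally have "norm ((real j / real N) *\<^sub>R x - t *\<^sub>R x) \<le> e"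
        by (metis norm_scaleR scaleR_left_diff_distrib)
      then have "norm ((real j / real N) *\<^sub>R x - y) \<le> 2 * e"
        using norm_triangle_ineq4[of "(real j / real N) *\<^sub>R x - t *\<^sub>R x" z] y
        by (simp add: algebra_simps)
      then show "y \<in> (\<Union>j\<in>{..N}. cball ((real j / real N) *\<^sub>R x) (2 * e))"
        using \<open>j \<le> N\<close> by (auto simp: dist_norm)
    qed
    have "measure lebesgue (segment_tube x e) \<le> measure lebesgue (\<Union>j\<in>{..N}. cball ((real j / real N) *\<^sub>R x) (2 * e))"
      by (intro measure_mono_fmeasurable sub fmeasurable.finite_UN)
         (auto intro: fmeasurableD lmeasurable_compact compact_segment_tube)
    also have "\<dots> \<le> (\<Sum>j\<in>{..N}. measure lebesgue (cball ((real j / real N) *\<^sub>R x) (2 * e)))"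
      by (intro measure_UNION_le) auto
    also have "\<dots> = (real N + 1) * (?w * (2 * e) ^ DIM('a))"
      using e by (simp add: content_cball algebra_simps)
    also have "\<dots> \<le> (R / e + 3) * (?w * (2 * e) ^ DIM('a))"
      using N e by (intro mult_right_mono) auto
    also have "(2 * e) ^ DIM('a) = 2 ^ DIM('a) * (e * e ^ ?s)"
      unfolding power_mult_distrib by (metis DIM_positive Suc_diff_1 power_Suc)
    also have "(R / e + 3) * (?w * (2 ^ DIM('a) * (e * e ^ ?s))) =
        ?w * 2 ^ DIM('a) * ((R + 3 * e) * e ^ ?s)"
      using e by (simp add: field_simps)
    finally show ?thesis .
  qed
  \<comment> \<open>Radius 0 occurs, since a covering set may be a single point; the bound is passed
    to \<open>d\<close> from larger radii.\<close>
  have "((\<lambda>e. ?w * 2 ^ DIM('a) * ((R + 3 * e) * e ^ ?s)) \<longlongrightarrow>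
      ?w * 2 ^ DIM('a) * ((R + 3 * d) * d ^ ?s)) (at_right d)"
    by (intro tendsto_intros)
  moreover have "eventually (\<lambda>e. measure lebesgue (segment_tube x d) \<le>
      ?w * 2 ^ DIM('a) * ((R + 3 * e) * e ^ ?s)) (at_right d)"
  proof (rule eventually_at_right_less[THEN eventually_mono])
    fix e assume "d < e"
    have "measure lebesgue (segment_tube x d) \<le> measure lebesgue (segment_tube x e)"
      using \<open>d < e\<close> by (intro measure_mono_fmeasurable)
        (auto intro!: fmeasurableD lmeasurable_compact compact_segment_tube, auto simp: segment_tube_def)
    then show "measure lebesgue (segment_tube x d) \<le> ?w * 2 ^ DIM('a) * ((R + 3 * e) * e ^ ?s)"
      using pos[of e] d \<open>d < e\<close> by linarith
  qed
  ultimately show ?thesis by (intro tendsto_lowerbound) auto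
qed

text \<open>A covering set of diameter \<open>d \<le> 1\<close> is the base of a cone inside a tube
  whose volume is of the order of \<open>d ^ (n - 1)\<close>, the order of its weight. This is the
  source of positivity of Hausdorff measure. \<open>Z\<close> ranges over Borel subsets because the
  cone over an arbitrary \<open>B\<close> need not be measurable.\<close>

lemma emeasure_cone_le_hausdorff:
  fixes A :: "'a::euclidean_space set"
  assumes A: "A \<subseteq> cball 0 R"
  shows "\<exists>q>0. \<forall>B Z. B \<subseteq> A \<longrightarrow> Z \<in> sets lborel \<longrightarrow> Z \<subseteq> {t *\<^sub>R x | t x. 0 \<le> t \<and> t \<le> 1 \<and> x \<in> B} \<longrightarrow>
    emeasure lborel Z \<le> ennreal q * hausdorff_outer_measure (DIM('a) - 1) B"
proof -
  let ?w = "unit_ball_vol (real DIM('a))" and ?s = "DIM('a) - 1"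
  let ?v = "unit_ball_vol (real ?s)"
  define R' where "R' = max R 0"
  \<comment> \<open>With diameters at most 1, \<open>R' + 3\<close> dominates the factor
    \<open>R' + 3 * d\<close> of the tube estimate.\<close>
  define c where "c = ?w * 2 ^ DIM('a) * (R' + 3)"
  define q where "q = c * 2 ^ ?s / ?v"
  have v: "0 < ?v" by (rule unit_ball_vol_pos) simp
  have c: "0 < c" unfolding c_def by (auto intro!: mult_pos_pos simp: R'_def)
  then have q: "0 < q" using v by (auto simp: q_def)
  show ?thesis
  proof (intro exI conjI allI impI)
    fix B Z assume B: "B \<subseteq> A" and Z: "Z \<in> sets lborel"
      and ZB: "Z \<subseteq> {t *\<^sub>R x | t x. 0 \<le> t \<and> t \<le> 1 \<and> x \<in> B}"
    have "emeasure lborel Z \<le> ennreal q * hausdorff_pre ?s 1 B"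
    proof (rule le_mult_hausdorff_pre[OF q])
      fix C :: "nat \<Rightarrow> 'a set"
      assume C: "B \<subseteq> (\<Union>i. C i)" "\<And>i. bounded (C i)" "\<And>i. diameter (C i) \<le> 1"
      define x where "x i = (SOME x. x \<in> C i \<inter> B)" for i
      have x: "x i \<in> C i \<inter> B" if "C i \<inter> B \<noteq> {}" for i
        unfolding x_def using that some_in_eq by blast
      define U where "U i = (if C i \<inter> B = {} then {} else segment_tube (x i) (diameter (C i)))" for i
      have "Z \<subseteq> (\<Union>i. U i)"
      proof
        fix z assume "z \<in> Z"
        then obtain t y where z: "z = t *\<^sub>R y" "0 \<le> t" "t \<le> 1" "y \<in> B" using ZB by blast
        then obtain i where i: "y \<in> C i" using C by blast
        then have ne: "C i \<inter> B \<noteq> {}" using z by blast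
        have "norm (y - x i) \<le> diameter (C i)"
          using diameter_bounded_bound[OF C(2) i, of "x i"] x[OF ne] by (auto simp: dist_norm)
        then have "norm (t *\<^sub>R (y - x i)) \<le> diameter (C i)"
          using z mult_mono[of t 1 "norm (y - x i)" "diameter (C i)"] by auto
        then have "z \<in> segment_tube (x i) (diameter (C i))"
          unfolding segment_tube_def using z
          by (intro image_eqI[of _ _ "(t, t *\<^sub>R (y - x i))"]) (auto simp: algebra_simps)
        then show "z \<in> (\<Union>i. U i)" using ne by (auto simp: U_def)
      qed
      moreover have U: "U i \<in> sets lborel" for i
        using compact_segment_tube by (auto simp: U_def intro: borel_compact)
      ultimately have "emeasure lborel Z \<le> emeasure lborel (\<Union>i. U i)"
        by (intro emeasure_mono) auto
      also have "\<dots> \<le> (\<Sum>i. emeasure lborel (U i))"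
        using U by (intro emeasure_subadditive_countably) auto
      also have "\<dots> \<le> (\<Sum>i. ennreal q * hausdorff_weight ?s (C i))"
      proof (intro suminf_le allI)
        fix i
        show "emeasure lborel (U i) \<le> ennreal q * hausdorff_weight ?s (C i)"
        proof (cases "C i \<inter> B = {}")
          case False
          let ?d = "diameter (C i)"
          have d: "0 \<le> ?d" "?d \<le> 1" using C diameter_ge_0 by auto
          have xR: "norm (x i) \<le> R'" using x[OF False] A B by (auto simp: R'_def)
          have "emeasure lborel (U i) = ennreal (measure lebesgue (U i))"
            using False emeasure_compact_finite[OF compact_segment_tube[of "x i" ?d]]
            by (auto simp: U_def borel_compact compact_segment_tube intro!: emeasure_eq_ennreal_measure)
          also have "\<dots> \<le> ennreal (?w * 2 ^ DIM('a) * ((R' + 3 * ?d) * ?d ^ ?s))"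
            using False measure_segment_tube_le[OF xR d(1)] by (auto simp: U_def intro!: ennreal_leI)
          also have "\<dots> \<le> ennreal (c * ?d ^ ?s)"
            unfolding c_def using d
            by (intro ennreal_leI) (auto simp: mult.assoc intro!: mult_left_mono mult_right_mono)
          also have "\<dots> = ennreal q * hausdorff_weight ?s (C i)"
          proof -
            have "c * ?d ^ ?s = q * (?v * (?d / 2) ^ ?s)"
              unfolding q_def power_divide using v by (simp add: less_imp_neq[symmetric] del: of_nat_diff)
            moreover have "hausdorff_weight ?s (C i) = ennreal (?v * (?d / 2) ^ ?s)"
              using False by (auto simp: hausdorff_weight_def)
            moreover have "0 \<le> ?v * (?d / 2) ^ ?s" using v d by (intro mult_nonneg_nonneg) auto
            ultimately show ?thesis using q by (simp only: ennreal_mult less_imp_le)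
          qed
          finally show ?thesis .
        qed (simp add: U_def)
      qed auto
      also have "\<dots> = ennreal q * (\<Sum>i. hausdorff_weight ?s (C i))"
        by (rule ennreal_suminf_cmult)
      finally show "emeasure lborel Z \<le> \<dots>" .
    qed
    also have "\<dots> \<le> ennreal q * hausdorff_outer_measure ?s B"
      by (intro mult_left_mono hausdorff_pre_le_outer) auto
    finally show "emeasure lborel Z \<le> ennreal q * hausdorff_outer_measure ?s B" .
  qed (rule q)
qed

section \<open>Invariant measures and volume-preserving linear maps\<close>

lemma emeasure_lborel_open_pos:
  fixes S :: "'a::euclidean_space set"
  assumes "open S" "x \<in> S"
  shows "0 < emeasure lborel S"
  using open_not_negligible[OF assms(1)] assms
  by (auto simp: negligible_iff_null_sets null_sets_def zero_less_iff_neq_zero)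

lemma emeasure_lborel_scaleR_vimage:
  fixes A :: "'a::euclidean_space set"
  assumes c: "0 < c" and A [measurable]: "A \<in> sets borel"
  shows "emeasure lborel A = ennreal (c ^ DIM('a)) * emeasure lborel {x. c *\<^sub>R x \<in> A}"
proof -
  have "emeasure lborel A = emeasure (density (distr lborel borel (\<lambda>x. 0 + c *\<^sub>R x)) (\<lambda>_. \<bar>c\<bar> ^ DIM('a))) A"
    using c by (subst lborel_affine[of c 0]) auto
  also have "\<dots> = ennreal (c ^ DIM('a)) * emeasure (distr lborel borel (\<lambda>x::'a. c *\<^sub>R x)) A"
    using c A by (simp add: emeasure_density nn_integral_cmult_indicator)
  also have "emeasure (distr lborel borel (\<lambda>x::'a. c *\<^sub>R x)) A = emeasure lborel {x. c *\<^sub>R x \<in> A}"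
    using A by (subst emeasure_distr) (auto intro!: arg_cong[where f="emeasure lborel"])
  finally show ?thesis .
qed

lemma measure_scaleR_image:
  fixes S :: "'a::euclidean_space set"
  assumes "0 < c"
  shows "measure lebesgue ((*\<^sub>R) c ` S) = c ^ DIM('a) * measure lebesgue S"
  using measure_lebesgue_affine[of c 0 S] assms by simp

lemma sigma_finite_measureI_ball:
  fixes M :: "'a::real_normed_vector measure"
  assumes sets: "sets M = sets borel" and fin: "\<And>k::nat. emeasure M (ball 0 (real k)) < \<infinity>"
  shows "sigma_finite_measure M"
proof
  have "x \<in> (\<Union>k::nat. ball 0 (real k))" for x :: 'a
    using reals_Archimedean2[of "norm x"] by auto
  then show "\<exists>A. countable A \<and> A \<subseteq> sets M \<and> \<Union> A = space M \<and> (\<forall>a\<in>A. emeasure M a \<noteq> \<infinity>)"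
    using fin sets_eq_imp_space_eq[OF sets]
    by (intro exI[of _ "range (\<lambda>k::nat. ball 0 (real k))"]) (auto simp: sets less_top)
qed

text \<open>
  Uniqueness of invariant measures: evaluate the integral of \<open>1\<^sub>E (x + y) 1\<^sub>F y\<close> over \<open>N \<Otimes> M\<close>
  in both orders.
\<close>

lemma invariant_measures_proportional:
  fixes M N :: "'a::euclidean_space measure"
  assumes sM: "sets M = sets borel" and sN: "sets N = sets borel"
    and fM: "sigma_finite_measure M" and fN: "sigma_finite_measure N"
    and aM: "AE x in M. x \<in> W" and aN: "AE x in N. x \<in> W"
    and W: "\<And>w. w \<in> W \<Longrightarrow> - w \<in> W"
    and iM: "\<And>w E. w \<in> W \<Longrightarrow> E \<in> sets borel \<Longrightarrow> emeasure M {x. x + w \<in> E} = emeasure M E"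
    and iN: "\<And>w E. w \<in> W \<Longrightarrow> E \<in> sets borel \<Longrightarrow> emeasure N {x. x + w \<in> E} = emeasure N E"
    and E: "E \<in> sets borel" and F: "F \<in> sets borel"
  shows "emeasure N E * emeasure M F = emeasure M E * emeasure N {x. - x \<in> F}"
proof -
  interpret M: sigma_finite_measure M by fact
  interpret N: sigma_finite_measure N by fact
  interpret pair_sigma_finite N M ..
  have spM: "space M = UNIV" and spN: "space N = UNIV"
    using sets_eq_imp_space_eq[OF sM] sets_eq_imp_space_eq[OF sN] by auto
  note [measurable_cong] = sM sN
  note [measurable] = E F
  have ind: "(\<integral>\<^sup>+x. indicator A x * indicator B x \<partial>L) = emeasure L (A \<inter> B)"
    if "A \<in> sets L" "B \<in> sets L" for A B and L :: "'a measure"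
  proof -
    have "(\<integral>\<^sup>+x. indicator A x * indicator B x \<partial>L) = (\<integral>\<^sup>+x. indicator (A \<inter> B) x \<partial>L)"
      by (intro nn_integral_cong) (auto simp: indicator_def)
    also have "\<dots> = emeasure L (A \<inter> B)" using that by (intro nn_integral_indicator) auto
    finally show ?thesis .
  qed
  have "(\<integral>\<^sup>+x. (\<integral>\<^sup>+y. indicator E (x + y) * indicator F y \<partial>M) \<partial>N) =
    (\<integral>\<^sup>+y. (\<integral>\<^sup>+x. indicator E (x + y) * indicator F y \<partial>N) \<partial>M)"
    by (rule Fubini'[symmetric]) measurable
  also have "\<dots> = (\<integral>\<^sup>+y. emeasure N E * indicator F y \<partial>M)"
  proof (rule nn_integral_cong_AE)
    \<comment> \<open>Invariance is available for translation vectors in \<open>W\<close>, which is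
      where both measures are concentrated. A measure on a hyperplane can thus be handled inside the
      full space.\<close>
    show "AE y in M. (\<integral>\<^sup>+x. indicator E (x + y) * indicator F y \<partial>N) = emeasure N E * indicator F y"
      using aM
    proof eventually_elim
      case (elim y)
      have "(\<integral>\<^sup>+x. indicator E (x + y) * indicator F y \<partial>N) =
          (\<integral>\<^sup>+x. indicator {x. x + y \<in> E} x \<partial>N) * indicator F y"
        by (subst nn_integral_multc[symmetric]) (auto simp: indicator_def intro!: nn_integral_cong)
      also have "(\<integral>\<^sup>+x. indicator {x. x + y \<in> E} x \<partial>N) = emeasure N {x. x + y \<in> E}"
        by (rule nn_integral_indicator) (auto simp: sN)
      finally show ?case using iN[OF elim E] by simp
    qed
  qed
  also have "\<dots> = emeasure N E * emeasure M F"
    by (rule nn_integral_cmult_indicator) (simp add: sM)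
  finally have 1: "(\<integral>\<^sup>+x. (\<integral>\<^sup>+y. indicator E (x + y) * indicator F y \<partial>M) \<partial>N) = emeasure N E * emeasure M F" .
  have "(\<integral>\<^sup>+x. (\<integral>\<^sup>+y. indicator E (x + y) * indicator F y \<partial>M) \<partial>N) =
      (\<integral>\<^sup>+x. (\<integral>\<^sup>+z. indicator E z * indicator F (z - x) \<partial>M) \<partial>N)"
  proof (rule nn_integral_cong_AE)
    show "AE x in N. (\<integral>\<^sup>+y. indicator E (x + y) * indicator F y \<partial>M) =
      (\<integral>\<^sup>+z. indicator E z * indicator F (z - x) \<partial>M)"
      using aN
    proof eventually_elim
      case (elim x)
      have "(\<integral>\<^sup>+y. indicator E (x + y) * indicator F y \<partial>M) =
         (\<integral>\<^sup>+y. indicator {y. x + y \<in> E} y * indicator F y \<partial>M)"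
        by (intro nn_integral_cong) (auto simp: indicator_def)
      also have "\<dots> = emeasure M ({y. x + y \<in> E} \<inter> F)"
        by (rule ind) (auto simp: sM)
      \<comment> \<open>Substitution \<open>z = x + y\<close>: the set becomes the translate by
        \<open>x\<close> of a single set, to which the invariance of \<open>M\<close>
        applies.\<close>
      also have "{y. x + y \<in> E} \<inter> F = {y. y + x \<in> E \<inter> {z. z - x \<in> F}}"
        by (auto simp: add.commute)
      also have "emeasure M \<dots> = emeasure M (E \<inter> {z. z - x \<in> F})"
        by (rule iM[OF elim]) measurable
      also have "\<dots> = (\<integral>\<^sup>+z. indicator E z * indicator {z. z - x \<in> F} z \<partial>M)"
        by (rule ind[symmetric]) (auto simp: sM)
      finally show ?case by (simp add: indicator_def)
    qed
  qed
  also have "\<dots> = (\<integral>\<^sup>+z. (\<integral>\<^sup>+x. indicator E z * indicator F (z - x) \<partial>N) \<partial>M)"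
    by (rule Fubini'[symmetric]) measurable
  also have "\<dots> = (\<integral>\<^sup>+z. emeasure N {x. - x \<in> F} * indicator E z \<partial>M)"
  proof (rule nn_integral_cong_AE)
    show "AE z in M. (\<integral>\<^sup>+x. indicator E z * indicator F (z - x) \<partial>N) = emeasure N {x. - x \<in> F} * indicator E z"
      using aM
    proof eventually_elim
      case (elim z)
      have "(\<integral>\<^sup>+x. indicator E z * indicator F (z - x) \<partial>N) =
          (\<integral>\<^sup>+x. indicator {x. z - x \<in> F} x \<partial>N) * indicator E z"
        by (subst nn_integral_multc[symmetric]) (auto simp: indicator_def intro!: nn_integral_cong)
      also have "(\<integral>\<^sup>+x. indicator {x. z - x \<in> F} x \<partial>N) = emeasure N {x. x + (- z) \<in> {x. - x \<in> F}}"
        by (subst nn_integral_indicator) (auto simp: sN)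
      also have "\<dots> = emeasure N {x. - x \<in> F}"
        by (rule iN[OF W[OF elim]]) measurable
      finally show ?case .
    qed
  qed
  also have "\<dots> = emeasure N {x. - x \<in> F} * emeasure M E"
    by (rule nn_integral_cmult_indicator) (simp add: sM)
  finally show ?thesis using 1 by (simp add: mult.commute)
qed

lemma emeasure_lborel_translate:
  fixes E :: "'a::euclidean_space set"
  assumes [measurable]: "E \<in> sets borel"
  shows "emeasure lborel {x. x + w \<in> E} = emeasure lborel E"
proof -
  have "emeasure lborel E = emeasure (distr lborel borel ((+) w)) E"
    by (simp add: lborel_distr_plus)
  also have "\<dots> = emeasure lborel {x. x + w \<in> E}"
    by (subst emeasure_distr) (auto simp: vimage_def add.commute)
  finally show ?thesis by simp
qed

text \<open>The image of Lebesgue measure under \<open>f\<close> is finite on balls, and invariant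
  under translations because a shift by \<open>w\<close> pulls back to a shift by
  \<open>g w\<close>; so it is a multiple of Lebesgue measure. The factor \<open>c\<close> is the
  reciprocal of the absolute value of the determinant of \<open>f\<close>.\<close>

lemma linear_vimage_lborel:
  fixes f :: "'a::euclidean_space \<Rightarrow> 'a"
  assumes f: "linear f" and g: "linear g" and fg: "\<And>x. f (g x) = x" "\<And>x. g (f x) = x"
  obtains c where "0 < c" "c < \<infinity>" "\<And>E. E \<in> sets borel \<Longrightarrow> emeasure lborel {x. f x \<in> E} = c * emeasure lborel E"
proof -
  have [measurable]: "f \<in> borel_measurable borel" "g \<in> borel_measurable borel"
    using f g by (auto intro!: borel_measurable_continuous_onI linear_continuous_on linear_conv_bounded_linear[THEN iffD1])
  let ?N = "distr lborel borel f"
  have N: "emeasure ?N E = emeasure lborel {x. f x \<in> E}" if "E \<in> sets borel" for E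
    using that by (subst emeasure_distr) (auto simp: vimage_def)
  have bd: "bounded {x. f x \<in> ball 0 r}" for r
  proof -
    have "{x. f x \<in> ball 0 r} = g ` ball 0 r"
      using fg imageI[of "f _" "ball 0 r" g] by auto
    then show ?thesis
      using g by (simp add: bounded_linear_image linear_conv_bounded_linear)
  qed
  have opn: "open {x. f x \<in> ball 0 r}" for r
    using f by (intro open_vimage[unfolded vimage_def] open_ball linear_continuous_on) (auto simp: linear_conv_bounded_linear)
  have fin: "emeasure ?N (ball 0 r) < \<infinity>" for r
    using emeasure_bounded_finite[OF bd] by (subst N) auto
  have pos: "0 < emeasure ?N (ball 0 1)"
  proof -
    have "0 \<in> {x. f x \<in> ball 0 1}" using linear_0[OF f] by simp
    then have "0 < emeasure lborel {x. f x \<in> ball 0 1}" by (rule emeasure_lborel_open_pos[OF opn])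
    then show ?thesis by (subst N) auto
  qed
  have b1: "emeasure lborel (ball (0::'a) 1) \<noteq> 0"
    using emeasure_lborel_open_pos[of "ball (0::'a) 1" 0] by auto
  have ratio: "emeasure ?N E * emeasure lborel (ball (0::'a) 1) = emeasure lborel E * emeasure ?N {x. - x \<in> ball 0 1}"
    if "E \<in> sets borel" for E
  proof (rule invariant_measures_proportional[where W=UNIV])
    show "sigma_finite_measure ?N"
      by (rule sigma_finite_measureI_ball) (use fin in auto)
    show "emeasure ?N {x. x + w \<in> E} = emeasure ?N E" if [measurable]: "E \<in> sets borel" for w E
    proof -
      have "emeasure ?N {x. x + w \<in> E} = emeasure lborel {x. x + g w \<in> {x. f x \<in> E}}"
        by (subst N) (simp_all add: linear_add[OF f] fg)
      also have "\<dots> = emeasure ?N E" by (subst emeasure_lborel_translate) (simp_all add: N)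
      finally show ?thesis .
    qed
  qed (use that in \<open>auto intro: lborel.sigma_finite_measure_axioms emeasure_lborel_translate\<close>)
  have sym: "{x::'a. - x \<in> ball 0 1} = ball 0 1" by auto
  define c where "c = emeasure ?N (ball 0 1) / emeasure lborel (ball (0::'a) 1)"
  show thesis
  proof
    show "0 < c" unfolding c_def using pos emeasure_lborel_ball_finite[of "0::'a" 1]
      by (auto simp: ennreal_zero_less_divide)
    show "c < \<infinity>" unfolding c_def using fin[of 1] b1
      by (metis ennreal_divide_eq_top_iff infinity_ennreal_def less_top less_irrefl)
    fix E :: "'a set" assume E: "E \<in> sets borel"
    have "emeasure ?N E = emeasure ?N E * emeasure lborel (ball (0::'a) 1) / emeasure lborel (ball (0::'a) 1)"
      using b1 emeasure_lborel_ball_finite[of "0::'a" 1] by (simp add: ennreal_mult_divide_eq)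
    also have "\<dots> = c * emeasure lborel E"
      unfolding ratio[OF E] sym c_def by (simp add: ennreal_times_divide mult.commute)
    finally show "emeasure lborel {x. f x \<in> E} = c * emeasure lborel E" using N[OF E] by simp
  qed
qed

section \<open>Reflections and shears preserve volume\<close>

text \<open>The reflection in the hyperplane orthogonal to \<open>w\<close>. For
  \<open>w = 0\<close> it is the identity, which lets \<open>hyper_reflection_swap\<close> cover the
  case \<open>u = v\<close>.\<close>

definition hyper_reflection :: "'a::real_inner \<Rightarrow> 'a \<Rightarrow> 'a" where
  "hyper_reflection w x = x - (2 * (x \<bullet> w) / (w \<bullet> w)) *\<^sub>R w"

lemma linear_hyper_reflection: "linear (hyper_reflection w)"
  by (rule linearI) (auto simp: hyper_reflection_def algebra_simps inner_add_left add_divide_distrib)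

lemma hyper_reflection_involution [simp]: "hyper_reflection w (hyper_reflection w x) = x"
  by (cases "w = 0") (auto simp: hyper_reflection_def algebra_simps inner_diff_left)

lemma norm_hyper_reflection [simp]: "norm (hyper_reflection w x) = norm x"
proof (cases "w = 0")
  case False
  then have "hyper_reflection w x \<bullet> hyper_reflection w x = x \<bullet> x"
    by (simp add: hyper_reflection_def inner_diff_left inner_diff_right inner_commute)
  then show ?thesis by (simp add: norm_eq_sqrt_inner)
qed (simp add: hyper_reflection_def)

lemma inner_hyper_reflection: "hyper_reflection w x \<bullet> y = x \<bullet> hyper_reflection w y"
  by (simp add: hyper_reflection_def inner_diff_left inner_diff_right inner_commute)

lemma hyper_reflection_swap:
  assumes "norm u = norm v"
  shows "hyper_reflection (u - v) u = v"
proof (cases "u = v")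
  case False
  have "u \<bullet> u = v \<bullet> v" using assms by (simp add: norm_eq_sqrt_inner)
  then have "2 * (u \<bullet> (u - v)) = (u - v) \<bullet> (u - v)"
    by (simp add: inner_diff_left inner_diff_right inner_commute)
  then show ?thesis using False by (simp add: hyper_reflection_def)
qed (simp add: hyper_reflection_def)

lemma dist_hyper_reflection [simp]: "dist (hyper_reflection w x) (hyper_reflection w y) = dist x y"
  by (metis dist_norm linear_diff linear_hyper_reflection norm_hyper_reflection)

lemma borel_measurable_hyper_reflection [measurable]:
  "hyper_reflection (w::'a::euclidean_space) \<in> borel_measurable borel"
  unfolding hyper_reflection_def by measurable

text \<open>The unit ball is its own preimage, so the volume factor of this linear map is 1.\<close>

lemma emeasure_lborel_hyper_reflection:
  fixes E :: "'a::euclidean_space set"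
  assumes E: "E \<in> sets borel"
  shows "emeasure lborel {x. hyper_reflection w x \<in> E} = emeasure lborel E"
proof -
  obtain c where c: "\<And>E. E \<in> sets borel \<Longrightarrow> emeasure lborel {x. hyper_reflection w x \<in> E} = c * emeasure lborel E"
    using linear_vimage_lborel[OF linear_hyper_reflection linear_hyper_reflection, of w w] by auto
  have b1: "emeasure lborel (ball (0::'a) 1) \<noteq> 0"
    using emeasure_lborel_open_pos[of "ball (0::'a) 1" 0] by auto
  have "{x. hyper_reflection w x \<in> ball 0 1} = ball 0 1" by auto
  then have "emeasure lborel (ball (0::'a) 1) = c * emeasure lborel (ball (0::'a) 1)"
    using c[of "ball 0 1"] by simp
  then have "c = 1" using b1 emeasure_lborel_ball_finite[of "0::'a" 1]
    by (metis ennreal_mult_divide_eq ennreal_divide_self infinity_ennreal_def less_irrefl)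
  then show ?thesis using c[OF E] by simp
qed

text \<open>A shear is conjugate to its inverse by a reflection, so its volume factor squares to 1.\<close>

lemma emeasure_lborel_shear:
  fixes u w :: "'a::euclidean_space"
  assumes E: "E \<in> sets borel" and uw: "w \<bullet> u = 0"
  shows "emeasure lborel {x. x + (x \<bullet> u) *\<^sub>R w \<in> E} = emeasure lborel E"
proof -
  let ?f = "\<lambda>x. x + (x \<bullet> u) *\<^sub>R w" and ?g = "\<lambda>x. x - (x \<bullet> u) *\<^sub>R w"
  have lf: "linear ?f" and lg: "linear ?g"
    by (auto intro!: linearI simp: algebra_simps inner_add_left)
  obtain c where c: "0 < c" "c < \<infinity>" "\<And>E. E \<in> sets borel \<Longrightarrow> emeasure lborel {x. ?f x \<in> E} = c * emeasure lborel E"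
    using linear_vimage_lborel[OF lf lg] uw by (auto simp: algebra_simps inner_diff_left inner_add_left)
  let ?r = "hyper_reflection w"
  have frf: "?f (?r (?f x)) = ?r x" for x
    using uw by (cases "w = 0")
      (auto simp: hyper_reflection_def inner_add_left inner_diff_left inner_commute algebra_simps add_divide_distrib,
       simp add: scaleR_add_left[symmetric])
  define b where "b = ball (0::'a) 1"
  have [measurable]: "b \<in> sets borel" by (simp add: b_def)
  have "emeasure lborel b = emeasure lborel {x. ?r x \<in> b}"
    by (rule emeasure_lborel_hyper_reflection[symmetric]) simp
  also have "\<dots> = emeasure lborel {x. ?f x \<in> {y. ?r y \<in> {z. ?f z \<in> b}}}"
    using frf by simp
  also have "\<dots> = c * emeasure lborel {y. ?r y \<in> {z. ?f z \<in> b}}"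
    by (rule c(3)) measurable
  also have "emeasure lborel {y. ?r y \<in> {z. ?f z \<in> b}} = emeasure lborel {z. ?f z \<in> b}"
    by (rule emeasure_lborel_hyper_reflection) measurable
  also have "\<dots> = c * emeasure lborel b" by (rule c(3)) simp
  finally have cc: "emeasure lborel b = (c * c) * emeasure lborel b" by (simp add: mult.assoc)
  have b1: "emeasure lborel b \<noteq> 0"
    unfolding b_def using emeasure_lborel_open_pos[of "ball (0::'a) 1" 0] by auto
  then have "c * c = 1" using cc emeasure_lborel_ball_finite[of "0::'a" 1, folded b_def]
    by (metis ennreal_mult_divide_eq ennreal_divide_self infinity_ennreal_def less_irrefl)
  then have "c = 1"
  proof -
    obtain d where d: "c = ennreal d" "0 \<le> d" using c(2) by (cases c) auto
    then have "ennreal (d * d) = ennreal 1" using \<open>c * c = 1\<close> by (simp add: ennreal_mult)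
    then have "d * d = 1" using d(2) by (subst (asm) ennreal_inj) auto
    then have "d = 1" using d(2) by (metis abs_of_nonneg abs_square_eq_1 power2_eq_square)
    then show ?thesis using d by simp
  qed
  then show ?thesis using c(3)[OF E] by simp
qed

section \<open>The gauge of a convex body and Hausdorff measure on hyperplanes\<close>

lemma power_diff_le:
  fixes a b :: real
  assumes "0 \<le> b" "b \<le> a"
  shows "a ^ n - b ^ n \<le> real n * (a - b) * a ^ (n - 1)"
proof (induction n)
  case (Suc n)
  have "a ^ Suc n - b ^ Suc n = a * (a ^ n - b ^ n) + b ^ n * (a - b)"
    by (simp add: algebra_simps)
  also have "\<dots> \<le> a * (real n * (a - b) * a ^ (n - 1)) + a ^ n * (a - b)"
    using assms Suc by (intro add_mono mult_left_mono mult_right_mono power_mono) auto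
  also have "\<dots> = real (Suc n) * (a - b) * a ^ n"
    by (cases n) (auto simp: algebra_simps)
  finally show ?case by simp
qed simp

section \<open>Polar body and gauge\<close>

definition polar_body :: "'a::real_inner set \<Rightarrow> 'a set" where
  "polar_body K = {p. \<forall>y\<in>K. p \<bullet> y \<le> 1}"

text \<open>A supremum over the polar body instead of an infimum of dilation factors: for a convex
  body around the origin it is attained, and the maximisers \<open>p\<close> are the subgradients of
  the gauge at \<open>x\<close>, with which all differentiability arguments work.\<close>

definition body_gauge :: "'a::real_inner set \<Rightarrow> 'a \<Rightarrow> real" where
  "body_gauge K x = (SUP p\<in>polar_body K. p \<bullet> x)"

locale body =
  fixes K :: "'a::euclidean_space set"
  assumes compact_K: "compact K" and convex_K: "convex K" and zero_K: "0 \<in> interior K"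
begin

abbreviation "P \<equiv> polar_body K"
abbreviation "g \<equiv> body_gauge K"

text \<open>Some radius of a ball about 0 inside \<open>K\<close>, not necessarily the largest;
  \<open>outr\<close> is likewise any radius of an enclosing ball.\<close>

definition inr :: real where "inr = (SOME r. 0 < r \<and> cball 0 r \<subseteq> K)"
definition outr :: real where "outr = (SOME r. 0 < r \<and> K \<subseteq> cball 0 r)"

lemma inr: "0 < inr" "cball 0 inr \<subseteq> K"
proof -
  have "\<exists>r. 0 < r \<and> cball 0 r \<subseteq> K" using zero_K by (auto simp: mem_interior_cball)
  from someI_ex[OF this] show "0 < inr" "cball 0 inr \<subseteq> K" by (auto simp: inr_def)
qed

lemma outr: "0 < outr" "K \<subseteq> cball 0 outr"
proof -
  have "\<exists>r. 0 < r \<and> K \<subseteq> cball 0 r"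
    using compact_imp_bounded[OF compact_K] by (auto simp: bounded_pos)
  from someI_ex[OF this] show "0 < outr" "K \<subseteq> cball 0 outr" by (auto simp: outr_def)
qed

lemma in_K_if_norm_le: "norm x \<le> inr \<Longrightarrow> x \<in> K"
  using inr(2) by auto

lemma norm_le_outr: "x \<in> K \<Longrightarrow> norm x \<le> outr"
  using outr(2) by auto

lemma norm_polar_le: assumes "p \<in> P" shows "norm p \<le> 1 / inr"
proof (cases "p = 0")
  case False
  have "(inr / norm p) *\<^sub>R p \<in> K" using inr False by (intro in_K_if_norm_le) auto
  then have "p \<bullet> ((inr / norm p) *\<^sub>R p) \<le> 1" using assms unfolding polar_body_def by blast
  then have "inr * norm p \<le> 1" using False by (simp add: dot_square_norm power2_eq_square)
  then show ?thesis using inr by (simp add: field_simps)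
qed (use inr in auto)

lemma zero_polar: "0 \<in> P" by (simp add: polar_body_def)

lemma compact_polar: "compact P"
  unfolding compact_eq_bounded_closed
proof
  show "bounded P" using norm_polar_le by (auto simp: bounded_iff)
  have "P = (\<Inter>y\<in>K. {p. y \<bullet> p \<le> 1})" by (auto simp: polar_body_def inner_commute)
  then show "closed P" by (auto intro: closed_halfspace_le)
qed

lemma bdd_polar: "bdd_above ((\<lambda>p. p \<bullet> x) ` P)"
proof (rule bdd_aboveI2)
  fix p assume "p \<in> P"
  then show "p \<bullet> x \<le> 1 / inr * norm x"
    by (intro order_trans[OF norm_cauchy_schwarz] mult_right_mono norm_polar_le) auto
qed

lemma inner_polar_le: "p \<in> P \<Longrightarrow> p \<bullet> x \<le> g x"
  unfolding body_gauge_def by (intro cSUP_upper bdd_polar)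

lemma gauge_attained: obtains p where "p \<in> P" "p \<bullet> x = g x"
proof -
  have "\<exists>p\<in>P. \<forall>q\<in>P. q \<bullet> x \<le> p \<bullet> x"
    by (intro continuous_attains_sup compact_polar continuous_intros) (use zero_polar in auto)
  then obtain p where p: "p \<in> P" "\<And>q. q \<in> P \<Longrightarrow> q \<bullet> x \<le> p \<bullet> x" by blast
  then have "g x \<le> p \<bullet> x" unfolding body_gauge_def by (intro cSUP_least) auto
  with p inner_polar_le[of p x] show thesis by (intro that) auto
qed

lemma gauge_nonneg: "0 \<le> g x"
  using inner_polar_le[OF zero_polar, of x] by simp

lemma gauge_scaleR: assumes "0 \<le> t" shows "g (t *\<^sub>R x) = t * g x"
proof (rule antisym)
  obtain p where "p \<in> P" "p \<bullet> (t *\<^sub>R x) = g (t *\<^sub>R x)" by (rule gauge_attained)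
  then show "g (t *\<^sub>R x) \<le> t * g x"
    using mult_left_mono[OF inner_polar_le[of p x] assms] by simp
  obtain p where "p \<in> P" "p \<bullet> x = g x" by (rule gauge_attained)
  then show "t * g x \<le> g (t *\<^sub>R x)" using inner_polar_le[of p "t *\<^sub>R x"] by simp
qed

lemma gauge_diff_le: "g x - g y \<le> norm (x - y) / inr"
proof -
  obtain p where p: "p \<in> P" "p \<bullet> x = g x" by (rule gauge_attained)
  have "g x - g y \<le> p \<bullet> x - p \<bullet> y" using p inner_polar_le[of p y] by simp
  also have "\<dots> = p \<bullet> (x - y)" by (simp add: inner_diff_right)
  also have "\<dots> \<le> norm p * norm (x - y)" by (rule norm_cauchy_schwarz)
  also have "\<dots> \<le> 1 / inr * norm (x - y)" using norm_polar_le[OF p(1)] by (intro mult_right_mono) auto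
  finally show ?thesis by simp
qed

lemma continuous_gauge: "continuous_on S g"
proof (rule continuous_on_subset[OF _ subset_UNIV], rule lipschitz_on_continuous_on)
  show "(1 / inr)-lipschitz_on UNIV g"
  proof (rule lipschitz_onI)
    fix x y
    show "dist (g x) (g y) \<le> 1 / inr * dist x y"
      using gauge_diff_le[of x y] gauge_diff_le[of y x] by (auto simp: dist_norm norm_minus_commute abs_le_iff)
  qed (use inr in auto)
qed

lemma measurable_gauge [measurable]: "g \<in> borel_measurable borel"
  by (rule borel_measurable_continuous_onI[OF continuous_gauge])

lemma gauge_ge: "norm x / outr \<le> g x"
proof (cases "x = 0")
  case False
  have "(1 / (norm x * outr)) *\<^sub>R x \<in> P"
    unfolding polar_body_def
  proof (safe)
    fix y assume "y \<in> K"
    then have "x \<bullet> y \<le> norm x * outr"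
      by (intro order_trans[OF norm_cauchy_schwarz] mult_left_mono norm_le_outr) auto
    then show "(1 / (norm x * outr)) *\<^sub>R x \<bullet> y \<le> 1"
      using False outr by (simp add: field_simps)
  qed
  from inner_polar_le[OF this, of x] show ?thesis using False outr
    by (simp add: dot_square_norm power2_eq_square)
qed (simp add: gauge_nonneg)

lemma gauge_pos: "x \<noteq> 0 \<Longrightarrow> 0 < g x"
  using gauge_ge[of x] outr by (smt (verit) divide_pos_pos zero_less_norm_iff)

lemma gauge_zero [simp]: "g 0 = 0" using gauge_scaleR[of 0 0] by simp

text \<open>The bipolar theorem for \<open>K\<close>. A point outside is separated from
  \<open>K\<close> by \<open>a\<close> and \<open>b\<close> with \<open>b < 0\<close>, since
  \<open>0 \<in> K\<close>; dividing \<open>a\<close> by \<open>b\<close> gives a polar point whose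
  inner product with \<open>x\<close> exceeds 1.\<close>

lemma mem_K_iff: "x \<in> K \<longleftrightarrow> g x \<le> 1"
proof
  assume "x \<in> K"
  moreover obtain p where "p \<in> P" "p \<bullet> x = g x" by (rule gauge_attained)
  ultimately show "g x \<le> 1" by (auto simp: polar_body_def)
next
  assume g1: "g x \<le> 1"
  show "x \<in> K"
  proof (rule ccontr)
    assume "x \<notin> K"
    then obtain a b where ab: "a \<bullet> x < b" "\<And>y. y \<in> K \<Longrightarrow> b < a \<bullet> y"
      using separating_hyperplane_closed_point[OF convex_K compact_imp_closed[OF compact_K]] by blast
    have "b < 0" using ab(2)[of 0] inr in_K_if_norm_le[of 0] by auto
    have "(1 / b) *\<^sub>R a \<in> P"
      unfolding polar_body_def using ab(2) \<open>b < 0\<close> by (auto simp: field_simps less_imp_le)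
    from inner_polar_le[OF this, of x] have "(a \<bullet> x) / b \<le> 1" using g1 by simp
    then show False using ab(1) \<open>b < 0\<close> by (simp add: field_simps)
  qed
qed

lemma scaleR_image_K: assumes "0 < t" shows "(*\<^sub>R) t ` K = {x. g x \<le> t}"
proof (safe)
  fix x assume "x \<in> K" then show "g (t *\<^sub>R x) \<le> t"
    using assms by (simp add: gauge_scaleR mem_K_iff)
next
  fix x assume "g x \<le> t"
  then have "(1 / t) *\<^sub>R x \<in> K" using assms by (simp add: gauge_scaleR mem_K_iff)
  then show "x \<in> (*\<^sub>R) t ` K" using assms by (intro image_eqI[of _ _ "(1 / t) *\<^sub>R x"]) auto
qed

lemma interior_K: "interior K = {x. g x < 1}"
proof
  have "open {x. g x < 1}" by (intro open_Collect_less continuous_gauge continuous_intros)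
  then show "{x. g x < 1} \<subseteq> interior K" by (intro interior_maximal) (auto simp: mem_K_iff)
  show "interior K \<subseteq> {x. g x < 1}"
  proof
    fix x assume x: "x \<in> interior K"
    then obtain e where e: "0 < e" "cball x e \<subseteq> K" by (auto simp: mem_interior_cball)
    show "x \<in> {x. g x < 1}"
    proof (cases "x = 0")
      case False
      have "x + (e / norm x) *\<^sub>R x \<in> K" using e False by (intro subsetD[OF e(2)]) (auto simp: dist_norm)
      then have "(1 + e / norm x) *\<^sub>R x \<in> K" by (simp add: scaleR_add_left)
      then have "(1 + e / norm x) * g x \<le> 1" using e by (simp add: mem_K_iff gauge_scaleR)
      moreover have "g x < (1 + e / norm x) * g x" using e False gauge_pos[OF False] by (simp add: algebra_simps)
      ultimately show ?thesis by simp
    qed simp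
  qed
qed

lemma frontier_K: "frontier K = {x. g x = 1}"
  using interior_K mem_K_iff compact_imp_closed[OF compact_K] by (auto simp: frontier_def)

lemma lmeasurable_gauge_le: "{x. g x \<le> t} \<in> lmeasurable"
proof (rule lmeasurable_compact)
  have "bounded {x. g x \<le> t}" unfolding bounded_iff
  proof (intro exI ballI)
    fix x assume "x \<in> {x. g x \<le> t}"
    then have "norm x / outr \<le> t" using gauge_ge[of x] by simp
    then show "norm x \<le> t * outr" using outr by (simp add: field_simps)
  qed
  moreover have "closed {x. g x \<le> t}" by (intro closed_Collect_le continuous_gauge continuous_intros)
  ultimately show "compact {x. g x \<le> t}" by (simp add: compact_eq_bounded_closed)
qed

lemma measure_gauge_le: "0 < t \<Longrightarrow> measure lebesgue {x. g x \<le> t} = t ^ DIM('a) * measure lebesgue K"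
  using measure_scaleR_image[of t K] scaleR_image_K[of t] by simp

text \<open>The gauge has Lipschitz constant \<open>1 / inr\<close>, so points within
  \<open>d\<close> of the boundary have gauge within \<open>d / inr\<close> of 1. The neighbourhood
  lies between two dilates of \<open>K\<close>, and its volume is of the order of
  \<open>d\<close>.\<close>

lemma hausdorff_frontier_finite: "hausdorff_outer_measure (DIM('a) - 1) (frontier K) < \<infinity>"
proof (rule hausdorff_outer_measure_lt_top)
  show "bounded (frontier K)"
    using compact_K by (auto intro: compact_imp_bounded compact_frontier)
  show "0 < inr / 2" using inr by simp
  fix d assume d: "0 < d" "d \<le> inr / 2"
  define e where "e = d / inr"
  have e: "0 < e" "e \<le> 1/2" using d inr by (auto simp: e_def field_simps)
  have "(\<Union>x\<in>frontier K. ball x d) \<subseteq> {x. g x \<le> 1 + e} - {x. g x \<le> 1 - e}"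
  proof
    fix y assume "y \<in> (\<Union>x\<in>frontier K. ball x d)"
    then obtain x where x: "g x = 1" "norm (x - y) < d" by (auto simp: frontier_K dist_norm)
    then have "norm (x - y) / inr < e" using inr by (simp add: e_def divide_strict_right_mono)
    then show "y \<in> {x. g x \<le> 1 + e} - {x. g x \<le> 1 - e}"
      using gauge_diff_le[of x y] gauge_diff_le[of y x] x by (simp add: norm_minus_commute)
  qed
  then have "measure lebesgue (\<Union>x\<in>frontier K. ball x d) \<le> measure lebesgue ({x. g x \<le> 1 + e} - {x. g x \<le> 1 - e})"
    by (intro measure_mono_fmeasurable fmeasurable.Diff lmeasurable_gauge_le)
       (auto intro!: sets_completionI_sets borel_open open_UN)
  also have "\<dots> = ((1 + e) ^ DIM('a) - (1 - e) ^ DIM('a)) * measure lebesgue K"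
  proof -
    have "measure lebesgue {x. g x \<le> 1 + e} = (1 + e) ^ DIM('a) * measure lebesgue K"
      "measure lebesgue {x. g x \<le> 1 - e} = (1 - e) ^ DIM('a) * measure lebesgue K"
      by (rule measure_gauge_le, use e in simp)+
    moreover have "measure lebesgue ({x. g x \<le> 1 + e} - {x. g x \<le> 1 - e}) =
        measure lebesgue {x. g x \<le> 1 + e} - measure lebesgue {x. g x \<le> 1 - e}"
      using e by (intro measurable_measure_Diff fmeasurableD lmeasurable_gauge_le) auto
    ultimately show ?thesis by (simp only: left_diff_distrib)
  qed
  also have "\<dots> \<le> (real DIM('a) * ((1 + e) - (1 - e)) * (1 + e) ^ (DIM('a) - 1)) * measure lebesgue K"
    using e by (intro mult_right_mono power_diff_le) auto
  also have "\<dots> \<le> (real DIM('a) * (2 * e) * 2 ^ (DIM('a) - 1)) * measure lebesgue K"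
  proof -
    have "(1 + e) ^ (DIM('a) - 1) \<le> 2 ^ (DIM('a) - 1)" using e by (intro power_mono) auto
    then show ?thesis using e by (intro mult_right_mono mult_mono) auto
  qed
  also have "\<dots> = (real DIM('a) * (2 / inr) * 2 ^ (DIM('a) - 1) * measure lebesgue K) * d"
    by (simp add: e_def)
  finally show "measure lebesgue (\<Union>x\<in>frontier K. ball x d) \<le> \<dots>" .
qed

end

text \<open>A bounded part of a hyperplane lies on the flat face of a ball cut by a half-space; the
  finiteness of Hausdorff measure on boundaries of convex bodies applies to that truncated
  ball.\<close>

lemma hausdorff_outer_measure_hyperplane_finite:
  fixes u :: "'a::euclidean_space"
  assumes u: "norm u = 1" and b: "A \<subseteq> {x. x \<bullet> u = 1}" "bounded A"
  shows "hausdorff_outer_measure (DIM('a) - 1) A < \<infinity>"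
proof -
  obtain R where R: "\<And>x. x \<in> A \<Longrightarrow> norm x \<le> R" using b(2) by (auto simp: bounded_iff)
  \<comment> \<open>The radius is at least 1, so that the open unit ball fits and 0 is an interior
    point.\<close>
  define K where "K = cball 0 (max R 1) \<inter> {x. u \<bullet> x \<le> 1}"
  interpret body K
  proof
    show "compact K" unfolding K_def by (intro compact_Int_closed closed_halfspace_le) auto
    show "convex K" unfolding K_def by (intro convex_Int convex_cball convex_halfspace_le)
    have "ball 0 1 \<subseteq> K"
    proof
      fix x :: 'a assume "x \<in> ball 0 1"
      moreover have "u \<bullet> x \<le> norm u * norm x" by (rule norm_cauchy_schwarz)
      ultimately show "x \<in> K" using u by (auto simp: K_def)
    qed
    then show "0 \<in> interior K" by (intro interiorI[of "ball 0 1"]) auto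
  qed
  have "A \<subseteq> frontier K"
  proof
    fix x assume x: "x \<in> A"
    then have "x \<in> K" and xu: "u \<bullet> x = 1" using R b by (auto simp: K_def inner_commute le_max_iff_disj)
    moreover have "x \<notin> interior K"
    proof
      assume "x \<in> interior K"
      then obtain e where e: "0 < e" "cball x e \<subseteq> K" by (auto simp: mem_interior_cball)
      then have "x + e *\<^sub>R u \<in> K" using u by (intro subsetD[OF e(2)]) (auto simp: dist_norm)
      then have "u \<bullet> (x + e *\<^sub>R u) \<le> 1" by (simp add: K_def)
      then show False using xu e u by (simp add: inner_add_right dot_square_norm)
    qed
    ultimately show "x \<in> frontier K" by (metis DiffI closure_subset frontier_def subsetD)
  qed
  then have "hausdorff_outer_measure (DIM('a) - 1) A \<le> hausdorff_outer_measure (DIM('a) - 1) (frontier K)"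
    by (rule hausdorff_outer_measure_mono)
  also have "\<dots> < \<infinity>" by (rule hausdorff_frontier_finite)
  finally show ?thesis .
qed


lemma hausdorff_outer_measure_isometry:
  fixes f :: "'a::real_normed_vector \<Rightarrow> 'b::real_normed_vector"
  assumes f: "\<And>x y. dist (f x) (f y) = dist x y"
  shows "hausdorff_outer_measure s (f ` A) = hausdorff_outer_measure s A"
proof (rule antisym)
  show "hausdorff_outer_measure s (f ` A) \<le> hausdorff_outer_measure s A"
    using hausdorff_outer_measure_lipschitz_image[of 1 A f s] f by simp
  have inj: "inj f" using f by (auto intro!: injI) (metis dist_eq_0_iff)
  have "dist (inv f x) (inv f y) = dist x y" if "x \<in> f ` A" "y \<in> f ` A" for x y
    using that f inj by auto
  then show "hausdorff_outer_measure s A \<le> hausdorff_outer_measure s (f ` A)"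
    using hausdorff_outer_measure_lipschitz_image[of 1 "f ` A" "inv f" s] inj by (simp add: image_image)
qed

lemma hausdorff_outer_measure_scaleR:
  fixes A :: "'a::real_normed_vector set"
  assumes c: "0 < c"
  shows "hausdorff_outer_measure s ((*\<^sub>R) c ` A) = ennreal (c ^ s) * hausdorff_outer_measure s A"
proof (rule antisym)
  have le: "hausdorff_outer_measure s ((*\<^sub>R) c ` A) \<le> ennreal (c ^ s) * hausdorff_outer_measure s A"
    if "0 < c" for c and A :: "'a set"
    using that by (intro hausdorff_outer_measure_lipschitz_image)
      (auto simp: dist_norm simp flip: scaleR_diff_right)
  show "hausdorff_outer_measure s ((*\<^sub>R) c ` A) \<le> ennreal (c ^ s) * hausdorff_outer_measure s A"
    by (rule le[OF c])
  have "hausdorff_outer_measure s A \<le> ennreal ((1/c) ^ s) * hausdorff_outer_measure s ((*\<^sub>R) c ` A)"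
    using le[of "1 / c" "(*\<^sub>R) c ` A"] c by (simp add: image_image)
  then have "ennreal (c ^ s) * hausdorff_outer_measure s A \<le>
      ennreal (c ^ s) * (ennreal ((1/c) ^ s) * hausdorff_outer_measure s ((*\<^sub>R) c ` A))"
    by (rule mult_left_mono) simp
  also have "\<dots> = hausdorff_outer_measure s ((*\<^sub>R) c ` A)"
    using c by (simp add: mult.assoc[symmetric] ennreal_mult[symmetric] power_mult_distrib[symmetric])
  finally show "ennreal (c ^ s) * hausdorff_outer_measure s A \<le> hausdorff_outer_measure s ((*\<^sub>R) c ` A)" .
qed

section \<open>Hausdorff measure and pyramid volume on a hyperplane\<close>

text \<open>Kept as a measure on the whole space, so that
  \<open>invariant_measures_proportional\<close> applies with \<open>W\<close> the hyperplane
  through 0 orthogonal to \<open>u\<close>.\<close>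

definition flat_hausdorff :: "'a::euclidean_space \<Rightarrow> 'a measure" where
  "flat_hausdorff u = density (hausdorff_measure (DIM('a) - 1)) (indicator {x. x \<bullet> u = 0})"

text \<open>The volume of the pyramid with apex \<open>0\<close> and base \<open>E + u\<close>, for \<open>E\<close> in the orthogonal complement of \<open>u\<close>.\<close>

definition pyramid_measure :: "'a::euclidean_space \<Rightarrow> 'a measure" where
  "pyramid_measure u = distr (density lborel (indicator {x. 0 < x \<bullet> u \<and> x \<bullet> u \<le> 1})) borel
     (\<lambda>x. (1 / (x \<bullet> u)) *\<^sub>R x - u)"

lemma sets_flat_hausdorff [simp, measurable_cong]: "sets (flat_hausdorff u) = sets borel"
  by (simp add: flat_hausdorff_def)

lemma sets_pyramid_measure [simp, measurable_cong]: "sets (pyramid_measure u) = sets borel"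
  by (simp add: pyramid_measure_def)

lemma emeasure_flat_hausdorff:
  fixes u :: "'a::euclidean_space"
  assumes "E \<in> sets borel"
  shows "emeasure (flat_hausdorff u) E = hausdorff_outer_measure (DIM('a) - 1) ({x. x \<bullet> u = 0} \<inter> E)"
  unfolding flat_hausdorff_def using assms
  by (subst emeasure_restricted) (auto simp: emeasure_hausdorff_measure)

lemma emeasure_pyramid_measure:
  fixes u :: "'a::euclidean_space"
  assumes [measurable]: "E \<in> sets borel"
  shows "emeasure (pyramid_measure u) E =
    emeasure lborel {x. 0 < x \<bullet> u \<and> x \<bullet> u \<le> 1 \<and> (1 / (x \<bullet> u)) *\<^sub>R x - u \<in> E}"
  unfolding pyramid_measure_def
  by (subst emeasure_distr, measurable, subst emeasure_restricted)
     (auto simp: vimage_def intro!: arg_cong[where f="emeasure lborel"])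

lemma emeasure_flat_hausdorff_finite:
  fixes u :: "'a::euclidean_space"
  assumes u: "norm u = 1"
  shows "emeasure (flat_hausdorff u) (ball 0 r) < \<infinity>"
proof -
  let ?A = "{x. x \<bullet> u = 0} \<inter> ball 0 r"
  have "emeasure (flat_hausdorff u) (ball 0 r) = hausdorff_outer_measure (DIM('a) - 1) ((+) u ` ?A)"
    by (subst hausdorff_outer_measure_isometry) (auto simp: emeasure_flat_hausdorff)
  also have "\<dots> < \<infinity>"
    using u by (intro hausdorff_outer_measure_hyperplane_finite[OF u])
      (auto simp: inner_add_left dot_square_norm bounded_translation bounded_Int)
  finally show ?thesis .
qed

lemma emeasure_pyramid_measure_finite:
  fixes u :: "'a::euclidean_space"
  assumes u: "norm u = 1"
  shows "emeasure (pyramid_measure u) (ball 0 r) < \<infinity>"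
proof -
  let ?A = "{x. 0 < x \<bullet> u \<and> x \<bullet> u \<le> 1 \<and> (1 / (x \<bullet> u)) *\<^sub>R x - u \<in> ball 0 r}"
  have "norm x \<le> r + 1" if "x \<in> ?A" for x
  proof -
    have *: "0 < x \<bullet> u" "x \<bullet> u \<le> 1" "norm ((1 / (x \<bullet> u)) *\<^sub>R x - u) < r" using that by auto
    have "norm ((1 / (x \<bullet> u)) *\<^sub>R x) \<le> r + 1"
      using norm_triangle_sub[of "(1 / (x \<bullet> u)) *\<^sub>R x" u] * u by simp
    then have "norm x \<le> (x \<bullet> u) * (r + 1)" using * by (simp add: field_simps)
    also have "\<dots> \<le> 1 * (r + 1)" using * norm_ge_zero[of "(1 / (x \<bullet> u)) *\<^sub>R x - u"]
      by (intro mult_right_mono) linarith+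
    finally show ?thesis by simp
  qed
  then have "bounded ?A" unfolding bounded_iff by blast
  from emeasure_bounded_finite[OF this] show ?thesis by (subst emeasure_pyramid_measure) auto
qed

lemma emeasure_pyramid_measure_pos:
  fixes u :: "'a::euclidean_space"
  assumes u: "norm u = 1"
  shows "0 < emeasure (pyramid_measure u) (ball 0 1)"
proof -
  let ?A = "{x. 0 < x \<bullet> u \<and> x \<bullet> u \<le> 1 \<and> (1 / (x \<bullet> u)) *\<^sub>R x - u \<in> ball 0 1}"
  let ?B = "{x. 0 < x \<bullet> u \<and> x \<bullet> u < 1 \<and> norm (x - (x \<bullet> u) *\<^sub>R u) < x \<bullet> u}"
  have op: "open ?B" by (intro open_Collect_conj open_Collect_less continuous_intros)
  have "(1/2) *\<^sub>R u \<in> ?B" using u by (simp add: dot_square_norm)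
  then have "0 < emeasure lborel ?B" by (rule emeasure_lborel_open_pos[OF op])
  also have "\<dots> \<le> emeasure lborel ?A"
  proof (rule emeasure_mono)
    show "?B \<subseteq> ?A"
    proof (safe)
      fix x assume x: "0 < x \<bullet> u" "norm (x - (x \<bullet> u) *\<^sub>R u) < x \<bullet> u"
      have "(1 / (x \<bullet> u)) *\<^sub>R x - u = (1 / (x \<bullet> u)) *\<^sub>R (x - (x \<bullet> u) *\<^sub>R u)"
        using x by (simp add: scaleR_diff_right)
      then have "norm ((1 / (x \<bullet> u)) *\<^sub>R x - u) = (1 / (x \<bullet> u)) * norm (x - (x \<bullet> u) *\<^sub>R u)"
        using x by simp
      also have "\<dots> < 1" using x by (simp add: field_simps)
      finally show "(1 / (x \<bullet> u)) *\<^sub>R x - u \<in> ball 0 1" by simp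
    qed auto
  qed auto
  finally show ?thesis by (simp only: emeasure_pyramid_measure borel_open open_ball)
qed

text \<open>The pyramid over the unit disc shifted by \<open>u\<close> has positive volume and is
  part of the cone over that disc, so the cone estimate rules out measure 0.\<close>

lemma emeasure_flat_hausdorff_pos:
  fixes u :: "'a::euclidean_space"
  assumes u: "norm u = 1"
  shows "0 < emeasure (flat_hausdorff u) (ball 0 1)"
proof -
  let ?A = "(+) u ` ({x. x \<bullet> u = 0} \<inter> ball 0 1)"
  let ?Z = "{x. 0 < x \<bullet> u \<and> x \<bullet> u \<le> 1 \<and> (1 / (x \<bullet> u)) *\<^sub>R x - u \<in> ball 0 1}"
  have "?A \<subseteq> cball 0 2"
  proof (safe)
    fix x :: 'a assume "x \<in> ball 0 1"
    then show "u + x \<in> cball 0 2" using norm_triangle_ineq[of u x] u by simp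
  qed
  from emeasure_cone_le_hausdorff[OF this] obtain q where q: "0 < q"
    "\<And>Z. Z \<in> sets lborel \<Longrightarrow> Z \<subseteq> {t *\<^sub>R x | t x. 0 \<le> t \<and> t \<le> 1 \<and> x \<in> ?A} \<Longrightarrow>
      emeasure lborel Z \<le> ennreal q * hausdorff_outer_measure (DIM('a) - 1) ?A"
    by blast
  have "?Z \<subseteq> {t *\<^sub>R x | t x. 0 \<le> t \<and> t \<le> 1 \<and> x \<in> ?A}"
  proof
    fix x assume x: "x \<in> ?Z"
    let ?y = "(1 / (x \<bullet> u)) *\<^sub>R x - u"
    have "?y \<in> {x. x \<bullet> u = 0} \<inter> ball 0 1" using x u by (auto simp: inner_diff_left dot_square_norm)
    moreover have "x = (x \<bullet> u) *\<^sub>R (u + ?y)" using x by (simp add: algebra_simps)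
    ultimately have "x = (x \<bullet> u) *\<^sub>R (u + ?y) \<and> 0 \<le> x \<bullet> u \<and> x \<bullet> u \<le> 1 \<and> u + ?y \<in> ?A"
      using x by (simp only: mem_Collect_eq image_eqI) auto
    then show "x \<in> {t *\<^sub>R x | t x. 0 \<le> t \<and> t \<le> 1 \<and> x \<in> ?A}" by blast
  qed
  moreover have "?Z \<in> sets lborel" by simp
  ultimately have "emeasure (pyramid_measure u) (ball 0 1) \<le> ennreal q * hausdorff_outer_measure (DIM('a) - 1) ?A"
    by (simp only: emeasure_pyramid_measure borel_open open_ball q(2))
  also have "hausdorff_outer_measure (DIM('a) - 1) ?A = emeasure (flat_hausdorff u) (ball 0 1)"
    by (subst hausdorff_outer_measure_isometry) (auto simp: emeasure_flat_hausdorff)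
  finally have "0 < ennreal q * emeasure (flat_hausdorff u) (ball 0 1)"
    using emeasure_pyramid_measure_pos[OF u] order.strict_trans2 by blast
  then show ?thesis by (simp add: ennreal_zero_less_mult_iff)
qed

text \<open>Translating the base of a pyramid within its hyperplane shears the pyramid, and shears
  preserve volume. Both measures are therefore invariant under the translations along the
  hyperplane.\<close>

lemma flat_hausdorff_proportional:
  fixes u :: "'a::euclidean_space"
  assumes u: "norm u = 1" and E: "E \<in> sets borel"
  shows "emeasure (flat_hausdorff u) E * emeasure (pyramid_measure u) (ball 0 1) =
    emeasure (pyramid_measure u) E * emeasure (flat_hausdorff u) (ball 0 1)"
proof -
  have sym: "{x::'a. - x \<in> ball 0 1} = ball 0 1" by auto
  have "emeasure (flat_hausdorff u) E * emeasure (pyramid_measure u) (ball 0 1) =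
    emeasure (pyramid_measure u) E * emeasure (flat_hausdorff u) {x. - x \<in> ball 0 1}"
  proof (rule invariant_measures_proportional[where W="{x. x \<bullet> u = 0}"])
    show "sigma_finite_measure (pyramid_measure u)" "sigma_finite_measure (flat_hausdorff u)"
      using emeasure_flat_hausdorff_finite[OF u] emeasure_pyramid_measure_finite[OF u]
      by (auto intro!: sigma_finite_measureI_ball)
    show "AE x in pyramid_measure u. x \<in> {x. x \<bullet> u = 0}"
      unfolding pyramid_measure_def using u
      by (subst AE_distr_iff) (auto simp: AE_density inner_diff_left dot_square_norm)
    show "AE x in flat_hausdorff u. x \<in> {x. x \<bullet> u = 0}"
      unfolding flat_hausdorff_def by (subst AE_density) (auto simp: indicator_def)
    fix w assume w: "w \<in> {x. x \<bullet> u = 0}"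
    then show "- w \<in> {x. x \<bullet> u = 0}" by simp
    fix F :: "'a set" assume F [measurable]: "F \<in> sets borel"
    let ?F = "{x. 0 < x \<bullet> u \<and> x \<bullet> u \<le> 1 \<and> (1 / (x \<bullet> u)) *\<^sub>R x - u \<in> F}"
    have eq: "(1 / (x \<bullet> u)) *\<^sub>R (x + (x \<bullet> u) *\<^sub>R w) - u = (1 / (x \<bullet> u)) *\<^sub>R x - u + w" if "0 < x \<bullet> u" for x
      using that by (simp add: algebra_simps)
    have mem: "(1 / (x \<bullet> u)) *\<^sub>R (x + (x \<bullet> u) *\<^sub>R w) - u \<in> F \<longleftrightarrow> (1 / (x \<bullet> u)) *\<^sub>R x - u + w \<in> F"
      if "0 < x \<bullet> u" for x unfolding eq[OF that] ..
    have "emeasure (pyramid_measure u) {x. x + w \<in> F} =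
      emeasure lborel {x. 0 < x \<bullet> u \<and> x \<bullet> u \<le> 1 \<and> (1 / (x \<bullet> u)) *\<^sub>R x - u \<in> {x. x + w \<in> F}}"
      by (rule emeasure_pyramid_measure) measurable
    also have "{x. 0 < x \<bullet> u \<and> x \<bullet> u \<le> 1 \<and> (1 / (x \<bullet> u)) *\<^sub>R x - u \<in> {x. x + w \<in> F}} =
      {x. x + (x \<bullet> u) *\<^sub>R w \<in> ?F}"
      using w by (auto simp: inner_add_left mem simp del: diff_add_eq add_diff_eq)
    also have "emeasure lborel \<dots> = emeasure lborel ?F"
      using w by (intro emeasure_lborel_shear) auto
    finally show "emeasure (pyramid_measure u) {x. x + w \<in> F} = emeasure (pyramid_measure u) F"
      by (simp add: emeasure_pyramid_measure)
    have "(+) w ` ({x. x \<bullet> u = 0} \<inter> {x. x + w \<in> F}) = {x. x \<bullet> u = 0} \<inter> F"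
    proof (safe)
      fix x assume "x \<bullet> u = 0" "x \<in> F"
      then show "x \<in> (+) w ` ({x. x \<bullet> u = 0} \<inter> {x. x + w \<in> F})"
        using w by (intro image_eqI[of _ _ "x - w"]) (auto simp: inner_diff_left)
    qed (use w in \<open>auto simp: inner_add_left add.commute\<close>)
    then show "emeasure (flat_hausdorff u) {x. x + w \<in> F} = emeasure (flat_hausdorff u) F"
      using hausdorff_outer_measure_isometry[of "(+) w" "DIM('a) - 1" "{x. x \<bullet> u = 0} \<inter> {x. x + w \<in> F}"]
      by (simp add: emeasure_flat_hausdorff)
  qed (use E in auto)
  then show ?thesis by (simp only: sym)
qed

text \<open>A reflection that carries \<open>u\<close> to \<open>v\<close> also carries one
  hyperplane to the other. Together with the same fact for pyramids this frees the proportionality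
  constant from the direction.\<close>

lemma flat_hausdorff_rotate:
  fixes u v :: "'a::euclidean_space"
  assumes "norm u = 1" "norm v = 1"
  shows "emeasure (flat_hausdorff u) (ball 0 1) = emeasure (flat_hausdorff v) (ball 0 1)"
proof -
  let ?r = "hyper_reflection (u - v)"
  have r: "?r u = v" using assms by (intro hyper_reflection_swap) simp
  have "?r ` ({x. x \<bullet> u = 0} \<inter> ball 0 1) = {x. x \<bullet> v = 0} \<inter> ball 0 1"
  proof (safe)
    fix x assume x: "x \<bullet> v = 0" "x \<in> ball 0 1"
    then show "x \<in> ?r ` ({x. x \<bullet> u = 0} \<inter> ball 0 1)"
      using r by (intro image_eqI[of _ _ "?r x"]) (auto simp: inner_hyper_reflection)
  next
    fix x assume "x \<bullet> u = 0"
    then show "?r x \<bullet> v = 0" using r by (metis hyper_reflection_involution inner_hyper_reflection)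
  qed auto
  then show ?thesis
    using hausdorff_outer_measure_isometry[of ?r "DIM('a) - 1" "{x. x \<bullet> u = 0} \<inter> ball 0 1"]
    by (simp add: emeasure_flat_hausdorff)
qed

lemma pyramid_measure_rotate:
  fixes u v :: "'a::euclidean_space"
  assumes "norm u = 1" "norm v = 1"
  shows "emeasure (pyramid_measure u) (ball 0 1) = emeasure (pyramid_measure v) (ball 0 1)"
proof -
  let ?r = "hyper_reflection (u - v)"
  let ?A = "\<lambda>u. {x. 0 < x \<bullet> u \<and> x \<bullet> u \<le> 1 \<and> norm ((1 / (x \<bullet> u)) *\<^sub>R x - u) < 1}"
  have r: "?r u = v" using assms by (intro hyper_reflection_swap) simp
  have xu: "?r x \<bullet> v = x \<bullet> u" for x using r by (metis hyper_reflection_involution inner_hyper_reflection)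
  have "norm ((1 / (x \<bullet> u)) *\<^sub>R ?r x - v) = norm ((1 / (x \<bullet> u)) *\<^sub>R x - u)" for x
  proof -
    have "(1 / (x \<bullet> u)) *\<^sub>R ?r x - v = ?r ((1 / (x \<bullet> u)) *\<^sub>R x - u)"
      using r by (simp add: linear_diff[OF linear_hyper_reflection] linear_scale[OF linear_hyper_reflection])
    then show ?thesis by simp
  qed
  then have "{x. ?r x \<in> ?A v} = ?A u" by (simp add: xu)
  then have "emeasure lborel (?A u) = emeasure lborel (?A v)"
    using emeasure_lborel_hyper_reflection[of "?A v" "u - v"] by simp
  then show ?thesis by (simp add: emeasure_pyramid_measure)
qed

text \<open>The set on the right is the pyramid with apex 0, base \<open>E\<close> and height
  \<open>c\<close>. Its volume is height times base area over \<open>n\<close>, so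
  \<open>\<kappa>\<close> is \<open>n\<close> times the ratio between the given Hausdorff measure
  and Lebesgue measure on hyperplanes.\<close>

lemma hausdorff_hyperplane:
  obtains \<kappa> :: real where "0 < \<kappa>"
    "\<And>(u::'a::euclidean_space) c E. norm u = 1 \<Longrightarrow> 0 < c \<Longrightarrow> E \<in> sets borel \<Longrightarrow> E \<subseteq> {x. x \<bullet> u = c} \<Longrightarrow>
      hausdorff_outer_measure (DIM('a) - 1) E =
        ennreal (\<kappa> / c) * emeasure lborel {x. 0 < x \<bullet> u \<and> x \<bullet> u \<le> c \<and> (c / (x \<bullet> u)) *\<^sub>R x \<in> E}"
proof -
  obtain u0 :: 'a where "u0 \<in> Basis" using nonempty_Basis by blast
  then have u0: "norm u0 = 1" by simp
  define N where "N = measure (flat_hausdorff u0) (ball 0 1)"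
  define M where "M = measure (pyramid_measure u0) (ball 0 1)"
  have N: "emeasure (flat_hausdorff u0) (ball 0 1) = ennreal N"
    unfolding N_def using emeasure_flat_hausdorff_finite[OF u0, of 1]
    by (intro emeasure_eq_ennreal_measure) auto
  have M: "emeasure (pyramid_measure u0) (ball 0 1) = ennreal M"
    unfolding M_def using emeasure_pyramid_measure_finite[OF u0, of 1]
    by (intro emeasure_eq_ennreal_measure) auto
  have N0: "0 < N" using emeasure_flat_hausdorff_pos[OF u0] N by simp
  have M0: "0 < M" using emeasure_pyramid_measure_pos[OF u0] M by simp
  show thesis
  proof
    show "0 < N / M" using N0 M0 by simp
    fix u :: 'a and c :: real and E :: "'a set"
    assume u: "norm u = 1" and c: "0 < c" and E [measurable]: "E \<in> sets borel" and Eu: "E \<subseteq> {x. x \<bullet> u = c}"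
    let ?s = "DIM('a) - 1"
    \<comment> \<open>\<open>E\<close> scaled to height 1 and moved to the hyperplane through 0, the
      position in which the two measures were compared.\<close>
    define F where "F = {x. c *\<^sub>R (x + u) \<in> E}"
    have F [measurable]: "F \<in> sets borel" unfolding F_def by measurable
    have Fu: "F \<subseteq> {x. x \<bullet> u = 0}" using Eu c u by (auto simp: F_def inner_add_left dot_square_norm)
    have EF: "E = (*\<^sub>R) c ` ((+) u ` F)"
    proof (safe)
      fix x assume "x \<in> E"
      then have "(1 / c) *\<^sub>R x - u \<in> F" using c by (simp add: F_def)
      then have "c *\<^sub>R (u + ((1 / c) *\<^sub>R x - u)) \<in> (*\<^sub>R) c ` ((+) u ` F)" by blast
      then show "x \<in> (*\<^sub>R) c ` ((+) u ` F)" using c by simp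
    qed (auto simp: F_def add.commute)
    let ?Z = "{x. 0 < x \<bullet> u \<and> x \<bullet> u \<le> c \<and> (c / (x \<bullet> u)) *\<^sub>R x \<in> E}"
    have "emeasure (flat_hausdorff u) F * ennreal M = emeasure (pyramid_measure u) F * ennreal N"
      using flat_hausdorff_proportional[OF u F] M N flat_hausdorff_rotate[OF u u0] pyramid_measure_rotate[OF u u0]
      by simp
    then have "emeasure (flat_hausdorff u) F * ennreal M * ennreal (1 / M) =
        emeasure (pyramid_measure u) F * ennreal N * ennreal (1 / M)" by simp
    then have fl: "emeasure (flat_hausdorff u) F = ennreal (N / M) * emeasure (pyramid_measure u) F"
      using M0 N0 by (simp add: mult.assoc ennreal_mult[symmetric])
        (simp add: mult.commute)
    have "hausdorff_outer_measure ?s F = emeasure (flat_hausdorff u) F"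
      using Fu by (simp add: emeasure_flat_hausdorff inf_absorb2)
    also have "\<dots> = ennreal (N / M) * emeasure lborel {x. 0 < x \<bullet> u \<and> x \<bullet> u \<le> 1 \<and> (1 / (x \<bullet> u)) *\<^sub>R x - u \<in> F}"
      unfolding fl by (simp add: emeasure_pyramid_measure)
    also have "{x. 0 < x \<bullet> u \<and> x \<bullet> u \<le> 1 \<and> (1 / (x \<bullet> u)) *\<^sub>R x - u \<in> F} = {x. c *\<^sub>R x \<in> ?Z}"
      using c by (auto simp: F_def zero_less_mult_iff)
    finally have HF: "hausdorff_outer_measure ?s F = ennreal (N / M) * emeasure lborel {x. c *\<^sub>R x \<in> ?Z}" .
    have "hausdorff_outer_measure ?s E = ennreal (c ^ ?s) * hausdorff_outer_measure ?s F"
      unfolding EF using c by (subst hausdorff_outer_measure_scaleR) (auto simp: hausdorff_outer_measure_isometry)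
    also have "\<dots> = ennreal (c ^ ?s * (N / M)) * emeasure lborel {x. c *\<^sub>R x \<in> ?Z}"
      unfolding HF using c N0 M0 by (subst ennreal_mult) (auto simp: mult.assoc)
    \<comment> \<open>Hausdorff measure scales with exponent \<open>n - 1\<close> and volume with
      exponent \<open>n\<close>; the mismatch is the divisor \<open>c\<close> in
      \<open>\<kappa> / c\<close>.\<close>
    also have "c ^ ?s * (N / M) = N / M / c * c ^ DIM('a)"
      using c power_Suc[of c ?s] by (simp add: DIM_positive Suc_diff_1 del: power_Suc)
    also have "ennreal (N / M / c * c ^ DIM('a)) * emeasure lborel {x. c *\<^sub>R x \<in> ?Z} =
        ennreal (N / M / c) * (ennreal (c ^ DIM('a)) * emeasure lborel {x. c *\<^sub>R x \<in> ?Z})"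
      using c N0 M0 by (simp add: ennreal_mult[symmetric] mult.assoc[symmetric])
    also have "ennreal (c ^ DIM('a)) * emeasure lborel {x. c *\<^sub>R x \<in> ?Z} = emeasure lborel ?Z"
      by (rule emeasure_lborel_scaleR_vimage[symmetric, OF c]) measurable
    finally show "hausdorff_outer_measure ?s E = ennreal (N / M / c) * emeasure lborel ?Z" .
  qed
qed

section \<open>The cone-volume formula\<close>

context body
begin

section \<open>Normals, polar points and measurability of the Gauss map\<close>

lemma normal_inner_ge: assumes "outer_unit_normal K x u" shows "inr \<le> x \<bullet> u"
proof -
  have u: "norm u = 1" using assms by (simp add: outer_unit_normal_def)
  have "inr *\<^sub>R u \<in> K" using u inr by (intro in_K_if_norm_le) auto
  then have "inr *\<^sub>R u \<bullet> u \<le> x \<bullet> u" using assms by (auto simp: outer_unit_normal_def)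
  then show ?thesis using u by (simp add: dot_square_norm)
qed

text \<open>Up to length, unit normals at a boundary point \<open>x\<close> and subgradients of the
  gauge at \<open>x\<close> are the same: \<open>u\<close> corresponds to a polar point whose norm
  is the reciprocal of \<open>x \<bullet> u\<close>. This is how the support function turns into the
  norm of a gradient.\<close>

lemma normal_imp_polar:
  assumes "outer_unit_normal K x u"
  shows "(1 / (x \<bullet> u)) *\<^sub>R u \<in> P" "(1 / (x \<bullet> u)) *\<^sub>R u \<bullet> x = 1"
proof -
  have pos: "0 < x \<bullet> u" using normal_inner_ge[OF assms] inr by simp
  then show "(1 / (x \<bullet> u)) *\<^sub>R u \<in> P"
    using assms by (auto simp: polar_body_def outer_unit_normal_def inner_commute field_simps)
  show "(1 / (x \<bullet> u)) *\<^sub>R u \<bullet> x = 1" using pos by (simp add: inner_commute)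
qed

lemma polar_imp_normal:
  assumes "p \<in> P" "p \<bullet> x = 1"
  shows "outer_unit_normal K x ((1 / norm p) *\<^sub>R p)" "x \<bullet> ((1 / norm p) *\<^sub>R p) = 1 / norm p"
proof -
  have p0: "p \<noteq> 0" using assms by auto
  show "outer_unit_normal K x ((1 / norm p) *\<^sub>R p)"
    using assms p0 by (auto simp: outer_unit_normal_def polar_body_def inner_commute divide_right_mono)
  show "x \<bullet> ((1 / norm p) *\<^sub>R p) = 1 / norm p" using assms by (simp add: inner_commute)
qed

lemma normal_exists: assumes "x \<in> frontier K" shows "\<exists>u. outer_unit_normal K x u"
proof -
  obtain p where "p \<in> P" "p \<bullet> x = g x" by (rule gauge_attained)
  then show ?thesis using assms polar_imp_normal[of p x] by (auto simp: frontier_K)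
qed

lemma gauss_map_normal:
  assumes "x \<in> regular_boundary K"
  shows "outer_unit_normal K x (gauss_map K x)"
  using assms theI'[of "outer_unit_normal K x"] by (auto simp: regular_boundary_def gauss_map_def)

lemma gauss_map_unique:
  assumes "x \<in> regular_boundary K" "outer_unit_normal K x u"
  shows "u = gauss_map K x"
  using assms gauss_map_normal[OF assms(1)] by (auto simp: regular_boundary_def)

lemma regular_boundaryD:
  assumes "x \<in> regular_boundary K"
  shows "x \<in> frontier K" "x \<in> K" "g x = 1" "norm (gauss_map K x) = 1" "inr \<le> x \<bullet> gauss_map K x"
    "x \<noteq> 0" "\<And>y. y \<in> K \<Longrightarrow> y \<bullet> gauss_map K x \<le> x \<bullet> gauss_map K x"
proof -
  show "x \<in> frontier K" using assms by (simp add: regular_boundary_def)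
  then show g1: "g x = 1" by (simp add: frontier_K)
  then show "x \<in> K" by (simp add: mem_K_iff)
  show "x \<noteq> 0" using g1 by auto
  show "norm (gauss_map K x) = 1" "\<And>y. y \<in> K \<Longrightarrow> y \<bullet> gauss_map K x \<le> x \<bullet> gauss_map K x"
    using gauss_map_normal[OF assms] by (auto simp: outer_unit_normal_def)
  show "inr \<le> x \<bullet> gauss_map K x" by (rule normal_inner_ge[OF gauss_map_normal[OF assms]])
qed

text \<open>Each inequality in the normal condition is closed in the pair \<open>(x, u)\<close>. The
  measurability questions about normals below reduce to projections of compact sets cut out of this
  bundle.\<close>

lemma compact_normal_bundle: "compact {(x, u). x \<in> frontier K \<and> outer_unit_normal K x u}"
proof -
  have "{(x, u). x \<in> frontier K \<and> outer_unit_normal K x u} =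
    (frontier K \<times> sphere 0 1) \<inter> (\<Inter>y\<in>K. {z. y \<bullet> snd z \<le> fst z \<bullet> snd z})"
    by (auto simp: outer_unit_normal_def)
  moreover have "closed (\<Inter>y\<in>K. {z::'a\<times>'a. y \<bullet> snd z \<le> fst z \<bullet> snd z})"
    by (intro closed_INT ballI closed_Collect_le continuous_intros)
  ultimately show ?thesis
    using compact_K by (auto intro!: compact_Int_closed compact_Times compact_frontier)
qed

text \<open>Two distinct normals differ by at least \<open>1 / (k + 1)\<close> for some
  \<open>k\<close>; for fixed \<open>k\<close> this is a closed condition, so the exceptional set is
  a countable union of projections of compact sets.\<close>

lemma irregular_boundary_eq:
  "frontier K - regular_boundary K =
    (\<Union>k::nat. (fst \<circ> fst) ` {z \<in> {(x, u). x \<in> frontier K \<and> outer_unit_normal K x u} \<times>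
        {(x, u). x \<in> frontier K \<and> outer_unit_normal K x u}.
      fst (fst z) = fst (snd z) \<and> 1 / real (Suc k) \<le> norm (snd (fst z) - snd (snd z))})"
  (is "?L = (\<Union>k. ?R k)")
proof
  show "?L \<subseteq> (\<Union>k. ?R k)"
  proof
    fix x assume x: "x \<in> ?L"
    then obtain u v where uv: "outer_unit_normal K x u" "outer_unit_normal K x v" "u \<noteq> v"
      using normal_exists[of x] by (auto simp: regular_boundary_def)
    then obtain k where "1 / real (Suc k) < norm (u - v)" using nat_approx_posE[of "norm (u - v)"] by auto
    then have "x \<in> ?R k" using x uv
      by (intro image_eqI[of _ _ "((x,u),(x,v))"]) auto
    then show "x \<in> (\<Union>k. ?R k)" by blast
  qed
  show "(\<Union>k. ?R k) \<subseteq> ?L"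
    by (auto simp: regular_boundary_def simp del: of_nat_Suc) (metis divide_le_0_1_iff norm_zero of_nat_0_less_iff zero_less_Suc not_less right_minus_eq)
qed

lemma regular_boundary_borel [measurable]: "regular_boundary K \<in> sets borel"
proof -
  have "compact {z \<in> {(x, u). x \<in> frontier K \<and> outer_unit_normal K x u} \<times>
        {(x, u). x \<in> frontier K \<and> outer_unit_normal K x u}.
      fst (fst z) = fst (snd z) \<and> 1 / real (Suc k) \<le> norm (snd (fst z) - snd (snd z))}" for k
  proof -
    have "closed {z::('a\<times>'a)\<times>('a\<times>'a). fst (fst z) = fst (snd z) \<and> 1 / real (Suc k) \<le> norm (snd (fst z) - snd (snd z))}"
      by (intro closed_Collect_conj closed_Collect_le closed_Collect_eq continuous_intros)
    from compact_Int_closed[OF compact_Times[OF compact_normal_bundle compact_normal_bundle] this]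
    show ?thesis by (simp only: Collect_conj_eq Collect_mem_eq)
  qed
  then have "frontier K - regular_boundary K \<in> sets borel"
    unfolding irregular_boundary_eq
    by (intro sets.countable_UN'' ballI borel_compact compact_continuous_image)
       (auto intro!: continuous_intros simp: o_def)
  then have "frontier K - (frontier K - regular_boundary K) \<in> sets borel"
    by (rule sets.Diff[OF borel_closed[OF frontier_closed]])
  moreover have "frontier K - (frontier K - regular_boundary K) = regular_boundary K"
    by (auto simp: regular_boundary_def)
  ultimately show ?thesis by simp
qed

text \<open>Where the normal is unique, the preimage of a closed set is the trace on the regular
  boundary of the projection of a compact part of the normal bundle.\<close>

lemma measurable_gauss_map: "gauss_map K \<in> borel_measurable (restrict_space borel (regular_boundary K))"
proof (rule borel_measurableI)
  fix S :: "'a set" assume S: "open S"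
  let ?N = "{(x, u). x \<in> frontier K \<and> outer_unit_normal K x u}"
  have "x \<in> fst ` (?N \<inter> (UNIV \<times> - S)) \<longleftrightarrow> gauss_map K x \<notin> S" if x: "x \<in> regular_boundary K" for x
  proof
    assume "x \<in> fst ` (?N \<inter> (UNIV \<times> - S))"
    then obtain u where "outer_unit_normal K x u" "u \<notin> S" by auto
    then show "gauss_map K x \<notin> S" using gauss_map_unique[OF x] by blast
  next
    assume "gauss_map K x \<notin> S"
    then have "(x, gauss_map K x) \<in> ?N \<inter> UNIV \<times> - S"
      using x gauss_map_normal regular_boundaryD by auto
    then show "x \<in> fst ` (?N \<inter> (UNIV \<times> - S))" by (rule image_eqI[rotated]) simp
  qed
  then have "gauss_map K -` S \<inter> space (restrict_space borel (regular_boundary K)) =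
      regular_boundary K - fst ` (?N \<inter> (UNIV \<times> - S))"
    by (auto simp: space_restrict_space)
  moreover have "compact (fst ` (?N \<inter> (UNIV \<times> - S)))"
    using S by (intro compact_continuous_image continuous_intros compact_Int_closed compact_normal_bundle closed_Times) auto
  ultimately show "gauss_map K -` S \<inter> space (restrict_space borel (regular_boundary K)) \<in> sets (restrict_space borel (regular_boundary K))"
    using sets.Diff[OF regular_boundary_borel borel_compact] by (auto simp: sets_restrict_space_iff)
qed

definition reg_measure :: "'a measure" where
  "reg_measure = restrict_space (hausdorff_measure (DIM('a) - 1)) (regular_boundary K)"

lemma space_reg_measure [simp]: "space reg_measure = regular_boundary K"
  by (simp add: reg_measure_def space_restrict_space)

lemma sets_reg_measure [measurable_cong]: "sets reg_measure = sets (restrict_space borel (regular_boundary K))"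
  unfolding reg_measure_def by (rule sets_restrict_space_cong) simp

lemma emeasure_reg_measure:
  assumes "E \<in> sets borel" "E \<subseteq> regular_boundary K"
  shows "emeasure reg_measure E = hausdorff_outer_measure (DIM('a) - 1) E"
  unfolding reg_measure_def using assms by (subst emeasure_restrict_space) auto

text \<open>The preimage of a Borel set under the Gauss map is Borel, so the defining set function
  agrees with an image measure. Hence it is countably additive and \<open>measure_of\<close> does
  not fall back to the zero measure.\<close>

lemma surface_area_measure_eq_distr:
  "surface_area_measure K = distr reg_measure (restrict_space borel (sphere 0 1)) (gauss_map K)"
  (is "_ = ?D")
proof -
  have meas: "gauss_map K \<in> reg_measure \<rightarrow>\<^sub>M restrict_space borel (sphere 0 1)"
    using measurable_gauss_map regular_boundaryD(4)
    by (intro measurable_restrict_space2) (auto cong: measurable_cong_sets[OF sets_reg_measure])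
  have "surface_area_measure K =
      measure_of (sphere 0 1) (sets (restrict_space borel (sphere 0 1))) (emeasure ?D)"
    unfolding surface_area_measure_def
  proof (rule measure_of_eq)
    show "sets (restrict_space borel (sphere 0 1)) \<subseteq> Pow (sphere (0::'a) 1)"
      using sets.sets_into_space[of _ "restrict_space borel (sphere (0::'a) 1)"] by (auto simp: space_restrict_space)
    fix \<omega> assume "\<omega> \<in> sigma_sets (sphere 0 1) (sets (restrict_space borel (sphere (0::'a) 1)))"
    then have \<omega>: "\<omega> \<in> sets (restrict_space borel (sphere (0::'a) 1))"
      using sets.sigma_sets_eq[of "restrict_space borel (sphere (0::'a) 1)"] by (simp add: space_restrict_space)
    have "gauss_map K -` \<omega> \<inter> space reg_measure \<in> sets reg_measure"
      by (rule measurable_sets[OF meas \<omega>])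
    then have "gauss_map K -` \<omega> \<inter> regular_boundary K \<in> sets borel"
      by (simp add: sets_reg_measure sets_restrict_space_iff)
    then show "hausdorff_outer_measure (DIM('a) - 1) {x \<in> regular_boundary K. gauss_map K x \<in> \<omega>} = emeasure ?D \<omega>"
      by (subst emeasure_distr[OF meas \<omega>]) (auto simp: emeasure_reg_measure vimage_def Int_def conj_commute)
  qed
  also have "\<dots> = ?D" using measure_of_of_measure[of ?D] by (simp add: space_restrict_space)
  finally show ?thesis .
qed

end


section \<open>Comparison of measures on small pieces\<close>

text \<open>The pieces may depend on \<open>\<tau>\<close>. Made disjoint, they give the bound with
  factor \<open>\<tau>\<close> for the whole of \<open>X\<close>, and only then does
  \<open>\<tau>\<close> tend to 1.\<close>

lemma piecewise_emeasure_le: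
  assumes sets: "sets N = sets M"
    and piece: "\<And>\<tau>::real. 1 < \<tau> \<Longrightarrow> \<exists>A :: nat \<Rightarrow> 'a set. range A \<subseteq> sets M \<and> (\<Union>i. A i) = space M \<and>
      (\<forall>i E. E \<in> sets M \<longrightarrow> E \<subseteq> A i \<longrightarrow> emeasure N E \<le> ennreal \<tau> * emeasure M E)"
    and X: "X \<in> sets M"
  shows "emeasure N X \<le> emeasure M X"
proof -
  have le: "emeasure N X \<le> ennreal \<tau> * emeasure M X" if \<tau>: "1 < \<tau>" for \<tau>
  proof -
    obtain A :: "nat \<Rightarrow> 'a set" where A: "range A \<subseteq> sets M" "(\<Union>i. A i) = space M"
      "\<And>i E. E \<in> sets M \<Longrightarrow> E \<subseteq> A i \<Longrightarrow> emeasure N E \<le> ennreal \<tau> * emeasure M E"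
      using piece[OF \<tau>] by blast
    define B where "B i = X \<inter> disjointed A i" for i
    have B: "range B \<subseteq> sets M" "disjoint_family B"
      using sets.range_disjointed_sets[OF A(1)] X disjoint_family_disjointed[of A]
      by (auto simp: B_def disjoint_family_on_def)
    have UB: "(\<Union>i. B i) = X"
      using UN_disjointed_eq[of A] A(2) sets.sets_into_space[OF X] by (auto simp: B_def)
    have "emeasure N X = (\<Sum>i. emeasure N (B i))"
      using suminf_emeasure[of B N] B sets UB by auto
    also have "\<dots> \<le> (\<Sum>i. ennreal \<tau> * emeasure M (B i))"
    proof (intro suminf_le allI)
      fix i
      have "B i \<subseteq> A i" using disjointed_subset[of A i] by (auto simp: B_def)
      then show "emeasure N (B i) \<le> ennreal \<tau> * emeasure M (B i)" using B(1) by (intro A(3)) auto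
    qed auto
    also have "\<dots> = ennreal \<tau> * emeasure M X"
      using suminf_emeasure[OF B] UB by simp
    finally show ?thesis .
  qed
  show ?thesis
  proof (cases "emeasure M X = top")
    case False
    then obtain m where m: "emeasure M X = ennreal m" "0 \<le> m" by (cases "emeasure M X") auto
    have "((\<lambda>\<tau>. ennreal (\<tau> * m)) \<longlongrightarrow> ennreal (1 * m)) (at_right 1)"
      by (intro tendsto_ennrealI tendsto_intros)
    moreover have "eventually (\<lambda>\<tau>. emeasure N X \<le> ennreal (\<tau> * m)) (at_right 1)"
      using le m by (intro eventually_at_right_less[THEN eventually_mono]) (auto simp: ennreal_mult)
    ultimately have "emeasure N X \<le> ennreal (1 * m)" by (intro tendsto_lowerbound) auto
    then show ?thesis using m by simp
  qed simp
qed

text \<open>\<open>\<kappa>\<close> is a parameter, so that \<open>K\<close> and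
  \<open>ball_of K\<close> can be interpreted with one and the same constant.\<close>

locale normalized_body = body K for K :: "'a::euclidean_space set" +
  fixes \<kappa> :: real
  assumes \<kappa>_pos: "0 < \<kappa>"
    and hausdorff_hyper: "\<And>(u::'a) c E. norm u = 1 \<Longrightarrow> 0 < c \<Longrightarrow> E \<in> sets borel \<Longrightarrow> E \<subseteq> {x. x \<bullet> u = c} \<Longrightarrow>
      hausdorff_outer_measure (DIM('a) - 1) E =
        ennreal (\<kappa> / c) * emeasure lborel {x. 0 < x \<bullet> u \<and> x \<bullet> u \<le> c \<and> (c / (x \<bullet> u)) *\<^sub>R x \<in> E}"
begin

text \<open>Division by zero makes \<open>radial 0 = 0\<close>, which is not a boundary point; the
  condition \<open>radial x \<in> regular_boundary K\<close> therefore excludes the origin.\<close>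

definition radial :: "'a \<Rightarrow> 'a" where "radial x = (1 / g x) *\<^sub>R x"

lemma measurable_radial [measurable]: "radial \<in> borel_measurable borel"
  unfolding radial_def by measurable

lemma radial_scaleR: "0 < t \<Longrightarrow> radial (t *\<^sub>R x) = radial x"
  by (simp add: radial_def gauge_scaleR)

lemma radial_regular: "x \<in> regular_boundary K \<Longrightarrow> radial x = x"
  by (simp add: radial_def regular_boundaryD)

lemma gauge_scaleR_radial: "g x *\<^sub>R radial x = x"
  by (cases "x = 0") (auto simp: radial_def gauge_pos less_imp_neq[symmetric])

lemma regular_radial_nz: "radial x \<in> regular_boundary K \<Longrightarrow> x \<noteq> 0"
  using regular_boundaryD(6)[of 0] by (auto simp: radial_def)

definition regular_part :: "'a set" where
  "regular_part = {x \<in> K. radial x \<in> regular_boundary K}"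

lemma regular_part_borel [measurable]: "regular_part \<in> sets borel"
proof -
  have "K \<in> sets borel" using compact_K by (rule borel_compact)
  then show ?thesis unfolding regular_part_def by measurable
qed

definition cone_measure :: "'a measure" where
  "cone_measure = distr (restrict_space lborel regular_part) (restrict_space borel (regular_boundary K)) radial"

lemma measurable_radial_regular:
  "radial \<in> restrict_space lborel regular_part \<rightarrow>\<^sub>M restrict_space borel (regular_boundary K)"
  by (intro measurable_restrict_space3) (auto simp: regular_part_def)

lemma emeasure_cone_measure:
  assumes "E \<in> sets borel" "E \<subseteq> regular_boundary K"
  shows "emeasure cone_measure E = emeasure lborel {x \<in> K. radial x \<in> E}"
proof -
  have E: "E \<in> sets (restrict_space borel (regular_boundary K))" using assms by (simp add: sets_restrict_space_iff)
  have "radial -` E \<inter> space (restrict_space lborel regular_part) = {x \<in> K. radial x \<in> E}"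
    using assms(2) by (auto simp: space_restrict_space regular_part_def)
  moreover have sub: "{x \<in> K. radial x \<in> E} \<subseteq> regular_part"
    using assms(2) by (auto simp: regular_part_def)
  ultimately show ?thesis
    unfolding cone_measure_def emeasure_distr[OF measurable_radial_regular E]
    using sub by (subst emeasure_restrict_space) auto
qed

text \<open>The projection goes to the tangent hyperplane at \<open>x\<^sub>1\<close>, at distance
  \<open>c\<close> from 0. One factor \<open>k\<close> pays for replacing
  \<open>x \<bullet> gauss_map K x\<close> by \<open>c\<close>, \<open>k ^ (n - 1)\<close> for the
  bi-Lipschitz change of Hausdorff measure, and \<open>k ^ n\<close> for passing between the pyramid
  over the projected set and the cone over \<open>E\<close> in \<open>K\<close>.\<close>

lemma cone_comparison:
  assumes E [measurable]: "E \<in> sets borel" and Er: "E \<subseteq> regular_boundary K"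
    and ne: "x\<^sub>1 \<in> E"
    and \<theta>: "0 < \<theta>" "\<theta> \<le> 1 / 2" and \<epsilon>: "0 < \<epsilon>" "\<epsilon> * (2 + 4 * outr) \<le> \<theta> * inr"
    and close: "\<And>x y. x \<in> E \<Longrightarrow> y \<in> E \<Longrightarrow> norm (x - y) \<le> \<epsilon>"
      "\<And>x y. x \<in> E \<Longrightarrow> y \<in> E \<Longrightarrow> norm (gauss_map K x - gauss_map K y) \<le> \<epsilon>"
  defines "k \<equiv> 1 / (1 - \<theta>)"
  shows "(\<integral>\<^sup>+x. ennreal (x \<bullet> gauss_map K x) * indicator E x \<partial>reg_measure) \<le>
      ennreal (k ^ (2 * DIM('a)) * \<kappa>) * emeasure lborel {x \<in> K. radial x \<in> E}"
    and "ennreal \<kappa> * emeasure lborel {x \<in> K. radial x \<in> E} \<le>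
      ennreal (k ^ (2 * DIM('a))) * (\<integral>\<^sup>+x. ennreal (x \<bullet> gauss_map K x) * indicator E x \<partial>reg_measure)"
proof -
  let ?\<nu> = "gauss_map K"
  let ?s = "DIM('a) - 1" and ?n = "DIM('a)"
  define u where "u = ?\<nu> x\<^sub>1"
  define c where "c = x\<^sub>1 \<bullet> u"
  note reg = regular_boundaryD[OF subsetD[OF Er]]
  have u: "norm u = 1" using reg(4)[OF ne] by (simp add: u_def)
  have c: "inr \<le> c" using reg(5)[OF ne] by (simp add: u_def c_def)
  have c0: "0 < c" using c inr by linarith
  have xR: "norm x \<le> outr" if "x \<in> E" for x using reg(2)[OF that] by (rule norm_le_outr)
  have e1: "\<epsilon> + \<epsilon> * outr \<le> \<theta> * inr" and e2: "\<epsilon> \<le> \<theta> * inr"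
  proof -
    have "\<epsilon> * (2 + 4 * outr) = 2 * \<epsilon> + 4 * (\<epsilon> * outr)" by (simp add: algebra_simps)
    moreover have "0 < \<epsilon> * outr" using \<epsilon> outr by simp
    ultimately show "\<epsilon> + \<epsilon> * outr \<le> \<theta> * inr" "\<epsilon> \<le> \<theta> * inr" using \<epsilon> by linarith+
  qed
  have tc: "\<theta> * inr \<le> \<theta> * c" using c \<theta> by simp
  have xu: "\<bar>x \<bullet> u - c\<bar> \<le> \<epsilon>" if "x \<in> E" for x
  proof -
    have "\<bar>(x - x\<^sub>1) \<bullet> u\<bar> \<le> norm (x - x\<^sub>1) * norm u" by (rule Cauchy_Schwarz_ineq2)
    then show ?thesis using close(1)[OF that ne] u by (simp add: c_def inner_diff_left)
  qed
  have xnu: "\<bar>x \<bullet> ?\<nu> x - c\<bar> \<le> \<theta> * c" if "x \<in> E" for x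
  proof -
    have "x \<bullet> ?\<nu> x - c = (x - x\<^sub>1) \<bullet> ?\<nu> x + x\<^sub>1 \<bullet> (?\<nu> x - u)"
      by (simp add: c_def inner_diff_left inner_diff_right)
    moreover have "\<bar>(x - x\<^sub>1) \<bullet> ?\<nu> x\<bar> \<le> \<epsilon>"
      using Cauchy_Schwarz_ineq2[of "x - x\<^sub>1" "?\<nu> x"] close(1)[OF that ne] reg(4)[OF that] by simp
    moreover have "\<bar>x\<^sub>1 \<bullet> (?\<nu> x - u)\<bar> \<le> outr * \<epsilon>"
      using close(2)[OF that ne] xR[OF ne] outr
      by (intro order_trans[OF Cauchy_Schwarz_ineq2] mult_mono) (auto simp: u_def)
    ultimately have "\<bar>x \<bullet> ?\<nu> x - c\<bar> \<le> \<epsilon> + outr * \<epsilon>" by linarith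
    then show ?thesis using e1 tc by (simp add: mult.commute)
  qed
  have xu_theta: "\<bar>x \<bullet> u - c\<bar> \<le> \<theta> * c" if "x \<in> E" for x using xu[OF that] e2 tc by linarith
  have xu_pos: "inr / 2 \<le> x \<bullet> u" if "x \<in> E" for x
  proof -
    have "\<epsilon> \<le> 1/2 * inr" using e2 mult_right_mono[OF \<theta>(2), of inr] inr by linarith
    then show ?thesis using xu[OF that] c by linarith
  qed
  \<comment> \<open>Since each of two points of \<open>E\<close> lies below the tangent hyperplane of the other, their difference is almost orthogonal to \<open>u\<close>.\<close>
  have one_sided: "(y - x) \<bullet> u \<le> \<epsilon> * norm (y - x)" if "x \<in> E" "y \<in> E" for x y
  proof -
    have "(y - x) \<bullet> u = (y - x) \<bullet> ?\<nu> x + (y - x) \<bullet> (u - ?\<nu> x)" by (simp add: inner_diff_right)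
    moreover have "(y - x) \<bullet> ?\<nu> x \<le> 0" using reg(7)[OF that(1) reg(2)[OF that(2)]] by (simp add: inner_diff_left)
    moreover have "(y - x) \<bullet> (u - ?\<nu> x) \<le> norm (y - x) * norm (u - ?\<nu> x)" by (rule norm_cauchy_schwarz)
    moreover have "norm (y - x) * norm (u - ?\<nu> x) \<le> norm (y - x) * \<epsilon>"
      using close(2)[OF ne that(1)] by (intro mult_left_mono) (auto simp: u_def)
    ultimately show ?thesis by (simp add: mult.commute)
  qed
  have flat: "\<bar>(y - x) \<bullet> u\<bar> \<le> \<epsilon> * norm (y - x)" if "x \<in> E" "y \<in> E" for x y
    using one_sided[OF that] one_sided[OF that(2,1)]
    by (simp add: inner_diff_left norm_minus_commute abs_le_iff)
  define pr where "pr x = (c / (x \<bullet> u)) *\<^sub>R x" for x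
  \<comment> \<open>The scaling factor in \<open>pr\<close> differs from 1 by at most
    \<open>2 * \<epsilon> / inr\<close>, and its variation is controlled by \<open>flat\<close>.
    With norms at most \<open>outr\<close> the total is
    \<open>\<epsilon> * (2 + 4 * outr) / inr\<close>, which explains the hypothesis on
    \<open>\<epsilon>\<close>.\<close>
  have pr_diff: "norm ((pr x - pr y) - (x - y)) \<le> \<theta> * norm (x - y)" if xy: "x \<in> E" "y \<in> E" for x y
  proof -
    have px: "0 < x \<bullet> u" and py: "0 < y \<bullet> u" using xu_pos xy inr by (smt (verit) half_gt_zero)+
    have coef: "c / (x \<bullet> u) - c / (y \<bullet> u) = c / (x \<bullet> u) * (((y - x) \<bullet> u) / (y \<bullet> u))"
      using px py by (simp add: field_simps inner_diff_left)
    have eq: "(pr x - pr y) - (x - y) = (c / (x \<bullet> u) - 1) *\<^sub>R (x - y) +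
        (c / (x \<bullet> u) - c / (y \<bullet> u)) *\<^sub>R y"
      by (simp add: pr_def algebra_simps)
    have "c / (x \<bullet> u) - 1 = (c - x \<bullet> u) / (x \<bullet> u)" using px by (simp add: field_simps)
    then have "\<bar>c / (x \<bullet> u) - 1\<bar> = \<bar>c - x \<bullet> u\<bar> / (x \<bullet> u)" using px by simp
    also have "\<dots> \<le> \<epsilon> / (inr / 2)"
      using xu[OF xy(1)] xu_pos[OF xy(1)] inr \<epsilon> by (intro frac_le) auto
    finally have 1: "\<bar>c / (x \<bullet> u) - 1\<bar> \<le> 2 * \<epsilon> / inr" by (simp add: mult.commute)
    have "2 * \<epsilon> / inr \<le> 1"
    proof -
      have "2 * \<epsilon> \<le> 2 * (\<theta> * inr)" using e2 by simp
      also have "\<dots> \<le> inr" using mult_right_mono[OF \<theta>(2), of inr] inr by simp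
      finally show ?thesis using inr by simp
    qed
    with 1 have c2: "\<bar>c / (x \<bullet> u)\<bar> \<le> 2" by linarith
    have "\<bar>((y - x) \<bullet> u) / (y \<bullet> u)\<bar> = \<bar>(y - x) \<bullet> u\<bar> / (y \<bullet> u)" using py by simp
    also have "\<dots> \<le> (\<epsilon> * norm (x - y)) / (inr / 2)"
      using flat[OF xy] xu_pos[OF xy(2)] inr \<epsilon> by (intro frac_le) (auto simp: norm_minus_commute)
    finally have "\<bar>c / (x \<bullet> u)\<bar> * \<bar>((y - x) \<bullet> u) / (y \<bullet> u)\<bar> \<le> 2 * ((\<epsilon> * norm (x - y)) / (inr / 2))"
      using c2 by (intro mult_mono) auto
    then have 2: "\<bar>c / (x \<bullet> u) - c / (y \<bullet> u)\<bar> \<le> 4 * \<epsilon> / inr * norm (x - y)"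
      unfolding coef by (simp add: abs_mult)
    have "norm ((pr x - pr y) - (x - y)) \<le> \<bar>c / (x \<bullet> u) - 1\<bar> * norm (x - y) + \<bar>c / (x \<bullet> u) - c / (y \<bullet> u)\<bar> * norm y"
      unfolding eq by (intro order_trans[OF norm_triangle_ineq]) simp
    also have "\<dots> \<le> 2 * \<epsilon> / inr * norm (x - y) + 4 * \<epsilon> / inr * norm (x - y) * outr"
      using 1 2 xR[OF xy(2)] inr \<epsilon> by (intro add_mono mult_right_mono mult_mono) auto
    also have "\<dots> = (\<epsilon> * (2 + 4 * outr) / inr) * norm (x - y)"
      by (simp add: add_divide_distrib algebra_simps)
    also have "\<dots> \<le> \<theta> * norm (x - y)"
      using \<epsilon>(2) inr by (intro mult_right_mono) (auto simp: field_simps)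
    finally show ?thesis .
  qed
  \<comment> \<open>\<open>k\<close> is the reciprocal of \<open>1 - \<theta>\<close> and at least
    \<open>1 + \<theta>\<close>, so one constant serves for \<open>pr\<close> and for its
    inverse.\<close>
  have k: "1 \<le> k" "1 + \<theta> \<le> k" "k * (1 - \<theta>) = 1"
  proof -
    show "k * (1 - \<theta>) = 1" using \<theta> by (simp add: k_def)
    show "1 \<le> k" using \<theta> by (simp add: k_def)
    have "(1 + \<theta>) * (1 - \<theta>) \<le> 1" by (simp add: algebra_simps)
    then show "1 + \<theta> \<le> k" using \<theta> by (simp add: k_def field_simps)
  qed
  have upper: "dist (pr x) (pr y) \<le> k * dist x y" if "x \<in> E" "y \<in> E" for x y
  proof -
    have "norm (pr x - pr y) \<le> norm (x - y) + \<theta> * norm (x - y)"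
      using pr_diff[OF that] norm_triangle_sub[of "pr x - pr y" "x - y"] by linarith
    also have "\<dots> = (1 + \<theta>) * norm (x - y)" by (simp add: algebra_simps)
    also have "\<dots> \<le> k * norm (x - y)" using k by (intro mult_right_mono) auto
    finally show ?thesis by (simp add: dist_norm)
  qed
  have lower: "dist x y \<le> k * dist (pr x) (pr y)" if "x \<in> E" "y \<in> E" for x y
  proof -
    have "norm (x - y) - \<theta> * norm (x - y) \<le> norm (pr x - pr y)"
      using pr_diff[OF that] norm_triangle_sub[of "x - y" "pr x - pr y"] by (simp add: norm_minus_commute)
    then have "k * ((1 - \<theta>) * norm (x - y)) \<le> k * norm (pr x - pr y)"
      using k by (intro mult_left_mono) (auto simp: algebra_simps)
    then show ?thesis using k(3) by (simp add: dist_norm mult.assoc[symmetric])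
  qed
  have rad_pr: "radial (pr x) = x" "pr x \<bullet> u = c" if "x \<in> E" for x
  proof -
    have "0 < x \<bullet> u" using xu_pos[OF that] inr by linarith
    then show "radial (pr x) = x" "pr x \<bullet> u = c"
      using c0 subsetD[OF Er that] by (simp_all add: pr_def radial_scaleR radial_regular)
  qed
  \<comment> \<open>As a preimage under \<open>radial\<close> within the hyperplane the projected
    set is Borel, and the pyramid over it is \<open>Z\<close>.\<close>
  have prE: "pr ` E = {y. y \<bullet> u = c \<and> radial y \<in> E}"
  proof (intro equalityI subsetI)
    fix y assume y: "y \<in> {y. y \<bullet> u = c \<and> radial y \<in> E}"
    then have yc: "g y * (radial y \<bullet> u) = c"
      using arg_cong[OF gauge_scaleR_radial[of y], of "\<lambda>z. z \<bullet> u"] by simp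
    have "0 < radial y \<bullet> u" using y xu_pos[of "radial y"] inr by simp
    then have "c / (radial y \<bullet> u) = g y" using yc by (simp add: field_simps)
    then have "y = pr (radial y)" using gauge_scaleR_radial[of y] by (simp add: pr_def)
    then show "y \<in> pr ` E" using y by blast
  qed (use rad_pr in auto)
  let ?H = "hausdorff_outer_measure ?s"
  define Z where "Z = {x. 0 < x \<bullet> u \<and> x \<bullet> u \<le> c \<and> radial x \<in> E}"
  define L where "L = {x \<in> K. radial x \<in> E}"
  have Kb [measurable]: "K \<in> sets borel" using compact_K by (rule borel_compact)
  have Z [measurable]: "Z \<in> sets borel" and L [measurable]: "L \<in> sets borel"
    unfolding Z_def L_def by measurable
  have "?H (pr ` E) = ennreal (\<kappa> / c) * emeasure lborel {x. 0 < x \<bullet> u \<and> x \<bullet> u \<le> c \<and> (c / (x \<bullet> u)) *\<^sub>R x \<in> pr ` E}"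
    by (rule hausdorff_hyper[OF u c0]) (auto simp: prE)
  also have "{x. 0 < x \<bullet> u \<and> x \<bullet> u \<le> c \<and> (c / (x \<bullet> u)) *\<^sub>R x \<in> pr ` E} = Z"
    unfolding prE Z_def using c0 by (auto simp: radial_scaleR)
  finally have HZ: "?H (pr ` E) = ennreal (\<kappa> / c) * emeasure lborel Z" .
  have H1: "?H (pr ` E) \<le> ennreal (k ^ ?s) * ?H E"
    using k upper by (intro hausdorff_outer_measure_lipschitz_image) auto
  have "radial ` pr ` E = E" using rad_pr by (auto simp: image_image image_iff)
  moreover have "?H (radial ` pr ` E) \<le> ennreal (k ^ ?s) * ?H (pr ` E)"
    using k lower rad_pr by (intro hausdorff_outer_measure_lipschitz_image) auto
  ultimately have H2: "?H E \<le> ennreal (k ^ ?s) * ?H (pr ` E)" by simp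
  \<comment> \<open>Points of \<open>E\<close> have heights \<open>x \<bullet> u\<close> between
    \<open>c / k\<close> and \<open>k * c\<close>, so dilating either of \<open>L\<close> and
    \<open>Z\<close> by \<open>k\<close> makes it cover the other.\<close>
  have LZ: "emeasure lborel L \<le> ennreal (k ^ ?n) * emeasure lborel Z"
  proof -
    let ?A = "{x. (1 / k) *\<^sub>R x \<in> Z}"
    have "L \<subseteq> ?A"
    proof
      fix x assume x: "x \<in> L"
      then have rx: "radial x \<in> E" and gx: "g x \<le> 1" by (auto simp: L_def mem_K_iff)
      have x0: "x \<noteq> 0" using regular_radial_nz subsetD[OF Er rx] by blast
      have "x \<bullet> u = g x * (radial x \<bullet> u)" by (metis gauge_scaleR_radial inner_scaleR_left)
      moreover have "0 < radial x \<bullet> u" using xu_pos[OF rx] inr by linarith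
      moreover have "radial x \<bullet> u \<le> k * c"
        using xu_theta[OF rx] mult_right_mono[OF k(2), of c] c0 by (simp add: algebra_simps)
      ultimately have "0 < x \<bullet> u" "x \<bullet> u \<le> k * c"
        using gauge_pos[OF x0] gx mult_mono[of "g x" 1 "radial x \<bullet> u" "k * c"] by auto
      then show "x \<in> ?A" using rx k by (auto simp: Z_def radial_scaleR field_simps)
    qed
    then have "emeasure lborel L \<le> emeasure lborel ?A" by (intro emeasure_mono) auto
    also have "\<dots> = ennreal (k ^ ?n) * emeasure lborel {x. k *\<^sub>R x \<in> ?A}"
      using k by (intro emeasure_lborel_scaleR_vimage) auto
    also have "{x. k *\<^sub>R x \<in> ?A} = Z" using k by auto
    finally show ?thesis .
  qed
  have ZL: "emeasure lborel Z \<le> ennreal (k ^ ?n) * emeasure lborel L"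
  proof -
    let ?A = "{x. (1 / k) *\<^sub>R x \<in> L}"
    have "Z \<subseteq> ?A"
    proof
      fix x assume x: "x \<in> Z"
      then have rx: "radial x \<in> E" and xc: "x \<bullet> u \<le> c" by (auto simp: Z_def)
      have "x \<bullet> u = g x * (radial x \<bullet> u)" by (metis gauge_scaleR_radial inner_scaleR_left)
      moreover have "(1 - \<theta>) * c \<le> radial x \<bullet> u"
        using xu_theta[OF rx] by (simp add: algebra_simps)
      ultimately have "g x * ((1 - \<theta>) * c) \<le> c"
        using xc mult_left_mono[of "(1 - \<theta>) * c" "radial x \<bullet> u" "g x"] gauge_nonneg[of x] by linarith
      then have "g x * (1 - \<theta>) \<le> 1" using c0 by (simp add: mult.assoc[symmetric])
      then have "g ((1 / k) *\<^sub>R x) \<le> 1" using k \<theta> by (simp add: gauge_scaleR k_def mult.commute)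
      then show "x \<in> ?A" using rx k by (auto simp: L_def mem_K_iff radial_scaleR)
    qed
    then have "emeasure lborel Z \<le> emeasure lborel ?A" by (intro emeasure_mono) auto
    also have "\<dots> = ennreal (k ^ ?n) * emeasure lborel {x. k *\<^sub>R x \<in> ?A}"
      using k by (intro emeasure_lborel_scaleR_vimage) auto
    also have "{x. k *\<^sub>R x \<in> ?A} = L" using k by auto
    finally show ?thesis .
  qed
  let ?a = "\<integral>\<^sup>+x. ennreal (x \<bullet> ?\<nu> x) * indicator E x \<partial>reg_measure"
  have Es: "E \<in> sets reg_measure" using E Er by (simp add: sets_reg_measure sets_restrict_space_iff)
  have HE: "emeasure reg_measure E = ?H E" by (rule emeasure_reg_measure[OF E Er])
  have a1: "?a \<le> ennreal (k * c) * ?H E"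
  proof -
    have "?a \<le> (\<integral>\<^sup>+x. ennreal (k * c) * indicator E x \<partial>reg_measure)"
    proof (intro nn_integral_mono)
      fix x
      have "x \<bullet> ?\<nu> x \<le> k * c" if "x \<in> E"
        using xnu[OF that] mult_right_mono[OF k(2), of c] c0 by (simp add: algebra_simps)
      then show "ennreal (x \<bullet> ?\<nu> x) * indicator E x \<le> ennreal (k * c) * indicator E x"
        by (auto simp: indicator_def intro: ennreal_leI)
    qed
    also have "\<dots> = ennreal (k * c) * ?H E" using Es HE by (simp add: nn_integral_cmult_indicator)
    finally show ?thesis .
  qed
  have a2: "ennreal ((1 - \<theta>) * c) * ?H E \<le> ?a"
  proof -
    have "ennreal ((1 - \<theta>) * c) * ?H E = (\<integral>\<^sup>+x. ennreal ((1 - \<theta>) * c) * indicator E x \<partial>reg_measure)"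
      using Es HE by (simp add: nn_integral_cmult_indicator)
    also have "\<dots> \<le> ?a"
    proof (intro nn_integral_mono)
      fix x
      have "(1 - \<theta>) * c \<le> x \<bullet> ?\<nu> x" if "x \<in> E"
        using xnu[OF that] by (simp add: algebra_simps)
      then show "ennreal ((1 - \<theta>) * c) * indicator E x \<le> ennreal (x \<bullet> ?\<nu> x) * indicator E x"
        by (auto simp: indicator_def intro: ennreal_leI)
    qed
    finally show ?thesis .
  qed
  have pw: "k ^ (2 * ?n) = k * k ^ ?s * k ^ ?n"
    by (metis DIM_positive Suc_diff_1 mult_2 power_Suc power_add)
  have "?a \<le> ennreal (k * c) * (ennreal (k ^ ?s) * (ennreal (\<kappa> / c) * (ennreal (k ^ ?n) * emeasure lborel L)))"
  proof (rule order_trans[OF a1 mult_left_mono])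
    show "?H E \<le> ennreal (k ^ ?s) * (ennreal (\<kappa> / c) * (ennreal (k ^ ?n) * emeasure lborel L))"
      by (rule order_trans[OF H2[unfolded HZ]]) (intro mult_left_mono ZL; simp)
  qed simp
  also have "\<dots> = ennreal (k * c * k ^ ?s * (\<kappa> / c) * k ^ ?n) * emeasure lborel L"
    using k c0 \<kappa>_pos by (simp add: ennreal_mult[symmetric] mult.assoc[symmetric])
  also have "k * c * k ^ ?s * (\<kappa> / c) * k ^ ?n = k ^ (2 * ?n) * \<kappa>" using c0 by (simp add: pw)
  finally show "?a \<le> ennreal (k ^ (2 * ?n) * \<kappa>) * emeasure lborel {x \<in> K. radial x \<in> E}" by (simp add: L_def)
  have "ennreal \<kappa> * emeasure lborel L \<le> ennreal \<kappa> * (ennreal (k ^ ?n) * emeasure lborel Z)"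
    using LZ by (rule mult_left_mono) simp
  also have "\<dots> = ennreal (k ^ ?n * c) * ?H (pr ` E)"
    unfolding HZ using k c0 \<kappa>_pos
    by (simp add: ennreal_mult[symmetric] mult.assoc[symmetric]) (simp add: mult.commute)
  also have "\<dots> \<le> ennreal (k ^ ?n * c) * (ennreal (k ^ ?s) * ?H E)"
    using H1 by (rule mult_left_mono) simp
  also have "\<dots> = ennreal (k ^ (2 * ?n)) * (ennreal ((1 - \<theta>) * c) * ?H E)"
  proof -
    have "k ^ (2 * ?n) * ((1 - \<theta>) * c) = k ^ ?n * c * k ^ ?s * (k * (1 - \<theta>))"
      unfolding pw by (simp add: algebra_simps)
    then have "k ^ (2 * ?n) * ((1 - \<theta>) * c) = k ^ ?n * c * k ^ ?s" using k(3) by simp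
    then show ?thesis using k c0 \<theta> by (simp add: ennreal_mult[symmetric] mult.assoc[symmetric])
      (simp only: mult.assoc mult.commute[of c])
  qed
  also have "\<dots> \<le> ennreal (k ^ (2 * ?n)) * ?a" using a2 by (rule mult_left_mono) simp
  finally show "ennreal \<kappa> * emeasure lborel {x \<in> K. radial x \<in> E} \<le> ennreal (k ^ (2 * ?n)) * ?a" by (simp add: L_def)
qed

lemma measurable_gauss_inner [measurable]:
  "(\<lambda>x. x \<bullet> gauss_map K x) \<in> borel_measurable reg_measure"
proof -
  have [measurable]: "gauss_map K \<in> borel_measurable reg_measure"
    using measurable_gauss_map by (simp cong: measurable_cong_sets[OF sets_reg_measure refl])
  have [measurable]: "(\<lambda>x. x) \<in> borel_measurable reg_measure"
    by (simp add: measurable_restrict_space1 cong: measurable_cong_sets[OF sets_reg_measure refl])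
  show ?thesis by measurable
qed

lemma sets_cone_measure [measurable_cong]: "sets cone_measure = sets (restrict_space borel (regular_boundary K))"
  by (simp add: cone_measure_def)

text \<open>Pairs of a point and its normal live in a separable space. The balls of radius
  \<open>\<epsilon> / 2\<close> about a countable dense set of pairs pull back to a cover of the
  regular boundary, and on each piece point and normal vary by at most
  \<open>\<epsilon>\<close>.\<close>

lemma cone_pieces:
  assumes \<tau>: "1 < \<tau>"
  defines "N \<equiv> density reg_measure (\<lambda>x. ennreal (x \<bullet> gauss_map K x))"
    and "M \<equiv> density cone_measure (\<lambda>_. ennreal \<kappa>)"
  obtains A :: "nat \<Rightarrow> 'a set" where "range A \<subseteq> sets (restrict_space borel (regular_boundary K))"
    "(\<Union>i. A i) = regular_boundary K"
    "\<And>i E. E \<in> sets (restrict_space borel (regular_boundary K)) \<Longrightarrow> E \<subseteq> A i \<Longrightarrow> emeasure N E \<le> ennreal \<tau> * emeasure M E"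
    "\<And>i E. E \<in> sets (restrict_space borel (regular_boundary K)) \<Longrightarrow> E \<subseteq> A i \<Longrightarrow> emeasure M E \<le> ennreal \<tau> * emeasure N E"
proof -
  let ?R = "restrict_space borel (regular_boundary K)" and ?\<nu> = "gauss_map K"
  \<comment> \<open>\<open>\<theta>\<close> is taken so small that the factor in
    \<open>cone_comparison\<close> stays below \<open>\<tau>\<close>; \<open>\<epsilon>\<close> is
    then dictated by \<open>\<theta>\<close>.\<close>
  have "((\<lambda>\<theta>. (1 / (1 - \<theta>)) ^ (2 * DIM('a))) \<longlongrightarrow> (1 / (1 - 0)) ^ (2 * DIM('a))) (at_right (0::real))"
    by (intro tendsto_intros) auto
  then have "eventually (\<lambda>\<theta>::real. (1 / (1 - \<theta>)) ^ (2 * DIM('a)) < \<tau>) (at_right 0)"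
    using \<tau> by (intro order_tendstoD) auto
  moreover have "eventually (\<lambda>\<theta>::real. \<theta> \<in> {0<..<1/2}) (at_right 0)"
    by (rule eventually_at_right_real) simp
  ultimately have "eventually (\<lambda>\<theta>::real. (1 / (1 - \<theta>)) ^ (2 * DIM('a)) < \<tau> \<and> \<theta> \<in> {0<..<1/2}) (at_right 0)"
    by (rule eventually_conj)
  then obtain \<theta> :: real where \<theta>: "(1 / (1 - \<theta>)) ^ (2 * DIM('a)) < \<tau>" "0 < \<theta>" "\<theta> < 1 / 2"
    using eventually_happens'[OF trivial_limit_at_right_real] by (metis (mono_tags, lifting) greaterThanLessThan_iff)
  define \<epsilon> where "\<epsilon> = \<theta> * inr / (2 + 4 * outr)"
  have \<epsilon>: "0 < \<epsilon>" "\<epsilon> * (2 + 4 * outr) \<le> \<theta> * inr"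
    using \<theta> inr outr by (auto simp: \<epsilon>_def)
  obtain D :: "('a \<times> 'a) set" where D: "countable D" "\<And>X. open X \<Longrightarrow> X \<noteq> {} \<Longrightarrow> \<exists>d\<in>D. d \<in> X"
    using countable_dense_setE by blast
  define A where "A i = {x \<in> regular_boundary K. dist (x, ?\<nu> x) (from_nat_into D i) < \<epsilon> / 2}" for i
  show thesis
  proof
    have [measurable]: "?\<nu> \<in> borel_measurable ?R" by (rule measurable_gauss_map)
    have [measurable]: "(\<lambda>x. x) \<in> borel_measurable ?R" by (simp add: measurable_restrict_space1)
    have "{x \<in> space ?R. dist (x, ?\<nu> x) (from_nat_into D i) < \<epsilon> / 2} \<in> sets ?R" for i by measurable
    then show "range A \<subseteq> sets ?R" by (auto simp: A_def space_restrict_space)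
    show "(\<Union>i. A i) = regular_boundary K"
    proof (intro equalityI subsetI)
      fix x assume x: "x \<in> regular_boundary K"
      obtain d where d: "d \<in> D" "d \<in> ball (x, ?\<nu> x) (\<epsilon> / 2)"
        using D(2)[of "ball (x, ?\<nu> x) (\<epsilon> / 2)"] \<epsilon> by auto
      then obtain i where "from_nat_into D i = d" using D(1) by (metis from_nat_into_surj)
      then have "x \<in> A i" using d x by (simp add: A_def)
      then show "x \<in> (\<Union>i. A i)" by blast
    qed (auto simp: A_def)
    fix i E assume E: "E \<in> sets ?R" and EA: "E \<subseteq> A i"
    then have Eb: "E \<in> sets borel" and Er: "E \<subseteq> regular_boundary K" by (auto simp: sets_restrict_space_iff)
    have close: "dist (x, ?\<nu> x) (y, ?\<nu> y) \<le> \<epsilon>" if "x \<in> E" "y \<in> E" for x y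
    proof -
      have "dist (x, ?\<nu> x) (from_nat_into D i) < \<epsilon> / 2" "dist (y, ?\<nu> y) (from_nat_into D i) < \<epsilon> / 2"
        using EA that by (auto simp: A_def)
      then show ?thesis using dist_triangle2[of "(x, ?\<nu> x)" "(y, ?\<nu> y)" "from_nat_into D i"] by linarith
    qed
    have c1: "norm (x - y) \<le> \<epsilon>" if "x \<in> E" "y \<in> E" for x y
      using close[OF that] dist_fst_le[of "(x, ?\<nu> x)" "(y, ?\<nu> y)"] by (simp add: dist_norm)
    have c2: "norm (?\<nu> x - ?\<nu> y) \<le> \<epsilon>" if "x \<in> E" "y \<in> E" for x y
      using close[OF that] dist_snd_le[of "(x, ?\<nu> x)" "(y, ?\<nu> y)"] by (simp add: dist_norm)
    have NE: "emeasure N E = (\<integral>\<^sup>+x. ennreal (x \<bullet> ?\<nu> x) * indicator E x \<partial>reg_measure)"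
      unfolding N_def using E by (intro emeasure_density) (auto simp: sets_reg_measure)
    have ME: "emeasure M E = ennreal \<kappa> * emeasure lborel {x \<in> K. radial x \<in> E}"
      unfolding M_def using E emeasure_cone_measure[OF Eb Er]
      by (subst emeasure_density) (auto simp: sets_cone_measure nn_integral_cmult_indicator)
    let ?k = "(1 / (1 - \<theta>)) ^ (2 * DIM('a))"
    have "emeasure N E \<le> ennreal \<tau> * emeasure M E \<and> emeasure M E \<le> ennreal \<tau> * emeasure N E"
    proof (cases "E = {}")
      case False
      then obtain x1 where x1: "x1 \<in> E" by blast
      note cc = cone_comparison[OF Eb Er x1 \<theta>(2) less_imp_le[OF \<theta>(3)] \<epsilon> c1 c2]
      have k: "ennreal ?k \<le> ennreal \<tau>" using \<theta> by (intro ennreal_leI) simp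
      have k0: "0 \<le> ?k" using \<theta> by simp
      have "emeasure N E \<le> ennreal (?k * \<kappa>) * emeasure lborel {x \<in> K. radial x \<in> E}"
        unfolding NE by (rule cc(1))
      also have "\<dots> = ennreal ?k * emeasure M E"
        unfolding ME using k0 \<kappa>_pos by (simp add: ennreal_mult mult.assoc)
      also have "\<dots> \<le> ennreal \<tau> * emeasure M E" using k by (rule mult_right_mono) simp
      finally have 1: "emeasure N E \<le> ennreal \<tau> * emeasure M E" .
      have "emeasure M E \<le> ennreal ?k * emeasure N E"
        unfolding NE ME by (rule cc(2))
      also have "\<dots> \<le> ennreal \<tau> * emeasure N E" using k by (rule mult_right_mono) simp
      finally show ?thesis using 1 by simp
    qed simp
    then show "emeasure N E \<le> ennreal \<tau> * emeasure M E" "emeasure M E \<le> ennreal \<tau> * emeasure N E" by auto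
  qed
qed

theorem cone_volume_formula:
  "density reg_measure (\<lambda>x. ennreal (x \<bullet> gauss_map K x)) = density cone_measure (\<lambda>_. ennreal \<kappa>)"
  (is "?N = ?M")
proof (rule measure_eqI)
  have sN: "sets ?N = sets (restrict_space borel (regular_boundary K))" by (simp add: sets_reg_measure)
  have sM: "sets ?M = sets (restrict_space borel (regular_boundary K))" by (simp add: sets_cone_measure)
  have sp: "space ?N = regular_boundary K" "space ?M = regular_boundary K"
    using sets_eq_imp_space_eq[OF sN] sets_eq_imp_space_eq[OF sM] by (auto simp: space_restrict_space)
  show "sets ?N = sets ?M" using sN sM by simp
  fix X assume X: "X \<in> sets ?N"
  show "emeasure ?N X = emeasure ?M X"
  proof (rule antisym)
    show "emeasure ?N X \<le> emeasure ?M X"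
    proof (rule piecewise_emeasure_le)
      show "sets ?N = sets ?M" "X \<in> sets ?M" using X sN sM by auto
      fix \<tau> :: real assume "1 < \<tau>"
      from cone_pieces[OF this] show "\<exists>A::nat \<Rightarrow> 'a set. range A \<subseteq> sets ?M \<and> \<Union> (range A) = space ?M \<and>
          (\<forall>i E. E \<in> sets ?M \<longrightarrow> E \<subseteq> A i \<longrightarrow> emeasure ?N E \<le> ennreal \<tau> * emeasure ?M E)"
        unfolding sp sM by metis
    qed
    show "emeasure ?M X \<le> emeasure ?N X"
    proof (rule piecewise_emeasure_le)
      show "sets ?M = sets ?N" "X \<in> sets ?N" using X sN sM by auto
      fix \<tau> :: real assume "1 < \<tau>"
      from cone_pieces[OF this] show "\<exists>A::nat \<Rightarrow> 'a set. range A \<subseteq> sets ?N \<and> \<Union> (range A) = space ?N \<and>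
          (\<forall>i E. E \<in> sets ?N \<longrightarrow> E \<subseteq> A i \<longrightarrow> emeasure ?M E \<le> ennreal \<tau> * emeasure ?N E)"
        unfolding sp sN by metis
    qed
  qed
qed

end

section \<open>The Orlicz surface area as a volume integral\<close>

text \<open>The measures of the translates of \<open>D\<close> along \<open>e\<close> are averaged
  over a unit interval of shifts. Each equals the measure of \<open>D\<close>, while exchanging the
  integrals leaves only intersections of \<open>D\<close> with lines; no coordinates adapted to
  \<open>e\<close> have to be chosen.\<close>

lemma null_set_if_lines_null:
  fixes D :: "'a::euclidean_space set"
  assumes [measurable]: "D \<in> sets borel" and lines: "\<And>x. emeasure lborel {t::real. x + t *\<^sub>R e \<in> D} = 0"
  shows "emeasure lborel D = 0"
proof -
  have "emeasure lborel D = (\<integral>\<^sup>+t. emeasure lborel D * indicator {0..1::real} t \<partial>lborel)"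
    by (simp add: nn_integral_cmult_indicator)
  also have "\<dots> = (\<integral>\<^sup>+t. (\<integral>\<^sup>+x. indicator D (x + t *\<^sub>R e) * indicator {0..1::real} t \<partial>lborel) \<partial>lborel)"
  proof (intro nn_integral_cong)
    fix t :: real
    have "(\<integral>\<^sup>+x. indicator D (x + t *\<^sub>R e) * indicator {0..1} t \<partial>lborel) =
        (\<integral>\<^sup>+x. indicator {x. x + t *\<^sub>R e \<in> D} x \<partial>lborel) * indicator {0..1} t"
      by (subst nn_integral_multc[symmetric]) (auto simp: indicator_def intro!: nn_integral_cong)
    also have "(\<integral>\<^sup>+x. indicator {x. x + t *\<^sub>R e \<in> D} x \<partial>lborel) = emeasure lborel {x. x + t *\<^sub>R e \<in> D}"
      by (rule nn_integral_indicator) simp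
    also have "\<dots> = emeasure lborel D" by (rule emeasure_lborel_translate) simp
    finally show "emeasure lborel D * indicator {0..1} t =
        (\<integral>\<^sup>+x. indicator D (x + t *\<^sub>R e) * indicator {0..1} t \<partial>lborel)" ..
  qed
  also have "\<dots> = (\<integral>\<^sup>+x. (\<integral>\<^sup>+t. indicator D (x + t *\<^sub>R e) * indicator {0..1::real} t \<partial>lborel) \<partial>lborel)"
    by (rule lborel_pair.Fubini') measurable
  also have "\<dots> = (\<integral>\<^sup>+x. 0 \<partial>(lborel :: 'a measure))"
  proof (intro nn_integral_cong)
    fix x :: 'a
    have "(\<integral>\<^sup>+t. indicator D (x + t *\<^sub>R e) * indicator {0..1::real} t \<partial>lborel) \<le>
        (\<integral>\<^sup>+t. indicator {t. x + t *\<^sub>R e \<in> D} t \<partial>lborel)"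
      by (intro nn_integral_mono) (auto simp: indicator_def)
    also have "\<dots> = emeasure lborel {t. x + t *\<^sub>R e \<in> D}"
      by (rule nn_integral_indicator) simp
    finally show "(\<integral>\<^sup>+t. indicator D (x + t *\<^sub>R e) * indicator {0..1::real} t \<partial>lborel) = 0"
      using lines[of x] by simp
  qed
  finally show ?thesis by simp
qed

context body
begin

text \<open>The points at which the gauge has two subgradients with different components along
  \<open>e\<close>, that is, where its derivative in direction \<open>e\<close> jumps.\<close>

definition kinks :: "'a \<Rightarrow> 'a set" where
  "kinks e = {x. \<exists>p\<in>P. \<exists>q\<in>P. p \<bullet> x = g x \<and> q \<bullet> x = g x \<and> p \<bullet> e < q \<bullet> e}"

text \<open>Bounding the jump below by \<open>1 / (k + 1)\<close> and the point by \<open>m\<close>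
  in norm makes the set of triples \<open>(x, p, q)\<close> compact; the kinks are the union of the
  projections.\<close>

lemma kinks_borel [measurable]: "kinks e \<in> sets borel"
proof -
  let ?C = "\<lambda>m k. {z \<in> cball 0 (real m) \<times> (P \<times> P). fst (snd z) \<bullet> fst z = g (fst z) \<and>
      snd (snd z) \<bullet> fst z = g (fst z) \<and> fst (snd z) \<bullet> e + 1 / real (Suc k) \<le> snd (snd z) \<bullet> e}"
  have "kinks e = (\<Union>m k. fst ` ?C m k)"
  proof (intro equalityI subsetI)
    fix x assume "x \<in> kinks e"
    then obtain p q where pq: "p \<in> P" "q \<in> P" "p \<bullet> x = g x" "q \<bullet> x = g x" "p \<bullet> e < q \<bullet> e"
      by (auto simp: kinks_def)
    obtain k where k: "1 / real (Suc k) < q \<bullet> e - p \<bullet> e" using nat_approx_posE[of "q \<bullet> e - p \<bullet> e"] pq by auto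
    obtain m :: nat where m: "norm x \<le> real m" using real_arch_simple by blast
    have "x \<in> fst ` ?C m k"
      using pq k m by (intro image_eqI[of _ _ "(x, p, q)"]) auto
    then show "x \<in> (\<Union>m k. fst ` ?C m k)" by blast
  next
    fix x assume "x \<in> (\<Union>m k. fst ` ?C m k)"
    then obtain k p q where pq: "p \<in> P" "q \<in> P" "p \<bullet> x = g x" "q \<bullet> x = g x" "p \<bullet> e + 1 / real (Suc k) \<le> q \<bullet> e"
      by auto
    moreover have "0 < 1 / real (Suc k)" by simp
    ultimately have "p \<bullet> e < q \<bullet> e" by linarith
    then show "x \<in> kinks e" using pq by (auto simp: kinks_def)
  qed
  moreover have "compact (?C m k)" for m k
  proof -
    have "closed {z::'a\<times>'a\<times>'a. fst (snd z) \<bullet> fst z = g (fst z) \<and>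
      snd (snd z) \<bullet> fst z = g (fst z) \<and> fst (snd z) \<bullet> e + 1 / real (Suc k) \<le> snd (snd z) \<bullet> e}"
      by (intro closed_Collect_conj closed_Collect_le closed_Collect_eq continuous_intros
           continuous_on_compose2[OF continuous_gauge[of UNIV]]) auto
    from compact_Int_closed[OF compact_Times[OF compact_cball compact_Times[OF compact_polar compact_polar]] this]
    show ?thesis by (simp only: Collect_conj_eq Collect_mem_eq)
  qed
  then have "compact (fst ` ?C m k)" for m k
    by (intro compact_continuous_image continuous_intros) auto
  ultimately show ?thesis
    by (simp only:) (intro sets.countable_UN'' borel_compact; simp)
qed

text \<open>Subgradients of a convex function increase along a line, so at different kinks the open
  intervals between the two components along \<open>e\<close> are disjoint and ordered. A rational
  chosen in each of them is strictly increasing in \<open>t\<close>.\<close>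

lemma countable_kinks_line: "countable {t::real. x + t *\<^sub>R e \<in> kinks e}"
proof -
  let ?T = "{t::real. x + t *\<^sub>R e \<in> kinks e}"
  define Q where "Q t c \<longleftrightarrow> (\<exists>p\<in>P. \<exists>q\<in>P. p \<bullet> (x + t *\<^sub>R e) = g (x + t *\<^sub>R e) \<and>
      q \<bullet> (x + t *\<^sub>R e) = g (x + t *\<^sub>R e) \<and> p \<bullet> e < real_of_rat c \<and> real_of_rat c < q \<bullet> e)" for t c
  have "\<exists>c. Q t c" if t: "t \<in> ?T" for t
  proof -
    obtain p q where pq: "p \<in> P" "q \<in> P" "p \<bullet> (x + t *\<^sub>R e) = g (x + t *\<^sub>R e)"
      "q \<bullet> (x + t *\<^sub>R e) = g (x + t *\<^sub>R e)" "p \<bullet> e < q \<bullet> e"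
      using t by (auto simp: kinks_def)
    obtain c where "p \<bullet> e < real_of_rat c" "real_of_rat c < q \<bullet> e" using of_rat_dense[OF pq(5)] by blast
    then show ?thesis unfolding Q_def using pq by blast
  qed
  then obtain r where r: "\<And>t. t \<in> ?T \<Longrightarrow> Q t (r t)" by metis
  have mono: "r s < r t" if st: "s \<in> ?T" "t \<in> ?T" "s < t" for s t
  proof -
    obtain q where q: "q \<in> P" "q \<bullet> (x + s *\<^sub>R e) = g (x + s *\<^sub>R e)" "real_of_rat (r s) < q \<bullet> e"
      using r[OF st(1)] unfolding Q_def by blast
    obtain p where p: "p \<in> P" "p \<bullet> (x + t *\<^sub>R e) = g (x + t *\<^sub>R e)" "p \<bullet> e < real_of_rat (r t)"
      using r[OF st(2)] unfolding Q_def by blast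
    have "q \<bullet> (x + t *\<^sub>R e) \<le> p \<bullet> (x + t *\<^sub>R e)"
      using inner_polar_le[OF q(1), of "x + t *\<^sub>R e"] p(2) by linarith
    moreover have "p \<bullet> (x + s *\<^sub>R e) \<le> q \<bullet> (x + s *\<^sub>R e)"
      using inner_polar_le[OF p(1), of "x + s *\<^sub>R e"] q(2) by linarith
    ultimately have "(t - s) * (q \<bullet> e) \<le> (t - s) * (p \<bullet> e)"
      by (simp add: inner_add_right algebra_simps)
    then have "q \<bullet> e \<le> p \<bullet> e" using st(3) by (simp add: mult_le_cancel_left)
    then have "real_of_rat (r s) < real_of_rat (r t)" using p(3) q(3) by linarith
    then show ?thesis by (simp add: of_rat_less)
  qed
  have "inj_on r ?T"
  proof (rule inj_onI)
    fix s t assume "s \<in> ?T" "t \<in> ?T" "r s = r t"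
    then show "s = t" using mono[of s t] mono[of t s] by (cases s t rule: linorder_cases) auto
  qed
  then show ?thesis by (metis countable_image_inj_on countableI_type)
qed

lemma emeasure_kinks: "emeasure lborel (kinks e) = 0"
  using countable_kinks_line
  by (intro null_set_if_lines_null[of _ e]) (auto intro!: emeasure_lborel_countable)

end

context normalized_body
begin

text \<open>The norm of the gradient of the gauge, written through the Gauss map. It is constant
  along rays and can therefore be carried between \<open>K\<close> and its boundary.\<close>

definition grad_norm :: "'a \<Rightarrow> real" where
  "grad_norm x = 1 / (radial x \<bullet> gauss_map K (radial x))"

lemma radial_frontier: "x \<noteq> 0 \<Longrightarrow> radial x \<in> frontier K"
  using gauge_pos[of x] by (simp add: frontier_K radial_def gauge_scaleR)

text \<open>Two unit normals at \<open>radial x\<close> give two distinct subgradients at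
  \<open>x\<close>. They differ in some coordinate, so \<open>x\<close> is a kink in the direction
  of a basis vector, and such points form a null set.\<close>

lemma AE_radial_regular: "AE x in lborel. radial x \<in> regular_boundary K"
proof (rule AE_I')
  have "kinks e \<in> null_sets lborel" for e by (simp add: null_setsI emeasure_kinks)
  then have "(\<Union>e\<in>Basis. kinks e) \<in> null_sets lborel"
    by (intro null_sets_UN') (auto intro: countable_finite)
  moreover have "{0} \<in> null_sets (lborel :: 'a measure)" by (simp add: finite_imp_null_set_lborel)
  ultimately show "{0} \<union> (\<Union>e\<in>Basis. kinks e) \<in> null_sets lborel" by blast
  show "{x \<in> space lborel. radial x \<notin> regular_boundary K} \<subseteq> {0} \<union> (\<Union>e\<in>Basis. kinks e)"
  proof (safe)
    fix x assume nr: "radial x \<notin> regular_boundary K" and nk: "x \<notin> (\<Union>e\<in>Basis. kinks e)"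
    show "x = 0"
    proof (rule ccontr)
      assume x0: "x \<noteq> 0"
      let ?r = "radial x"
      obtain u v where uv: "outer_unit_normal K ?r u" "outer_unit_normal K ?r v" "u \<noteq> v"
        using nr radial_frontier[OF x0] normal_exists[OF radial_frontier[OF x0]] by (auto simp: regular_boundary_def)
      define p where "p = (1 / (?r \<bullet> u)) *\<^sub>R u"
      define q where "q = (1 / (?r \<bullet> v)) *\<^sub>R v"
      have pos: "0 < ?r \<bullet> u" "0 < ?r \<bullet> v"
        using normal_inner_ge[OF uv(1)] normal_inner_ge[OF uv(2)] inr by linarith+
      have P: "p \<in> P" "q \<in> P" and r1: "p \<bullet> ?r = 1" "q \<bullet> ?r = 1"
        using normal_imp_polar[OF uv(1)] normal_imp_polar[OF uv(2)] by (auto simp: p_def q_def)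
      have sc: "p' \<bullet> x = g x" if "p' \<bullet> ?r = 1" for p'
        using arg_cong[OF gauge_scaleR_radial[of x], of "\<lambda>z. p' \<bullet> z"] that by simp
      have "p \<noteq> q"
      proof
        assume "p = q"
        moreover have "norm p = 1 / (?r \<bullet> u)" "norm q = 1 / (?r \<bullet> v)"
          using uv pos by (auto simp: p_def q_def outer_unit_normal_def)
        ultimately have "?r \<bullet> u = ?r \<bullet> v" by simp
        then have "u = v" using \<open>p = q\<close> pos by (simp add: p_def q_def)
        then show False using uv by simp
      qed
      then obtain e where "e \<in> Basis" "p \<bullet> e \<noteq> q \<bullet> e" using euclidean_eqI by blast
      moreover from this consider "p \<bullet> e < q \<bullet> e" | "q \<bullet> e < p \<bullet> e" by linarith
      ultimately have "x \<in> kinks e"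
        unfolding kinks_def using P sc[OF r1(1)] sc[OF r1(2)] by cases blast+
      then show False using nk \<open>e \<in> Basis\<close> by blast
    qed
  qed
qed

lemma grad_norm_bounds:
  assumes "radial x \<in> regular_boundary K"
  shows "1 / outr \<le> grad_norm x" "grad_norm x \<le> 1 / inr" "0 < grad_norm x"
proof -
  note r = regular_boundaryD[OF assms]
  have "radial x \<bullet> gauss_map K (radial x) \<le> norm (radial x) * norm (gauss_map K (radial x))"
    by (rule norm_cauchy_schwarz)
  then have "radial x \<bullet> gauss_map K (radial x) \<le> outr" using r(4) norm_le_outr[OF r(2)] by simp
  then show "1 / outr \<le> grad_norm x" "grad_norm x \<le> 1 / inr" "0 < grad_norm x"
    using r(5) inr outr by (auto simp: grad_norm_def intro!: divide_left_mono)
qed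

text \<open>A subgradient at \<open>x\<close> is proportional to a normal at
  \<open>radial x\<close>; uniqueness of the normal fixes its length.\<close>

lemma norm_gradient:
  assumes "radial x \<in> regular_boundary K" "q \<in> P" "q \<bullet> x = g x"
  shows "norm q = grad_norm x"
proof -
  have "x \<noteq> 0" using regular_radial_nz assms by blast
  then have qr: "q \<bullet> radial x = 1" using assms(3) gauge_pos[of x] by (simp add: radial_def)
  note n = polar_imp_normal[OF assms(2) qr]
  have "gauss_map K (radial x) = (1 / norm q) *\<^sub>R q" using gauss_map_unique[OF assms(1) n(1)] by simp
  moreover have "q \<noteq> 0" using qr by auto
  ultimately show ?thesis using n(2) by (simp add: grad_norm_def)
qed

lemma gauge_le_grad_norm:
  assumes "radial x \<in> regular_boundary K"
  shows "g x \<le> grad_norm x * norm x"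
proof -
  obtain q where q: "q \<in> P" "q \<bullet> x = g x" by (rule gauge_attained)
  then have "g x \<le> norm q * norm x" using norm_cauchy_schwarz[of q x] by simp
  then show ?thesis using norm_gradient[OF assms q] by simp
qed

lemma gauge_le_parallel:
  assumes "radial (k + e *\<^sub>R b) \<in> regular_boundary K" "k \<in> K" "norm b \<le> 1" "0 \<le> e"
  shows "g (k + e *\<^sub>R b) \<le> 1 + e * grad_norm (k + e *\<^sub>R b)"
proof -
  let ?y = "k + e *\<^sub>R b"
  obtain q where q: "q \<in> P" "q \<bullet> ?y = g ?y" by (rule gauge_attained)
  have "q \<bullet> k \<le> 1" using q(1) assms(2) by (auto simp: polar_body_def)
  moreover have "q \<bullet> b \<le> norm q"
    using norm_cauchy_schwarz[of q b] mult_left_mono[OF assms(3), of "norm q"] by simp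
  then have "e * (q \<bullet> b) \<le> e * norm q" using assms(4) by (rule mult_left_mono)
  ultimately have "q \<bullet> ?y \<le> 1 + e * norm q" by (simp add: inner_add_right)
  then show ?thesis using q norm_gradient[OF assms(1) q] by simp
qed

lemma grad_norm_measurable [measurable]: "grad_norm \<in> borel_measurable (restrict_space lborel {x. radial x \<in> regular_boundary K})"
proof -
  have [measurable]: "(\<lambda>x. x \<bullet> gauss_map K x) \<in> borel_measurable (restrict_space borel (regular_boundary K))"
    using measurable_gauss_inner by (simp cong: measurable_cong_sets[OF sets_reg_measure refl])
  have [measurable]: "radial \<in> restrict_space lborel {x. radial x \<in> regular_boundary K} \<rightarrow>\<^sub>M restrict_space borel (regular_boundary K)"
    by (intro measurable_restrict_space3) auto
  show ?thesis unfolding grad_norm_def by measurable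
qed

section \<open>Volume of a star-shaped set given by a radial function\<close>

text \<open>Polar coordinates relative to \<open>K\<close>: over boundary points where
  \<open>\<rho>\<close> is constant, the star-shaped set is a dilate of the corresponding cone in
  \<open>K\<close>, so its volume is \<open>\<rho> ^ n\<close> times the cone measure. A general
  \<open>\<rho>\<close> is cut into slices on which it is almost constant.\<close>

lemma emeasure_sublevel_le:
  assumes e: "0 \<le> e"
  shows "emeasure lborel {y. radial y \<in> regular_boundary K \<and> g y \<le> 1 + e * grad_norm y} \<le>
    (\<integral>\<^sup>+x. ennreal ((1 + e * grad_norm x) ^ DIM('a)) \<partial>restrict_space lborel regular_part)"
proof -
  let ?R = "restrict_space borel (regular_boundary K)"
  define \<rho> where "\<rho> x = 1 + e * (1 / (x \<bullet> gauss_map K x))" for x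
  have rho_grad_norm: "\<rho> (radial y) = 1 + e * grad_norm y" for y by (simp add: \<rho>_def grad_norm_def)
  have [measurable]: "(\<lambda>x. x \<bullet> gauss_map K x) \<in> borel_measurable ?R"
    using measurable_gauss_inner by (simp cong: measurable_cong_sets[OF sets_reg_measure refl])
  have \<rho> [measurable]: "\<rho> \<in> borel_measurable ?R" unfolding \<rho>_def by measurable
  have \<rho>1: "1 \<le> \<rho> x" if "x \<in> regular_boundary K" for x
    using regular_boundaryD(5)[OF that] inr e by (simp add: \<rho>_def)
  define Y where "Y = {y. radial y \<in> regular_boundary K \<and> g y \<le> 1 + e * grad_norm y}"
  have Y [measurable]: "Y \<in> sets borel"
  proof -
    let ?S = "restrict_space lborel {x. radial x \<in> regular_boundary K}"
    have [measurable]: "g \<in> borel_measurable ?S" by (intro measurable_restrict_space1) simp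
    have "{y \<in> space ?S. g y \<le> 1 + e * grad_norm y} \<in> sets ?S" by measurable
    then show ?thesis by (subst (asm) sets_restrict_space_iff) (auto simp: Y_def space_restrict_space)
  qed
  define N where "N = distr (restrict_space lborel Y) ?R radial"
  define M where "M = density cone_measure (\<lambda>x. ennreal (\<rho> x ^ DIM('a)))"
  have sN: "sets N = sets ?R" and sM: "sets M = sets ?R" by (auto simp: N_def M_def sets_cone_measure)
  have spM: "space M = regular_boundary K" using sets_eq_imp_space_eq[OF sM] by (simp add: space_restrict_space)
  have radY [measurable]: "radial \<in> restrict_space lborel Y \<rightarrow>\<^sub>M ?R"
    by (intro measurable_restrict_space3) (auto simp: Y_def)
  have emN: "emeasure N E = emeasure lborel {y. radial y \<in> E \<and> g y \<le> 1 + e * grad_norm y}" if E: "E \<in> sets ?R" for E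
  proof -
    have Er: "E \<subseteq> regular_boundary K" using E by (auto simp: sets_restrict_space_iff)
    then have eq: "radial -` E \<inter> space (restrict_space lborel Y) = {y. radial y \<in> E \<and> g y \<le> 1 + e * grad_norm y}"
      by (auto simp: Y_def space_restrict_space)
    have "{y. radial y \<in> E \<and> g y \<le> 1 + e * grad_norm y} \<subseteq> Y" using Er by (auto simp: Y_def)
    then show ?thesis unfolding N_def emeasure_distr[OF radY E] eq by (subst emeasure_restrict_space) auto
  qed
  have "emeasure N (regular_boundary K) \<le> emeasure M (regular_boundary K)"
  proof (rule piecewise_emeasure_le)
    show "sets N = sets M" using sN sM by simp
    show "regular_boundary K \<in> sets M" by (simp add: sM sets_restrict_space_iff)
    fix \<tau> :: real assume \<tau>: "1 < \<tau>"
    have "((\<lambda>\<eta>. (1 + \<eta>) ^ DIM('a)) \<longlongrightarrow> (1 + 0) ^ DIM('a)) (at_right (0::real))"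
      by (intro tendsto_intros)
    then have "eventually (\<lambda>\<eta>::real. (1 + \<eta>) ^ DIM('a) < \<tau>) (at_right 0)"
      using \<tau> by (intro order_tendstoD) auto
    moreover have "eventually (\<lambda>\<eta>::real. 0 < \<eta>) (at_right 0)" by (rule eventually_at_right_less)
    ultimately have "eventually (\<lambda>\<eta>::real. (1 + \<eta>) ^ DIM('a) < \<tau> \<and> 0 < \<eta>) (at_right 0)" by (rule eventually_conj)
    then obtain \<eta> :: real where \<eta>: "(1 + \<eta>) ^ DIM('a) < \<tau>" "0 < \<eta>"
      using eventually_happens'[OF trivial_limit_at_right_real] by (metis (mono_tags, lifting))
    \<comment> \<open>Since \<open>\<rho> \<ge> 1\<close>, an additive step \<open>\<eta>\<close>
      costs at most a factor \<open>1 + \<eta>\<close>, whose power of exponent \<open>n\<close> is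
      below \<open>\<tau>\<close>.\<close>
    define A where "A j = {x \<in> regular_boundary K. real j * \<eta> \<le> \<rho> x \<and> \<rho> x < (real j + 1) * \<eta>}" for j :: nat
    have "{x \<in> space ?R. real j * \<eta> \<le> \<rho> x \<and> \<rho> x < (real j + 1) * \<eta>} \<in> sets ?R" for j by measurable
    then have "range A \<subseteq> sets M" by (auto simp: A_def sM space_restrict_space)
    moreover have "(\<Union>j. A j) = space M"
    proof (intro equalityI subsetI)
      fix x assume "x \<in> space M"
      then have x: "x \<in> regular_boundary K" by (simp add: spM)
      have "real (nat \<lfloor>\<rho> x / \<eta>\<rfloor>) \<le> \<rho> x / \<eta>" "\<rho> x / \<eta> < real (nat \<lfloor>\<rho> x / \<eta>\<rfloor>) + 1"
        using \<rho>1[OF x] \<eta> by (auto simp: of_nat_floor, linarith?)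
      then have "x \<in> A (nat \<lfloor>\<rho> x / \<eta>\<rfloor>)" using x \<eta> by (simp add: A_def field_simps)
      then show "x \<in> (\<Union>j. A j)" by blast
    qed (auto simp: A_def spM)
    moreover have "emeasure N E \<le> ennreal \<tau> * emeasure M E" if E: "E \<in> sets M" and EA: "E \<subseteq> A j" for j E
    proof -
      have E': "E \<in> sets ?R" and Eb [measurable]: "E \<in> sets borel" and Er: "E \<subseteq> regular_boundary K"
        using E by (auto simp: sM sets_restrict_space_iff)
      define s where "s = (real j + 1) * \<eta>"
      have s: "0 < s" using \<eta> by (simp add: s_def)
      let ?Z = "{y. radial y \<in> E \<and> g y \<le> s}"
      have "{y. radial y \<in> E \<and> g y \<le> 1 + e * grad_norm y} \<subseteq> ?Z"
        using EA rho_grad_norm by (auto simp: A_def s_def subset_eq)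
      then have "emeasure N E \<le> emeasure lborel ?Z"
        unfolding emN[OF E'] by (intro emeasure_mono) auto
      also have "\<dots> = ennreal (s ^ DIM('a)) * emeasure lborel {x. s *\<^sub>R x \<in> ?Z}"
        by (rule emeasure_lborel_scaleR_vimage[OF s]) measurable
      also have "{x. s *\<^sub>R x \<in> ?Z} = {x \<in> K. radial x \<in> E}"
        using s by (auto simp: radial_scaleR gauge_scaleR mem_K_iff)
      also have "emeasure lborel {x \<in> K. radial x \<in> E} = emeasure cone_measure E"
        using emeasure_cone_measure[OF Eb Er] by simp
      also have "ennreal (s ^ DIM('a)) * emeasure cone_measure E =
          (\<integral>\<^sup>+x. ennreal (s ^ DIM('a)) * indicator E x \<partial>cone_measure)"
        using E' by (simp add: nn_integral_cmult_indicator sets_cone_measure)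
      also have "\<dots> \<le> (\<integral>\<^sup>+x. ennreal \<tau> * (ennreal (\<rho> x ^ DIM('a)) * indicator E x) \<partial>cone_measure)"
      proof (intro nn_integral_mono)
        fix x
        have "s ^ DIM('a) \<le> \<tau> * \<rho> x ^ DIM('a)" if "x \<in> E"
        proof -
          have "s \<le> \<rho> x + \<eta>" using EA that by (auto simp: A_def s_def algebra_simps)
          also have "\<dots> \<le> (1 + \<eta>) * \<rho> x" using \<rho>1[of x] Er that \<eta> by (auto simp: algebra_simps)
          finally have "s ^ DIM('a) \<le> ((1 + \<eta>) * \<rho> x) ^ DIM('a)" using s by (intro power_mono) auto
          also have "\<dots> \<le> \<tau> * \<rho> x ^ DIM('a)"
            unfolding power_mult_distrib using \<eta> \<rho>1[of x] Er that by (intro mult_right_mono) auto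
          finally show ?thesis .
        qed
        then show "ennreal (s ^ DIM('a)) * indicator E x \<le> ennreal \<tau> * (ennreal (\<rho> x ^ DIM('a)) * indicator E x)"
          using \<tau> by (auto simp: indicator_def ennreal_mult'[symmetric] intro!: ennreal_leI)
      qed
      also have "\<dots> = ennreal \<tau> * (\<integral>\<^sup>+x. ennreal (\<rho> x ^ DIM('a)) * indicator E x \<partial>cone_measure)"
        using E' by (intro nn_integral_cmult) (auto simp: sets_cone_measure)
      also have "(\<integral>\<^sup>+x. ennreal (\<rho> x ^ DIM('a)) * indicator E x \<partial>cone_measure) = emeasure M E"
        unfolding M_def using E' by (intro emeasure_density[symmetric]) (auto simp: sets_cone_measure)
      finally show ?thesis .
    qed
    ultimately show "\<exists>A::nat \<Rightarrow> 'a set. range A \<subseteq> sets M \<and> \<Union> (range A) = space M \<and>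
        (\<forall>i E. E \<in> sets M \<longrightarrow> E \<subseteq> A i \<longrightarrow> emeasure N E \<le> ennreal \<tau> * emeasure M E)" by blast
  qed
  moreover have "emeasure N (regular_boundary K) = emeasure lborel {y. radial y \<in> regular_boundary K \<and> g y \<le> 1 + e * grad_norm y}"
    by (rule emN) (simp add: sets_restrict_space_iff)
  moreover have "emeasure M (regular_boundary K) =
      (\<integral>\<^sup>+x. ennreal ((1 + e * grad_norm x) ^ DIM('a)) \<partial>restrict_space lborel regular_part)"
  proof -
    have "emeasure M (regular_boundary K) = (\<integral>\<^sup>+x. ennreal (\<rho> x ^ DIM('a)) \<partial>cone_measure)"
      unfolding M_def spM[symmetric, unfolded M_def]
      by (subst emeasure_density) (auto intro!: nn_integral_cong)
    also have "\<dots> = (\<integral>\<^sup>+x. ennreal (\<rho> (radial x) ^ DIM('a)) \<partial>restrict_space lborel regular_part)"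
      unfolding cone_measure_def by (subst nn_integral_distr[OF measurable_radial_regular]) auto
    finally show ?thesis by (simp add: rho_grad_norm)
  qed
  ultimately show ?thesis by simp
qed

lemma emeasure_regular_part: "emeasure lborel regular_part = emeasure lborel K"
proof (rule emeasure_eq_AE)
  show "AE x in lborel. (x \<in> regular_part) = (x \<in> K)"
    using AE_radial_regular by eventually_elim (simp add: regular_part_def)
qed (use compact_K in \<open>auto intro: borel_compact\<close>)

lemma finite_regular_part: "finite_measure (restrict_space lborel regular_part)"
proof
  have "emeasure lborel K < \<infinity>" using compact_K by (rule emeasure_compact_finite)
  then show "emeasure (restrict_space lborel regular_part) (space (restrict_space lborel regular_part)) \<noteq> \<infinity>"
    by (auto simp: space_restrict_space emeasure_restrict_space emeasure_regular_part)
qed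

lemma measure_regular_part: "measure (restrict_space lborel regular_part) (space (restrict_space lborel regular_part)) = measure lebesgue K"
  using compact_K
  by (simp add: space_restrict_space measure_restrict_space measure_def[of lborel] emeasure_regular_part
      borel_compact measure_def[of lebesgue])

lemma grad_norm_measurable_regular_part [measurable]: "grad_norm \<in> borel_measurable (restrict_space lborel regular_part)"
proof -
  have "regular_part \<subseteq> {x. radial x \<in> regular_boundary K}" by (auto simp: regular_part_def)
  then have "restrict_space lborel regular_part = restrict_space (restrict_space lborel {x. radial x \<in> regular_boundary K}) regular_part"
    by (subst restrict_restrict_space) (auto simp: inf_absorb2)
  then show ?thesis using measurable_restrict_space1[OF grad_norm_measurable] by simp
qed

lemma support_fun_normal: "outer_unit_normal K x u \<Longrightarrow> x \<in> K \<Longrightarrow> support_fun K u = x \<bullet> u"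
  unfolding support_fun_def outer_unit_normal_def
  by (intro cSup_eq_maximum) auto

lemma support_fun_diff_le: "support_fun K u - support_fun K v \<le> outr * norm (u - v)"
proof -
  have ne: "K \<noteq> {}" using in_K_if_norm_le[of 0] inr by auto
  have bdd: "bdd_above ((\<lambda>x. x \<bullet> w) ` K)" for w
    using compact_K by (intro bounded_imp_bdd_above compact_imp_bounded compact_continuous_image continuous_intros)
  have "support_fun K u \<le> support_fun K v + outr * norm (u - v)"
    unfolding support_fun_def[of K u]
  proof (rule cSUP_least[OF ne])
    fix x assume x: "x \<in> K"
    have "x \<bullet> v \<le> support_fun K v" unfolding support_fun_def by (rule cSUP_upper[OF x bdd])
    moreover have "x \<bullet> (u - v) \<le> outr * norm (u - v)"
      by (rule order_trans[OF norm_cauchy_schwarz]) (simp add: mult_right_mono norm_le_outr[OF x])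
    ultimately show "x \<bullet> u \<le> support_fun K v + outr * norm (u - v)" by (simp add: inner_diff_right)
  qed
  then show ?thesis by simp
qed

lemma measurable_support_fun [measurable]: "support_fun K \<in> borel_measurable borel"
proof (intro borel_measurable_continuous_onI lipschitz_on_continuous_on lipschitz_onI)
  fix u v
  show "dist (support_fun K u) (support_fun K v) \<le> outr * dist u v"
    using support_fun_diff_le[of u v] support_fun_diff_le[of v u]
    by (auto simp: dist_norm norm_minus_commute abs_le_iff)
qed (use outr in auto)

lemma support_fun_pos: assumes "norm u = 1" shows "0 < support_fun K u"
proof -
  have "bdd_above ((\<lambda>x. x \<bullet> u) ` K)"
    using compact_K by (intro bounded_imp_bdd_above compact_imp_bounded compact_continuous_image continuous_intros)
  moreover have "inr *\<^sub>R u \<in> K" using assms inr by (intro in_K_if_norm_le) auto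
  ultimately have "inr *\<^sub>R u \<bullet> u \<le> support_fun K u" unfolding support_fun_def by (intro cSUP_upper)
  then show ?thesis using assms inr by (simp add: dot_square_norm)
qed

lemma support_fun_unit_ball: "norm u = 1 \<Longrightarrow> support_fun (cball 0 1) u = 1"
  unfolding support_fun_def
proof (rule cSup_eq_maximum)
  assume u: "norm u = 1"
  show "1 \<in> (\<lambda>x. x \<bullet> u) ` cball 0 1"
    using u by (intro image_eqI[of _ _ u]) (auto simp: dot_square_norm)
  fix y assume "y \<in> (\<lambda>x. x \<bullet> u) ` cball 0 1"
  then obtain x where "y = x \<bullet> u" "norm x \<le> 1" by auto
  then show "y \<le> 1" using norm_cauchy_schwarz[of x u] u by simp
qed

text \<open>Under the Gauss map the weight \<open>support_fun K u\<close> becomes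
  \<open>x \<bullet> gauss_map K x\<close>, exactly the density in the cone-volume formula, and its
  reciprocal becomes \<open>grad_norm\<close>.\<close>

theorem orlicz_surface_area_eq_integral:
  assumes \<phi>: "convex_on {0<..} \<phi>"
  shows "orlicz_surface_area \<phi> K = \<kappa> * (LINT x|restrict_space lborel regular_part. \<phi> (grad_norm x))"
proof -
  let ?\<nu> = "gauss_map K"
  let ?S = "restrict_space borel (sphere (0::'a) 1)"
  \<comment> \<open>Outside the positive reals \<open>\<phi>\<close> is arbitrary. Cut off to 0
    there, it is Borel, because a convex function is continuous on an open interval.\<close>
  define \<psi> where "\<psi> t = indicator {0<..} t *\<^sub>R \<phi> t" for t
  have [measurable]: "\<psi> \<in> borel_measurable borel"
    unfolding \<psi>_def using \<phi> by (intro borel_measurable_continuous_on_indicator convex_on_continuous) auto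
  have \<psi>: "\<psi> t = \<phi> t" if "0 < t" for t using that by (simp add: \<psi>_def)
  have meas: "?\<nu> \<in> reg_measure \<rightarrow>\<^sub>M ?S"
    using measurable_gauss_map regular_boundaryD(4)
    by (intro measurable_restrict_space2) (auto cong: measurable_cong_sets[OF sets_reg_measure])
  have "orlicz_surface_area \<phi> K =
      (LINT u|surface_area_measure K. \<phi> (support_fun (cball 0 1) u / support_fun K u) * support_fun K u)"
    by (simp add: orlicz_surface_area_def orlicz_mixed_volume_def)
  also have "\<dots> = (LINT u|surface_area_measure K. \<psi> (1 / support_fun K u) * support_fun K u)"
    unfolding surface_area_measure_eq_distr
    by (intro Bochner_Integration.integral_cong refl)
       (auto simp: space_restrict_space support_fun_unit_ball support_fun_pos \<psi>)
  also have "\<dots> = (LINT x|reg_measure. \<psi> (1 / support_fun K (?\<nu> x)) * support_fun K (?\<nu> x))"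
    unfolding surface_area_measure_eq_distr
    by (rule integral_distr[OF meas]) (intro measurable_restrict_space1, measurable)
  also have "\<dots> = (LINT x|reg_measure. (x \<bullet> ?\<nu> x) *\<^sub>R \<psi> (1 / (x \<bullet> ?\<nu> x)))"
    by (intro Bochner_Integration.integral_cong refl)
       (auto simp: support_fun_normal[OF gauss_map_normal] regular_boundaryD)
  also have "\<dots> = (LINT x|density reg_measure (\<lambda>x. ennreal (x \<bullet> ?\<nu> x)). \<psi> (1 / (x \<bullet> ?\<nu> x)))"
    using regular_boundaryD(5) inr
    by (intro integral_density[symmetric]) (auto intro!: AE_I2 elim: order_trans[OF less_imp_le])
  also have "\<dots> = (LINT x|density cone_measure (\<lambda>_. ennreal \<kappa>). \<psi> (1 / (x \<bullet> ?\<nu> x)))"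
    by (simp only: cone_volume_formula)
  also have "\<dots> = (LINT x|cone_measure. \<kappa> *\<^sub>R \<psi> (1 / (x \<bullet> ?\<nu> x)))"
  proof (rule integral_density)
    show "(\<lambda>x. \<psi> (1 / (x \<bullet> ?\<nu> x))) \<in> borel_measurable cone_measure"
    proof -
      have [measurable]: "(\<lambda>x. x \<bullet> ?\<nu> x) \<in> borel_measurable cone_measure"
        using measurable_gauss_inner
        by (simp cong: measurable_cong_sets[OF sets_reg_measure refl] measurable_cong_sets[OF sets_cone_measure refl])
      show ?thesis by measurable
    qed
  qed (use \<kappa>_pos in auto)
  also have "\<dots> = \<kappa> * (LINT x|cone_measure. \<psi> (1 / (x \<bullet> ?\<nu> x)))" by simp
  also have "(LINT x|cone_measure. \<psi> (1 / (x \<bullet> ?\<nu> x))) = (LINT x|restrict_space lborel regular_part. \<psi> (grad_norm x))"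
    unfolding cone_measure_def grad_norm_def
  proof (rule integral_distr[OF measurable_radial_regular])
    have [measurable]: "(\<lambda>x. x \<bullet> ?\<nu> x) \<in> borel_measurable (restrict_space borel (regular_boundary K))"
      using measurable_gauss_inner by (simp cong: measurable_cong_sets[OF sets_reg_measure refl])
    show "(\<lambda>x. \<psi> (1 / (x \<bullet> ?\<nu> x))) \<in> borel_measurable (restrict_space borel (regular_boundary K))" by measurable
  qed
  also have "\<dots> = (LINT x|restrict_space lborel regular_part. \<phi> (grad_norm x))"
    using grad_norm_bounds(3) by (intro Bochner_Integration.integral_cong refl) (auto simp: space_restrict_space \<psi> regular_part_def)
  finally show ?thesis .
qed

end

section \<open>The Brunn-Minkowski inequality\<close>

definition msum :: "'a::plus set \<Rightarrow> 'a set \<Rightarrow> 'a set" where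
  "msum A B = {x + y | x y. x \<in> A \<and> y \<in> B}"

lemma msum_commute: "msum A B = msum B (A :: 'a::ab_semigroup_add set)"
proof -
  have "msum A B \<subseteq> msum B A" for A B :: "'a set"
  proof
    fix z assume "z \<in> msum A B"
    then obtain x y where "z = x + y" "x \<in> A" "y \<in> B" by (auto simp: msum_def)
    then show "z \<in> msum B A" by (auto simp: msum_def add.commute[of x])
  qed
  then show ?thesis by blast
qed

lemma msum_mono: "A \<subseteq> A' \<Longrightarrow> B \<subseteq> B' \<Longrightarrow> msum A B \<subseteq> msum A' B'"
  unfolding msum_def by blast

lemma open_msum: "open (B :: 'a::real_normed_vector set) \<Longrightarrow> open (msum A B)"
proof -
  assume "open B"
  moreover have "msum A B = (\<Union>x\<in>A. (+) x ` B)" by (auto simp: msum_def)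
  ultimately show ?thesis by (auto intro: open_translation)
qed

lemma bounded_msum: "bounded A \<Longrightarrow> bounded B \<Longrightarrow> bounded (msum A (B :: 'a::real_normed_vector set))"
  using bounded_plus[of A B] unfolding msum_def by (auto intro: bounded_subset)

section \<open>Brunn-Minkowski for two boxes\<close>

text \<open>After division by the product of the sums this is the inequality of arithmetic and
  geometric means for the fractions \<open>x i / (x i + y i)\<close> and
  \<open>y i / (x i + y i)\<close>, whose arithmetic means add up to 1.\<close>

lemma root_add_prod_le:
  fixes x y :: "'i \<Rightarrow> real"
  assumes I: "finite I" "I \<noteq> {}" and pos: "\<And>i. i \<in> I \<Longrightarrow> 0 < x i" "\<And>i. i \<in> I \<Longrightarrow> 0 < y i"
  shows "(root (card I) (\<Prod>i\<in>I. x i) + root (card I) (\<Prod>i\<in>I. y i)) ^ card I \<le> (\<Prod>i\<in>I. x i + y i)"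
proof -
  let ?n = "card I"
  have n: "0 < ?n" using I by (simp add: card_gt_0_iff)
  have amgm: "root ?n (\<Prod>i\<in>I. z i) \<le> (\<Sum>i\<in>I. z i / ?n)" if "\<And>i. i \<in> I \<Longrightarrow> 0 < z i" for z :: "'i \<Rightarrow> real"
    using arith_geom_mean[OF I, of z] that n prod_pos[of I z]
    by (simp add: root_powr_inverse less_imp_le)
  let ?s = "\<lambda>i. x i + y i"
  have s: "0 < ?s i" if "i \<in> I" for i using pos that by (simp add: add_pos_pos)
  have S: "0 < (\<Prod>i\<in>I. ?s i)" using s by (rule prod_pos)
  have "root ?n (\<Prod>i\<in>I. x i / ?s i) + root ?n (\<Prod>i\<in>I. y i / ?s i) \<le>
      (\<Sum>i\<in>I. x i / ?s i / ?n) + (\<Sum>i\<in>I. y i / ?s i / ?n)"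
    using pos s by (intro add_mono amgm) auto
  also have "\<dots> = (\<Sum>i\<in>I. 1 / ?n)"
    unfolding sum.distrib[symmetric]
  proof (rule sum.cong)
    fix i assume "i \<in> I"
    then show "x i / ?s i / ?n + y i / ?s i / ?n = 1 / ?n"
      using s[of i] by (simp add: add_divide_distrib[symmetric])
  qed simp
  also have "\<dots> = 1" using n by simp
  finally have "(root ?n (\<Prod>i\<in>I. x i) + root ?n (\<Prod>i\<in>I. y i)) / root ?n (\<Prod>i\<in>I. ?s i) \<le> 1"
    using n by (simp add: prod_dividef real_root_divide add_divide_distrib)
  then have "root ?n (\<Prod>i\<in>I. x i) + root ?n (\<Prod>i\<in>I. y i) \<le> root ?n (\<Prod>i\<in>I. ?s i)"
    using S n by (simp add: divide_le_eq_1)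
  then have "(root ?n (\<Prod>i\<in>I. x i) + root ?n (\<Prod>i\<in>I. y i)) ^ ?n \<le> root ?n (\<Prod>i\<in>I. ?s i) ^ ?n"
    using n pos by (intro power_mono add_nonneg_nonneg real_root_ge_zero prod_nonneg) (auto simp: less_imp_le)
  then show ?thesis using S n by simp
qed

lemma measure_box_nonempty:
  fixes a b :: "'a::euclidean_space"
  assumes "box a b \<noteq> {}"
  shows "measure lebesgue (box a b) = (\<Prod>i\<in>Basis. (b - a) \<bullet> i)"
proof -
  have "\<And>i. i \<in> Basis \<Longrightarrow> a \<bullet> i \<le> b \<bullet> i" using assms by (auto simp: box_ne_empty less_imp_le)
  then show ?thesis by simp
qed

lemma brunn_minkowski_box:
  fixes a b c d :: "'a::euclidean_space"
  assumes ne: "box a b \<noteq> {}" "box c d \<noteq> {}"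
  shows "(root DIM('a) (measure lebesgue (box a b)) + root DIM('a) (measure lebesgue (box c d))) ^ DIM('a)
    \<le> measure lebesgue (msum (box a b) (box c d))"
proof -
  have ab: "a \<bullet> i < b \<bullet> i" "c \<bullet> i < d \<bullet> i" if "i \<in> Basis" for i using ne that by (auto simp: box_ne_empty)
  have ne2: "box (a + c) (b + d) \<noteq> {}"
    using ab by (auto simp: box_ne_empty inner_add_left add_strict_mono)
  have sub: "box (a + c) (b + d) \<subseteq> msum (box a b) (box c d)"
  proof
    fix z assume z: "z \<in> box (a + c) (b + d)"
    \<comment> \<open>The proportion in which \<open>z\<close> divides the side of the large box;
      both summands are placed in the same proportion in their own boxes.\<close>
    define t where "t i = ((z - (a + c)) \<bullet> i) / ((b + d - (a + c)) \<bullet> i)" for i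
    have den: "0 < (b + d - (a + c)) \<bullet> i" if "i \<in> Basis" for i
      using ab[OF that] by (simp add: inner_diff_left inner_add_left)
    have t: "0 < t i" "t i < 1" if "i \<in> Basis" for i
      using z den[OF that] that by (auto simp: t_def mem_box inner_diff_left inner_add_left)
    define x where "x = (\<Sum>i\<in>Basis. (a \<bullet> i + t i * ((b - a) \<bullet> i)) *\<^sub>R i)"
    have xi: "x \<bullet> i = a \<bullet> i + t i * ((b - a) \<bullet> i)" if "i \<in> Basis" for i
      using that by (simp add: x_def)
    have conv: "u < u + s * (v - u)" "u + s * (v - u) < v" if "u < v" "0 < s" "s < 1" for u v s :: real
    proof -
      show "u < u + s * (v - u)" using that by simp
      have "s * (v - u) < 1 * (v - u)" using that by (intro mult_strict_right_mono) auto
      then show "u + s * (v - u) < v" by (simp add: algebra_simps)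
    qed
    have "x \<in> box a b" using xi t ab conv by (auto simp: mem_box inner_diff_left)
    moreover have "(z - x) \<bullet> i = c \<bullet> i + t i * ((d - c) \<bullet> i)" if "i \<in> Basis" for i
    proof -
      have "t i * ((b + d - (a + c)) \<bullet> i) = (z - (a + c)) \<bullet> i" using den[OF that] by (simp add: t_def)
      then show ?thesis using xi[OF that] by (simp add: inner_diff_left inner_add_left algebra_simps)
    qed
    then have "z - x \<in> box c d" using t ab conv by (auto simp: mem_box inner_diff_left)
    moreover have "z = x + (z - x)" by simp
    ultimately show "z \<in> msum (box a b) (box c d)" unfolding msum_def by blast
  qed
  have "(root DIM('a) (measure lebesgue (box a b)) + root DIM('a) (measure lebesgue (box c d))) ^ DIM('a) \<le>
     (\<Prod>i\<in>Basis. (b - a) \<bullet> i + (d - c) \<bullet> i)"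
    unfolding measure_box_nonempty[OF ne(1)] measure_box_nonempty[OF ne(2)]
    using ab by (intro root_add_prod_le) (auto simp: inner_diff_left)
  also have "\<dots> = measure lebesgue (box (a + c) (b + d))"
    unfolding measure_box_nonempty[OF ne2] by (intro prod.cong) (auto simp: inner_diff_left inner_add_left)
  also have "\<dots> \<le> measure lebesgue (msum (box a b) (box c d))"
    by (intro measure_mono_fmeasurable sub lmeasurable_open bounded_msum open_msum) auto
  finally show ?thesis .
qed

section \<open>Finite families of disjoint boxes\<close>

text \<open>The boxes are open, so that sums of their unions are open, and a cut along a hyperplane
  loses only a null set. They are nonempty, so that the number of boxes serves as induction
  measure.\<close>

definition box_family :: "'a::euclidean_space set set \<Rightarrow> bool" where
  "box_family \<A> \<longleftrightarrow> finite \<A> \<and> disjoint \<A> \<and> (\<forall>Q\<in>\<A>. Q \<noteq> {} \<and> (\<exists>a b. Q = box a b))"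

lemma box_familyE:
  assumes "box_family \<A>" "Q \<in> \<A>"
  obtains a b where "Q = box a b" "box a b \<noteq> {}"
  using assms unfolding box_family_def by blast

lemma box_familyD:
  assumes "box_family \<A>"
  shows "finite \<A>" "disjoint \<A>" "open (\<Union>\<A>)" "bounded (\<Union>\<A>)" "\<Union>\<A> \<in> lmeasurable"
proof -
  show f: "finite \<A>" "disjoint \<A>" using assms by (simp_all add: box_family_def)
  show o: "open (\<Union>\<A>)" using assms by (intro open_Union ballI) (metis box_familyE open_box)
  show b: "bounded (\<Union>\<A>)" using assms f by (intro bounded_Union ballI) (metis box_familyE bounded_box)+
  show "\<Union>\<A> \<in> lmeasurable" using b o by (rule lmeasurable_open)
qed

lemma measure_box_family_Int:
  assumes \<A>: "box_family \<A>" and T: "T \<in> sets lebesgue"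
  shows "measure lebesgue (\<Union>\<A> \<inter> T) = (\<Sum>Q\<in>\<A>. measure lebesgue (Q \<inter> T))"
proof -
  have "measure lebesgue (\<Union>((\<lambda>Q. Q \<inter> T) ` \<A>)) = (\<Sum>Q\<in>\<A>. measure lebesgue (Q \<inter> T))"
  proof (rule measure_UNION')
    show "Q \<inter> T \<in> lmeasurable" if Q: "Q \<in> \<A>" for Q
    proof -
      obtain a b where "Q = box a b" using box_familyE[OF \<A> Q] by metis
      then show ?thesis using fmeasurable_Int_fmeasurable[OF lmeasurable_box T] by simp
    qed
    show "pairwise (\<lambda>X Y. disjnt (X \<inter> T) (Y \<inter> T)) \<A>"
      using box_familyD(2)[OF \<A>] by (auto simp: pairwise_def disjnt_def)
  qed (rule box_familyD(1)[OF \<A>])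
  moreover have "\<Union>((\<lambda>Q. Q \<inter> T) ` \<A>) = \<Union>\<A> \<inter> T" by blast
  ultimately show ?thesis by (simp only:)
qed

text \<open>\<open>T\<close> stands for an open coordinate half-space. Boxes that miss
  \<open>T\<close> are dropped, so the number of boxes decreases as soon as there is one.\<close>

lemma box_family_cut:
  assumes \<A>: "box_family \<A>" and T: "\<And>a b. \<exists>a' b'. box a b \<inter> T = box a' b'"
  obtains \<B> where "box_family \<B>" "\<Union>\<B> = \<Union>\<A> \<inter> T" "card \<B> \<le> card \<A>"
    "\<And>Q. Q \<in> \<A> \<Longrightarrow> Q \<inter> T = {} \<Longrightarrow> card \<B> < card \<A>"
proof
  let ?B = "(\<lambda>Q. Q \<inter> T) ` {Q \<in> \<A>. Q \<inter> T \<noteq> {}}"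
  have fin: "finite \<A>" using \<A> by (simp add: box_family_def)
  show "box_family ?B"
    unfolding box_family_def
  proof (intro conjI ballI)
    show "finite ?B" using fin by simp
    have "disjoint \<A>" using \<A> by (simp add: box_family_def)
    then show "disjoint ?B" unfolding pairwise_def disjnt_def by blast
    fix X assume "X \<in> ?B"
    then obtain Q where Q: "Q \<in> \<A>" "X = Q \<inter> T" "Q \<inter> T \<noteq> {}" by blast
    obtain a b where "Q = box a b" using box_familyE[OF \<A> Q(1)] by metis
    then show "\<exists>a b. X = box a b" using T[of a b] Q(2) by simp
    show "X \<noteq> {}" using Q by simp
  qed
  show "\<Union>?B = \<Union>\<A> \<inter> T" by auto
  have "card ?B \<le> card {Q \<in> \<A>. Q \<inter> T \<noteq> {}}" using fin by (intro card_image_le) auto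
  also have "\<dots> \<le> card \<A>" using fin by (intro card_mono) auto
  finally show "card ?B \<le> card \<A>" .
  fix Q assume Q: "Q \<in> \<A>" "Q \<inter> T = {}"
  have "card ?B \<le> card {Q \<in> \<A>. Q \<inter> T \<noteq> {}}" using fin by (intro card_image_le) auto
  also have "\<dots> < card \<A>" using fin Q by (intro psubset_card_mono) auto
  finally show "card ?B < card \<A>" .
qed

lemma box_Int_below:
  fixes a b :: "'a::euclidean_space"
  assumes "i \<in> Basis"
  shows "box a b \<inter> {x. x \<bullet> i < t} = box a (b + (min (b \<bullet> i) t - b \<bullet> i) *\<^sub>R i)"
  using assms by (auto simp: mem_box inner_add_left inner_Basis split: if_splits)

lemma box_Int_above:
  fixes a b :: "'a::euclidean_space"
  assumes "i \<in> Basis"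
  shows "box a b \<inter> {x. t < x \<bullet> i} = box (a + (max (a \<bullet> i) t - a \<bullet> i) *\<^sub>R i) b"
  using assms by (auto simp: mem_box inner_add_left inner_Basis split: if_splits)

text \<open>The explicit formula makes visible that the volume below a moving hyperplane is
  continuous in \<open>t\<close>, as \<open>box_family_bisect\<close> requires.\<close>

lemma measure_box_below:
  fixes a b :: "'a::euclidean_space"
  assumes i: "i \<in> Basis" and ne: "box a b \<noteq> {}"
  shows "measure lebesgue (box a b \<inter> {x. x \<bullet> i < t}) =
    max 0 (min (b \<bullet> i) t - a \<bullet> i) * (\<Prod>k\<in>Basis - {i}. b \<bullet> k - a \<bullet> k)"
proof -
  define b' where "b' = b + (min (b \<bullet> i) t - b \<bullet> i) *\<^sub>R i"
  have b': "b' \<bullet> k = (if k = i then min (b \<bullet> i) t else b \<bullet> k)" if "k \<in> Basis" for k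
    using that i by (auto simp: b'_def inner_add_left inner_Basis)
  have ab: "\<And>k. k \<in> Basis \<Longrightarrow> a \<bullet> k < b \<bullet> k" using ne by (simp add: box_ne_empty)
  have "measure lebesgue (box a b') = max 0 (min (b \<bullet> i) t - a \<bullet> i) * (\<Prod>k\<in>Basis - {i}. b \<bullet> k - a \<bullet> k)"
  proof (cases "a \<bullet> i \<le> min (b \<bullet> i) t")
    case True
    have "\<And>k. k \<in> Basis \<Longrightarrow> a \<bullet> k \<le> b' \<bullet> k" using True ab b' by (auto simp: less_imp_le)
    then have "measure lebesgue (box a b') = (\<Prod>k\<in>Basis. (b' - a) \<bullet> k)" by simp
    also have "\<dots> = ((b' - a) \<bullet> i) * (\<Prod>k\<in>Basis - {i}. (b' - a) \<bullet> k)"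
      using i by (intro prod.remove) auto
    also have "(\<Prod>k\<in>Basis - {i}. (b' - a) \<bullet> k) = (\<Prod>k\<in>Basis - {i}. b \<bullet> k - a \<bullet> k)"
      by (intro prod.cong) (auto simp: b' inner_diff_left)
    also have "(b' - a) \<bullet> i = max 0 (min (b \<bullet> i) t - a \<bullet> i)" using i True by (simp add: b' inner_diff_left)
    finally show ?thesis .
  next
    case False
    moreover have "b' \<bullet> i = min (b \<bullet> i) t" using i b' by simp
    ultimately have "b' \<bullet> i \<le> a \<bullet> i" by linarith
    then have "box a b' = {}" using i by (auto simp: box_eq_empty)
    moreover have "max 0 (min (b \<bullet> i) t - a \<bullet> i) = 0" using False by linarith
    ultimately show ?thesis by simp
  qed
  then show ?thesis by (simp only: box_Int_below[OF i] b'_def)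
qed

lemma half_measures:
  fixes A :: "'a::euclidean_space set"
  assumes i: "i \<in> Basis" and A: "A \<in> lmeasurable"
  shows "measure lebesgue A = measure lebesgue (A \<inter> {x. x \<bullet> i < t}) + measure lebesgue (A \<inter> {x. t < x \<bullet> i})"
proof -
  have m: "{x. x \<bullet> i < t} \<in> sets lebesgue" "{x. t < x \<bullet> i} \<in> sets lebesgue"
    by (auto intro!: sets_completionI_sets)
  have "measure lebesgue A = measure lebesgue (A \<inter> {x. x \<bullet> i < t} \<union> A \<inter> {x. t < x \<bullet> i})"
  proof (rule measure_negligible_symdiff[symmetric])
    have "negligible {x. x \<bullet> i = t}" using i by (rule negligible_standard_hyperplane)
    then show "negligible (sym_diff A (A \<inter> {x. x \<bullet> i < t} \<union> A \<inter> {x. t < x \<bullet> i}))"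
      by (rule negligible_subset) auto
  qed (rule A)
  also have "\<dots> = measure lebesgue (A \<inter> {x. x \<bullet> i < t}) + measure lebesgue (A \<inter> {x. t < x \<bullet> i})"
  proof -
    have "A \<inter> {x. t < x \<bullet> i} - A \<inter> {x. x \<bullet> i < t} = A \<inter> {x. t < x \<bullet> i}" by auto
    then show ?thesis
      using measure_Un2[OF fmeasurable_Int_fmeasurable[OF A m(1)] fmeasurable_Int_fmeasurable[OF A m(2)]]
      by (simp only:)
  qed
  finally show ?thesis .
qed

text \<open>The intermediate value theorem: the volume below height \<open>t\<close> grows
  continuously from 0 to the full volume.\<close>

lemma box_family_bisect:
  assumes \<B>: "box_family \<B>" and i: "i \<in> Basis" and \<theta>: "0 < \<theta>" "\<theta> < 1"
  obtains t where "measure lebesgue (\<Union>\<B> \<inter> {x. x \<bullet> i < t}) = \<theta> * measure lebesgue (\<Union>\<B>)"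
proof -
  define F where "F t = measure lebesgue (\<Union>\<B> \<inter> {x. x \<bullet> i < t})" for t
  obtain M where M: "\<And>x. x \<in> \<Union>\<B> \<Longrightarrow> norm x \<le> M" using box_familyD(4)[OF \<B>] by (auto simp: bounded_iff)
  have xi: "\<bar>x \<bullet> i\<bar> \<le> max M 0" if "x \<in> \<Union>\<B>" for x
    using Basis_le_norm[OF i, of x] M[OF that] by linarith
  have lo: "F (- max M 0 - 1) = 0"
  proof -
    have "\<Union>\<B> \<inter> {x. x \<bullet> i < - max M 0 - 1} = {}"
      using xi by (force simp: abs_le_iff)
    then show ?thesis unfolding F_def by (simp only: measure_empty)
  qed
  have hi: "F (max M 0 + 1) = measure lebesgue (\<Union>\<B>)"
  proof -
    have "\<Union>\<B> \<inter> {x. x \<bullet> i < max M 0 + 1} = \<Union>\<B>"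
      using xi by (force simp: abs_le_iff)
    then show ?thesis unfolding F_def by (simp only:)
  qed
  have Feq: "F t = (\<Sum>Q\<in>\<B>. measure lebesgue (Q \<inter> {x. x \<bullet> i < t}))" for t
    unfolding F_def by (rule measure_box_family_Int[OF \<B>]) (auto intro!: sets_completionI_sets)
  have "continuous_on UNIV F"
    unfolding Feq[abs_def]
  proof (intro continuous_on_sum)
    fix Q assume "Q \<in> \<B>"
    then obtain a b where Q: "Q = box a b" "box a b \<noteq> {}" using \<B> by (metis box_familyE)
    show "continuous_on UNIV (\<lambda>t. measure lebesgue (Q \<inter> {x. x \<bullet> i < t}))"
      unfolding Q(1) measure_box_below[OF i Q(2)] by (intro continuous_intros)
  qed
  then have "continuous_on {- max M 0 - 1..max M 0 + 1} F" by (rule continuous_on_subset) simp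
  moreover have "0 \<le> \<theta> * measure lebesgue (\<Union>\<B>)" "\<theta> * measure lebesgue (\<Union>\<B>) \<le> measure lebesgue (\<Union>\<B>)"
    using \<theta> mult_right_mono[of \<theta> 1 "measure lebesgue (\<Union>\<B>)"] by auto
  ultimately obtain t where "F t = \<theta> * measure lebesgue (\<Union>\<B>)"
    using IVT'[of F "- max M 0 - 1" "\<theta> * measure lebesgue (\<Union>\<B>)" "max M 0 + 1"] lo hi by auto
  then show thesis using that by (simp add: F_def)
qed

lemma measure_open_pos:
  fixes S :: "'a::euclidean_space set"
  assumes "open S" "bounded S" "S \<noteq> {}"
  shows "0 < measure lebesgue S"
proof -
  have "measure lebesgue S \<noteq> 0"
    using open_not_negligible[OF assms(1,3)] lmeasurable_open[OF assms(2,1)] negligible_iff_measure by blast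
  then show ?thesis using measure_nonneg[of lebesgue S] by linarith
qed

lemma measure_box_family_pos:
  assumes "box_family \<A>" "\<Union>\<A> \<noteq> {}"
  shows "0 < measure lebesgue (\<Union>\<A>)"
  using box_familyD[OF assms(1)] assms(2) by (intro measure_open_pos)

text \<open>Induction on the number of boxes (Hadwiger and Ohmann): cut one family between two of its boxes
  and the other one by a parallel hyperplane in the same volume ratio.\<close>

lemma brunn_minkowski_box_family:
  fixes \<A> \<B> :: "'a::euclidean_space set set"
  assumes "box_family \<A>" "box_family \<B>" "\<Union>\<A> \<noteq> {}" "\<Union>\<B> \<noteq> {}"
  shows "(root DIM('a) (measure lebesgue (\<Union>\<A>)) + root DIM('a) (measure lebesgue (\<Union>\<B>))) ^ DIM('a)
    \<le> measure lebesgue (msum (\<Union>\<A>) (\<Union>\<B>))"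
  using assms
proof (induction "card \<A> + card \<B>" arbitrary: \<A> \<B> rule: less_induct)
  case less
  let ?r = "root DIM('a)" and ?m = "measure lebesgue :: 'a set \<Rightarrow> real"
  \<comment> \<open>Stated for arbitrary families, because it is applied a second time with the two
    families exchanged.\<close>
  have step: "(?r (?m (\<Union>\<A>)) + ?r (?m (\<Union>\<B>))) ^ DIM('a) \<le> ?m (msum (\<Union>\<A>) (\<Union>\<B>))"
    if \<A>: "box_family \<A>" and \<B>: "box_family \<B>" and neA: "\<Union>\<A> \<noteq> {}" and neB: "\<Union>\<B> \<noteq> {}"
      and two: "2 \<le> card \<A>"
      and IH: "\<And>\<A>' \<B>'. card \<A>' + card \<B>' < card \<A> + card \<B> \<Longrightarrow> box_family \<A>' \<Longrightarrow> box_family \<B>' \<Longrightarrow>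
        \<Union>\<A>' \<noteq> {} \<Longrightarrow> \<Union>\<B>' \<noteq> {} \<Longrightarrow>
        (?r (?m (\<Union>\<A>')) + ?r (?m (\<Union>\<B>'))) ^ DIM('a) \<le> ?m (msum (\<Union>\<A>') (\<Union>\<B>'))" for \<A> \<B>
  proof -
    obtain Q1 Q2 where Q: "Q1 \<in> \<A>" "Q2 \<in> \<A>" "Q1 \<noteq> Q2"
      using two box_familyD(1)[OF \<A>] by (metis card_le_Suc0_iff_eq not_less_eq_eq numeral_2_eq_2)
    obtain a b c d where ab: "Q1 = box a b" "Q2 = box c d" "box a b \<noteq> {}" "box c d \<noteq> {}"
      using box_familyE[OF \<A> Q(1)] box_familyE[OF \<A> Q(2)] by metis
    have "box a b \<inter> box c d = {}"
      using box_familyD(2)[OF \<A>] Q unfolding ab pairwise_def disjnt_def by blast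
    then obtain i where i: "i \<in> Basis" and sep: "b \<bullet> i \<le> c \<bullet> i \<or> d \<bullet> i \<le> a \<bullet> i"
      using ab(3,4) by (auto simp: disjoint_interval box_ne_empty)
    \<comment> \<open>A hyperplane between two disjoint boxes: each open side misses one of them, so
      both halves have fewer boxes than the family.\<close>
    obtain s where s: "(\<exists>Q\<in>\<A>. Q \<inter> {x. s < x \<bullet> i} = {}) \<and> (\<exists>Q\<in>\<A>. Q \<inter> {x. x \<bullet> i < s} = {})"
    proof -
      from sep show thesis
      proof
        assume "b \<bullet> i \<le> c \<bullet> i"
        then have "Q1 \<inter> {x. b \<bullet> i < x \<bullet> i} = {}" "Q2 \<inter> {x. x \<bullet> i < b \<bullet> i} = {}"
          using i by (force simp: ab mem_box)+
        then show thesis using Q that by blast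
      next
        assume "d \<bullet> i \<le> a \<bullet> i"
        then have "Q2 \<inter> {x. d \<bullet> i < x \<bullet> i} = {}" "Q1 \<inter> {x. x \<bullet> i < d \<bullet> i} = {}"
          using i by (force simp: ab mem_box)+
        then show thesis using Q that by blast
      qed
    qed
    have below: "\<exists>a' b'. box a b \<inter> {x. x \<bullet> i < t} = box a' b'" and above: "\<exists>a' b'. box a b \<inter> {x. t < x \<bullet> i} = box a' b'" for a b t
      using box_Int_below[OF i] box_Int_above[OF i] by blast+
    obtain \<A>1 where A1: "box_family \<A>1" "\<Union>\<A>1 = \<Union>\<A> \<inter> {x. x \<bullet> i < s}" "card \<A>1 < card \<A>"
      using box_family_cut[OF \<A> below[of _ _ s]] s by metis
    obtain \<A>2 where A2: "box_family \<A>2" "\<Union>\<A>2 = \<Union>\<A> \<inter> {x. s < x \<bullet> i}" "card \<A>2 < card \<A>"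
      using box_family_cut[OF \<A> above[of _ _ s]] s by metis
    have ne1: "\<Union>\<A>1 \<noteq> {}"
    proof -
      obtain Q where Q: "Q \<in> \<A>" "Q \<inter> {x. s < x \<bullet> i} = {}" using s by blast
      have Qo: "open Q" "Q \<noteq> {}" using box_familyE[OF \<A> Q(1)] by (metis open_box)+
      have "\<not> Q \<subseteq> {x. x \<bullet> i = s}"
        using open_not_negligible[OF Qo] negligible_standard_hyperplane[OF i, of s] negligible_subset by blast
      then obtain x where "x \<in> Q" "x \<bullet> i \<noteq> s" by blast
      then have "x \<bullet> i < s" using Q by force
      then show ?thesis using \<open>x \<in> Q\<close> Q A1(2) by blast
    qed
    have ne2: "\<Union>\<A>2 \<noteq> {}"
    proof -
      obtain Q where Q: "Q \<in> \<A>" "Q \<inter> {x. x \<bullet> i < s} = {}" using s by blast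
      have Qo: "open Q" "Q \<noteq> {}" using box_familyE[OF \<A> Q(1)] by (metis open_box)+
      have "\<not> Q \<subseteq> {x. x \<bullet> i = s}"
        using open_not_negligible[OF Qo] negligible_standard_hyperplane[OF i, of s] negligible_subset by blast
      then obtain x where "x \<in> Q" "x \<bullet> i \<noteq> s" by blast
      then have "s < x \<bullet> i" using Q by force
      then show ?thesis using \<open>x \<in> Q\<close> Q A2(2) by blast
    qed
    have mA: "?m (\<Union>\<A>) = ?m (\<Union>\<A>1) + ?m (\<Union>\<A>2)"
      unfolding A1(2) A2(2) by (rule half_measures[OF i box_familyD(5)[OF \<A>]])
    have p1: "0 < ?m (\<Union>\<A>1)" and p2: "0 < ?m (\<Union>\<A>2)"
      using measure_box_family_pos A1 A2 ne1 ne2 by blast+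
    have pB: "0 < ?m (\<Union>\<B>)" using measure_box_family_pos \<B> neB by blast
    define \<theta> where "\<theta> = ?m (\<Union>\<A>1) / ?m (\<Union>\<A>)"
    have \<theta>: "0 < \<theta>" "\<theta> < 1" using mA p1 p2 by (auto simp: \<theta>_def)
    have mA1: "?m (\<Union>\<A>1) = \<theta> * ?m (\<Union>\<A>)" and mA2: "?m (\<Union>\<A>2) = (1 - \<theta>) * ?m (\<Union>\<A>)"
      using mA p1 p2 by (auto simp: \<theta>_def field_simps)
    obtain t where t: "?m (\<Union>\<B> \<inter> {x. x \<bullet> i < t}) = \<theta> * ?m (\<Union>\<B>)"
      using box_family_bisect[OF \<B> i \<theta>] .
    obtain \<B>1 where B1: "box_family \<B>1" "\<Union>\<B>1 = \<Union>\<B> \<inter> {x. x \<bullet> i < t}" "card \<B>1 \<le> card \<B>"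
      using box_family_cut[OF \<B> below[of _ _ t]] by metis
    obtain \<B>2 where B2: "box_family \<B>2" "\<Union>\<B>2 = \<Union>\<B> \<inter> {x. t < x \<bullet> i}" "card \<B>2 \<le> card \<B>"
      using box_family_cut[OF \<B> above[of _ _ t]] by metis
    have mB1: "?m (\<Union>\<B>1) = \<theta> * ?m (\<Union>\<B>)" using t B1 by simp
    have "?m (\<Union>\<B>) = ?m (\<Union>\<B>1) + ?m (\<Union>\<B>2)"
      unfolding B1(2) B2(2) by (rule half_measures[OF i box_familyD(5)[OF \<B>]])
    then have mB2: "?m (\<Union>\<B>2) = (1 - \<theta>) * ?m (\<Union>\<B>)" using mB1 by (simp add: algebra_simps)
    have neB1: "\<Union>\<B>1 \<noteq> {}"
    proof
      assume "\<Union>\<B>1 = {}"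
      then have "?m (\<Union>\<B>1) = 0" by (simp only: measure_empty)
      then show False using mB1 \<theta> pB by simp
    qed
    have neB2: "\<Union>\<B>2 \<noteq> {}"
    proof
      assume "\<Union>\<B>2 = {}"
      then have "?m (\<Union>\<B>2) = 0" by (simp only: measure_empty)
      then show False using mB2 \<theta> pB by simp
    qed
    \<comment> \<open>On each side of the cuts both families have the same share of their volume, so
      by homogeneity the bounds for the two sides add up exactly to the bound for the whole.\<close>
    have scale: "(?r (x * p) + ?r (x * q)) ^ DIM('a) = x * (?r p + ?r q) ^ DIM('a)" if "0 < x" for x p q :: real
    proof -
      have "?r (x * p) + ?r (x * q) = ?r x * (?r p + ?r q)" by (simp add: real_root_mult algebra_simps)
      then show ?thesis using that by (simp add: power_mult_distrib)
    qed
    have op: "msum (\<Union>\<A>') (\<Union>\<B>') \<in> lmeasurable" if "box_family \<A>'" "box_family \<B>'" for \<A>' \<B>' :: "'a set set"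
      using box_familyD[OF that(1)] box_familyD[OF that(2)] by (intro lmeasurable_open bounded_msum open_msum)
    \<comment> \<open>The two sums lie on opposite sides of the hyperplane at height
      \<open>s + t\<close>, so their volumes add.\<close>
    have dj: "msum (\<Union>\<A>1) (\<Union>\<B>1) \<inter> msum (\<Union>\<A>2) (\<Union>\<B>2) = {}"
    proof -
      have "z \<bullet> i < s + t" if "z \<in> msum (\<Union>\<A>1) (\<Union>\<B>1)" for z
        using that unfolding msum_def A1(2) B1(2) by (auto simp: inner_add_left)
      moreover have "s + t < z \<bullet> i" if "z \<in> msum (\<Union>\<A>2) (\<Union>\<B>2)" for z
        using that unfolding msum_def A2(2) B2(2) by (auto simp: inner_add_left)
      ultimately show ?thesis by fastforce
    qed
    have "(?r (?m (\<Union>\<A>)) + ?r (?m (\<Union>\<B>))) ^ DIM('a) =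
        \<theta> * (?r (?m (\<Union>\<A>)) + ?r (?m (\<Union>\<B>))) ^ DIM('a) + (1 - \<theta>) * (?r (?m (\<Union>\<A>)) + ?r (?m (\<Union>\<B>))) ^ DIM('a)"
      by (simp add: algebra_simps)
    also have "\<dots> = (?r (?m (\<Union>\<A>1)) + ?r (?m (\<Union>\<B>1))) ^ DIM('a) + (?r (?m (\<Union>\<A>2)) + ?r (?m (\<Union>\<B>2))) ^ DIM('a)"
      unfolding mA1 mA2 mB1 mB2 using \<theta> by (simp add: scale)
    also have "\<dots> \<le> ?m (msum (\<Union>\<A>1) (\<Union>\<B>1)) + ?m (msum (\<Union>\<A>2) (\<Union>\<B>2))"
      using A1 A2 B1 B2 ne1 ne2 neB1 neB2 by (intro add_mono IH) auto
    also have "\<dots> = ?m (msum (\<Union>\<A>1) (\<Union>\<B>1) \<union> msum (\<Union>\<A>2) (\<Union>\<B>2))"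
      using op[OF A1(1) B1(1)] op[OF A2(1) B2(1)] dj
      by (subst measure_Un2) (auto simp: Diff_triv Int_commute)
    also have "\<dots> \<le> ?m (msum (\<Union>\<A>) (\<Union>\<B>))"
    proof (rule measure_mono_fmeasurable)
      show "msum (\<Union>\<A>1) (\<Union>\<B>1) \<union> msum (\<Union>\<A>2) (\<Union>\<B>2) \<subseteq> msum (\<Union>\<A>) (\<Union>\<B>)"
        unfolding A1(2) A2(2) B1(2) B2(2) by (intro Un_least msum_mono) auto
      show "msum (\<Union>\<A>1) (\<Union>\<B>1) \<union> msum (\<Union>\<A>2) (\<Union>\<B>2) \<in> sets lebesgue"
        using op[OF A1(1) B1(1)] op[OF A2(1) B2(1)] by (intro sets.Un) (auto intro: fmeasurableD)
      show "msum (\<Union>\<A>) (\<Union>\<B>) \<in> lmeasurable" by (rule op[OF \<A> \<B>])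
    qed
    finally show ?thesis .
  qed
  have cA: "0 < card \<A>" and cB: "0 < card \<B>"
    using less.prems box_familyD(1) by (auto simp: card_gt_0_iff)
  consider "2 \<le> card \<A>" | "2 \<le> card \<B>" | "card \<A> = 1" "card \<B> = 1" using cA cB by linarith
  then show ?case
  proof cases
    case 1
    show ?thesis
    proof (rule step)
      fix \<A>' \<B>' :: "'a set set"
      assume "card \<A>' + card \<B>' < card \<A> + card \<B>" "box_family \<A>'" "box_family \<B>'" "\<Union>\<A>' \<noteq> {}" "\<Union>\<B>' \<noteq> {}"
      then show "(?r (?m (\<Union>\<A>')) + ?r (?m (\<Union>\<B>'))) ^ DIM('a) \<le> ?m (msum (\<Union>\<A>') (\<Union>\<B>'))"
        by (rule less.hyps)
    qed (use 1 less.prems in auto)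
  next
    case 2
    have "(?r (?m (\<Union>\<B>)) + ?r (?m (\<Union>\<A>))) ^ DIM('a) \<le> ?m (msum (\<Union>\<B>) (\<Union>\<A>))"
    proof (rule step)
      fix \<A>' \<B>' :: "'a set set"
      assume "card \<A>' + card \<B>' < card \<B> + card \<A>" "box_family \<A>'" "box_family \<B>'" "\<Union>\<A>' \<noteq> {}" "\<Union>\<B>' \<noteq> {}"
      then show "(?r (?m (\<Union>\<A>')) + ?r (?m (\<Union>\<B>'))) ^ DIM('a) \<le> ?m (msum (\<Union>\<A>') (\<Union>\<B>'))"
        by (intro less.hyps) (simp_all only: add.commute[of "card \<B>"] not_False_eq_True)
    qed (use 2 less.prems in auto)
    then show ?thesis by (simp only: msum_commute[of "\<Union>\<A>"] add.commute)
  next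
    case 3
    then obtain Q Q' where Q: "\<A> = {Q}" "\<B> = {Q'}" by (metis card_1_singletonE)
    obtain a b where ab: "Q = box a b" "box a b \<noteq> {}" using box_familyE[OF less.prems(1)] Q by blast
    obtain c d where cd: "Q' = box c d" "box c d \<noteq> {}" using box_familyE[OF less.prems(2)] Q by blast
    have "\<Union>\<A> = box a b" "\<Union>\<B> = box c d" using Q ab cd by simp_all
    then show ?thesis using brunn_minkowski_box[OF ab(2) cd(2)] by (simp only:)
  qed
qed

text \<open>An open set is a countable union of closed boxes with disjoint interiors. Finitely many
  of them have its volume up to \<open>e\<close>, and passing to interiors changes no
  volume.\<close>

lemma box_family_approx:
  fixes A :: "'a::euclidean_space set"
  assumes A: "open A" "bounded A" and e: "0 < e"
  obtains \<A> where "box_family \<A>" "\<Union>\<A> \<subseteq> A" "measure lebesgue A - e < measure lebesgue (\<Union>\<A>)"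
proof -
  obtain M where M: "0 < M" "\<And>x. x \<in> A \<Longrightarrow> norm x \<le> M" using A(2) by (auto simp: bounded_pos)
  define l :: 'a where "l = - (M *\<^sub>R One)" define h :: 'a where "h = M *\<^sub>R One"
  have sub: "A \<subseteq> cbox l h"
  proof
    fix x assume "x \<in> A"
    then have "\<bar>x \<bullet> k\<bar> \<le> M" if "k \<in> Basis" for k using M(2) Basis_le_norm[OF that, of x] by fastforce
    then show "x \<in> cbox l h" by (auto simp: l_def h_def mem_box abs_le_iff) (metis minus_le_iff)
  qed
  have ne: "box l h \<noteq> {}" using M by (auto simp: box_ne_empty l_def h_def)
  \<comment> \<open>With these neighbourhoods the covering lemma produces only boxes contained in
    \<open>A\<close>.\<close>
  have g: "gauge (\<lambda>x. if x \<in> A then A else UNIV)" using A by (auto simp: gauge_def)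
  obtain \<D> where D: "countable \<D>" "\<And>K. K \<in> \<D> \<Longrightarrow> interior K \<noteq> {} \<and> (\<exists>c d. K = cbox c d)"
    "pairwise (\<lambda>A B. interior A \<inter> interior B = {}) \<D>"
    "\<And>K. K \<in> \<D> \<Longrightarrow> \<exists>x\<in>A \<inter> K. K \<subseteq> (if x \<in> A then A else UNIV)" "A \<subseteq> \<Union>\<D>"
    using covering_lemma[OF sub ne g] by metis
  have DA: "K \<subseteq> A" if "K \<in> \<D>" for K using D(4)[OF that] by auto
  have eq: "\<Union>\<D> = A" using D(5) DA by blast
  have Am: "A \<in> lmeasurable" using A by (simp add: lmeasurable_open)
  obtain D' where D': "D' \<subseteq> \<D>" "finite D'" "measure lebesgue (\<Union>\<D>) - e < measure lebesgue (\<Union>D')"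
  proof (rule measure_countable_Union_approachable[OF D(1) e])
    show dm: "d \<in> lmeasurable" if "d \<in> \<D>" for d using D(2)[OF that] by auto
    show "measure lebesgue (\<Union>D') \<le> measure lebesgue A" if D': "D' \<subseteq> \<D>" "finite D'" for D'
    proof (rule measure_mono_fmeasurable)
      show "\<Union>D' \<subseteq> A" using D' DA by blast
      show "\<Union>D' \<in> sets lebesgue" using D' dm by (intro sets.finite_Union) (auto intro: fmeasurableD)
    qed (rule Am)
  qed
  have box: "interior K \<noteq> {}" "\<exists>a b. interior K = box a b" "K \<in> lmeasurable" "measure lebesgue K = measure lebesgue (interior K)" if K: "K \<in> D'" for K
  proof -
    obtain c d where "K = cbox c d" using D(2) D'(1) K by blast
    then show "\<exists>a b. interior K = box a b" "K \<in> lmeasurable" "measure lebesgue K = measure lebesgue (interior K)"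
      by (auto simp: interior_cbox measure_lborel_box_eq measure_lborel_cbox_eq)
    show "interior K \<noteq> {}" using D(2) D'(1) K by blast
  qed
  have disj: "disjoint_family_on interior D'"
    using D(3) D'(1) by (auto simp: disjoint_family_on_def pairwise_def)
  have fam: "box_family (interior ` D')"
    unfolding box_family_def
  proof (intro conjI ballI)
    show "disjoint (interior ` D')"
      using disj unfolding pairwise_image by (simp add: pairwise_def disjnt_def disjoint_family_on_def)
  qed (use D'(2) box in auto)
  have "measure lebesgue (\<Union>D') \<le> (\<Sum>K\<in>D'. measure lebesgue K)"
    using D'(2) box by (intro measure_Union_le) (auto intro: fmeasurableD)
  also have "\<dots> = (\<Sum>K\<in>D'. measure lebesgue (interior K))" using box by (intro sum.cong) auto
  also have "\<dots> = measure lebesgue (\<Union>(interior ` D'))"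
  proof (rule measure_UNION'[symmetric])
    show "interior K \<in> lmeasurable" if "K \<in> D'" for K using box(2)[OF that] by auto
    show "pairwise (\<lambda>X Y. disjnt (interior X) (interior Y)) D'"
      using disj by (auto simp: pairwise_def disjnt_def disjoint_family_on_def)
  qed (rule D')
  finally have "measure lebesgue A - e < measure lebesgue (\<Union>(interior ` D'))" using D'(3) eq by simp
  moreover have "\<Union>(interior ` D') \<subseteq> A" using interior_subset DA D'(1) by fastforce
  ultimately show thesis using that fam by blast
qed

text \<open>The sum of open sets is open, hence measurable. Approximation by boxes from inside costs
  \<open>e\<close> in either volume, and \<open>e\<close> tends to 0 by continuity of the
  root.\<close>

theorem brunn_minkowski_open:
  fixes A B :: "'a::euclidean_space set"
  assumes A: "open A" "bounded A" "A \<noteq> {}" and B: "open B" "bounded B" "B \<noteq> {}"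
  shows "(root DIM('a) (measure lebesgue A) + root DIM('a) (measure lebesgue B)) ^ DIM('a)
    \<le> measure lebesgue (msum A B)"
proof -
  let ?r = "root DIM('a)" and ?m = "measure lebesgue :: 'a set \<Rightarrow> real"
  define e0 where "e0 = min (?m A) (?m B)"
  have e0: "0 < e0" using A B by (auto simp: e0_def simp del: measure_completion intro: measure_open_pos)
  have le: "(?r (?m A - e) + ?r (?m B - e)) ^ DIM('a) \<le> ?m (msum A B)" if e: "0 < e" "e < e0" for e
  proof -
    obtain \<A> where \<A>: "box_family \<A>" "\<Union>\<A> \<subseteq> A" "?m A - e < ?m (\<Union>\<A>)"
      using box_family_approx[OF A(1,2) e(1)] .
    obtain \<B> where \<B>: "box_family \<B>" "\<Union>\<B> \<subseteq> B" "?m B - e < ?m (\<Union>\<B>)"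
      using box_family_approx[OF B(1,2) e(1)] .
    have eAB: "0 < ?m A - e" "0 < ?m B - e" using e by (auto simp: e0_def)
    have "\<Union>\<A> \<noteq> {}"
    proof
      assume "\<Union>\<A> = {}"
      then have "?m (\<Union>\<A>) = 0" by (simp only: measure_empty)
      then show False using \<A>(3) eAB by linarith
    qed
    moreover have "\<Union>\<B> \<noteq> {}"
    proof
      assume "\<Union>\<B> = {}"
      then have "?m (\<Union>\<B>) = 0" by (simp only: measure_empty)
      then show False using \<B>(3) eAB by linarith
    qed
    ultimately have "(?r (?m (\<Union>\<A>)) + ?r (?m (\<Union>\<B>))) ^ DIM('a) \<le> ?m (msum (\<Union>\<A>) (\<Union>\<B>))"
      using \<A> \<B> by (intro brunn_minkowski_box_family)
    also have "\<dots> \<le> ?m (msum A B)"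
      using A B \<A> \<B> box_familyD[OF \<B>(1)] box_familyD[OF \<A>(1)]
      by (intro measure_mono_fmeasurable msum_mono fmeasurableD lmeasurable_open bounded_msum open_msum) auto
    finally have "(?r (?m (\<Union>\<A>)) + ?r (?m (\<Union>\<B>))) ^ DIM('a) \<le> ?m (msum A B)" .
    moreover have "(?r (?m A - e) + ?r (?m B - e)) ^ DIM('a) \<le> (?r (?m (\<Union>\<A>)) + ?r (?m (\<Union>\<B>))) ^ DIM('a)"
      using \<A>(3) \<B>(3) eAB by (intro power_mono add_mono real_root_le_mono) auto
    ultimately show ?thesis by linarith
  qed
  have "((\<lambda>e. (?r (?m A - e) + ?r (?m B - e)) ^ DIM('a)) \<longlongrightarrow> (?r (?m A - 0) + ?r (?m B - 0)) ^ DIM('a)) (at_right 0)"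
    by (intro tendsto_intros)
  moreover have "eventually (\<lambda>e. (?r (?m A - e) + ?r (?m B - e)) ^ DIM('a) \<le> ?m (msum A B)) (at_right 0)"
    by (rule eventually_mono[OF eventually_at_right_real[OF e0]]) (use le in simp)
  ultimately have "(?r (?m A - 0) + ?r (?m B - 0)) ^ DIM('a) \<le> ?m (msum A B)"
    by (rule tendsto_upperbound) simp
  then show ?thesis by (simp only: diff_zero)
qed

section \<open>The Orlicz isoperimetric inequality\<close>

lemma power_add_ge:
  fixes a x :: real
  assumes "0 \<le> a" "0 \<le> x"
  shows "a ^ n + real n * x * a ^ (n - 1) \<le> (a + x) ^ n"
proof (induction n)
  case (Suc n)
  have "a ^ Suc n + real (Suc n) * x * a ^ n \<le> (a + x) * (a ^ n + real n * x * a ^ (n - 1))"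
  proof -
    have "(a + x) * (a ^ n + real n * x * a ^ (n - 1)) =
        a ^ Suc n + real (Suc n) * x * a ^ n + real n * (x * x) * a ^ (n - 1)"
      by (cases n) (auto simp: algebra_simps)
    moreover have "0 \<le> real n * (x * x) * a ^ (n - 1)" using assms by simp
    ultimately show ?thesis by linarith
  qed
  also have "\<dots> \<le> (a + x) * (a + x) ^ n" using assms Suc by (intro mult_left_mono) auto
  finally show ?case by simp
qed simp

text \<open>The slope is the infimum of the difference quotients to the right of \<open>t0\<close>,
  and is nonnegative as \<open>\<phi>\<close> increases. Under strict convexity a second point of
  contact would put the graph below the line at the midpoint.\<close>

lemma convex_on_supporting_line:
  fixes \<phi> :: "real \<Rightarrow> real"
  assumes \<phi>: "convex_on {0<..} \<phi>" "mono_on {0<..} \<phi>" and t0: "0 < t0"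
  obtains s where "0 \<le> s" "\<And>t. 0 < t \<Longrightarrow> \<phi> t0 + s * (t - t0) \<le> \<phi> t"
    "\<And>t. strictly_convex_on {0<..} \<phi> \<Longrightarrow> 0 < t \<Longrightarrow> t \<noteq> t0 \<Longrightarrow> \<phi> t0 + s * (t - t0) < \<phi> t"
proof -
  define s where "s = Inf ((\<lambda>t. (\<phi> t0 - \<phi> t) / (t0 - t)) ` ({t0<..} \<inter> {0<..}))"
  have line: "\<phi> t0 + s * (t - t0) \<le> \<phi> t" if "0 < t" for t
    using convex_le_Inf_differential[OF \<phi>(1), of t0 t] t0 that
    by (simp add: s_def interior_open algebra_simps)
  have "0 \<le> s"
  proof -
    have "\<phi> (t0 / 2) \<le> \<phi> t0" using \<phi>(2) t0 by (auto intro: mono_onD)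
    moreover have "\<phi> t0 + s * (t0 / 2 - t0) \<le> \<phi> (t0 / 2)" using t0 by (intro line) simp
    ultimately have "0 \<le> s * (t0 / 2)" by (simp add: algebra_simps)
    then show ?thesis using t0 by (simp add: zero_le_mult_iff)
  qed
  moreover have "\<phi> t0 + s * (t - t0) < \<phi> t" if sc: "strictly_convex_on {0<..} \<phi>" and t: "0 < t" "t \<noteq> t0" for t
  proof (rule ccontr)
    assume "\<not> ?thesis"
    then have "\<phi> t \<le> \<phi> t0 + s * (t - t0)" by simp
    moreover have "\<phi> ((1/2) *\<^sub>R t + (1/2) *\<^sub>R t0) < 1/2 * \<phi> t + 1/2 * \<phi> t0"
    proof -
      have "\<forall>u>0. \<forall>v>0. t \<noteq> t0 \<longrightarrow> u + v = 1 \<longrightarrow> \<phi> (u *\<^sub>R t + v *\<^sub>R t0) < u * \<phi> t + v * \<phi> t0"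
        using sc t t0 unfolding strictly_convex_on_def by blast
      from this[rule_format, of "1/2" "1/2"] show ?thesis using t by simp
    qed
    moreover have "\<phi> t0 + s * (((1/2) *\<^sub>R t + (1/2) *\<^sub>R t0) - t0) \<le> \<phi> ((1/2) *\<^sub>R t + (1/2) *\<^sub>R t0)"
      using t t0 by (intro line) simp
    ultimately show False by (simp add: algebra_simps)
  qed
  ultimately show thesis using line that by blast
qed

lemma measure_ball_scale:
  assumes "0 < r"
  shows "measure lebesgue (ball (0::'a::euclidean_space) r) = r ^ DIM('a) * measure lebesgue (cball (0::'a) 1)"
    "measure lebesgue (cball (0::'a::euclidean_space) r) = r ^ DIM('a) * measure lebesgue (cball (0::'a) 1)"
  using assms by (simp_all add: content_ball content_cball)

lemma vrad_eq:
  fixes K :: "'a::euclidean_space set"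
  assumes "0 < measure lebesgue K"
  shows "vrad K = root DIM('a) (measure lebesgue K) / root DIM('a) (measure lebesgue (cball (0::'a) 1))"
    "0 < vrad K" "vrad K ^ DIM('a) * measure lebesgue (cball (0::'a) 1) = measure lebesgue K"
proof -
  have B: "0 < measure lebesgue (cball (0::'a) 1)" by (simp add: content_cball)
  have q: "0 < measure lebesgue K / measure lebesgue (cball (0::'a) 1)" using assms B by (rule divide_pos_pos)
  have r: "vrad K = root DIM('a) (measure lebesgue K / measure lebesgue (cball (0::'a) 1))"
    unfolding vrad_def using q by (subst root_powr_inverse) auto
  show "vrad K = root DIM('a) (measure lebesgue K) / root DIM('a) (measure lebesgue (cball (0::'a) 1))"
    unfolding r by (rule real_root_divide)
  show "0 < vrad K" unfolding r by (rule real_root_gt_zero[OF _ q]) simp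
  have "vrad K ^ DIM('a) = measure lebesgue K / measure lebesgue (cball (0::'a) 1)"
    unfolding r by (rule real_root_pow_pos2[OF _ less_imp_le[OF q]]) simp
  then show "vrad K ^ DIM('a) * measure lebesgue (cball (0::'a) 1) = measure lebesgue K" using B by simp
qed

lemma scaleR_image_cball: "0 < r \<Longrightarrow> (\<lambda>x. r *\<^sub>R x) ` cball 0 1 = cball (0::'a::real_normed_vector) r"
  using cball_scale[of r 0 1] by simp

section \<open>The isoperimetric bound for the gradient and its Orlicz version\<close>

context normalized_body
begin

abbreviation "reg_lborel \<equiv> restrict_space lborel regular_part"

lemma measure_K_pos: "0 < measure lebesgue K"
proof -
  have "0 < measure lebesgue (cball (0::'a) inr)" using inr by (simp add: content_cball)
  also have "\<dots> \<le> measure lebesgue K"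
    using inr compact_K by (intro measure_mono_fmeasurable) (auto intro: lmeasurable_compact)
  finally show ?thesis .
qed

lemma AE_reg_lborelI:
  assumes "\<And>x. radial x \<in> regular_boundary K \<Longrightarrow> Q x"
  shows "AE x in reg_lborel. Q x"
  by (rule AE_I2) (simp add: assms space_restrict_space regular_part_def)

lemma integrable_reg_lborel:
  fixes f :: "'a \<Rightarrow> real"
  assumes "f \<in> borel_measurable reg_lborel" "\<And>x. radial x \<in> regular_boundary K \<Longrightarrow> \<bar>f x\<bar> \<le> B"
  shows "integrable reg_lborel f"
proof -
  interpret finite_measure reg_lborel by (rule finite_regular_part)
  show ?thesis
    using assms by (intro integrable_const_bound[of _ B] AE_reg_lborelI) auto
qed

lemma integrable_grad_norm: "integrable reg_lborel grad_norm"
  using grad_norm_bounds by (intro integrable_reg_lborel[of _ "1 / inr"]) (auto simp: less_imp_le)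

text \<open>Brunn-Minkowski for \<open>interior K\<close> and an open ball bounds the volume of
  their sum from below. Almost every point of the sum lies in the star-shaped set of
  \<open>emeasure_sublevel_le\<close>, whose volume is at most the integral.\<close>

theorem brunn_minkowski_integral:
  assumes e: "0 < e"
  shows "(root DIM('a) (measure lebesgue K) + e * root DIM('a) (measure lebesgue (cball (0::'a) 1))) ^ DIM('a)
    \<le> (LINT x|reg_lborel. (1 + e * grad_norm x) ^ DIM('a))"
proof -
  let ?n = "DIM('a)" and ?S = "msum (interior K) (ball 0 e)"
  let ?Y = "{y. radial y \<in> regular_boundary K \<and> g y \<le> 1 + e * grad_norm y}"
  have bK: "bounded (interior K)" using compact_imp_bounded[OF compact_K] bounded_subset interior_subset by blast
  have So: "open ?S" "bounded ?S" using bK by (auto intro: open_msum bounded_msum)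
  have mK: "measure lebesgue (interior K) = measure lebesgue K"
    using compact_imp_bounded[OF compact_K] convex_K by (intro measure_interior negligible_convex_frontier)
  have rB: "root ?n (measure lebesgue (ball (0::'a) e)) = e * root ?n (measure lebesgue (cball (0::'a) 1))"
    using e unfolding measure_ball_scale(1)[OF e] by (simp add: real_root_mult real_root_pos2)
  have "(root ?n (measure lebesgue (interior K)) + root ?n (measure lebesgue (ball (0::'a) e))) ^ ?n \<le> measure lebesgue ?S"
    using zero_K e bK by (intro brunn_minkowski_open) auto
  then have 1: "(root ?n (measure lebesgue K) + e * root ?n (measure lebesgue (cball (0::'a) 1))) ^ ?n \<le> measure lebesgue ?S"
    by (simp only: mK rB)
  have int: "integrable reg_lborel (\<lambda>x. (1 + e * grad_norm x) ^ ?n)"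
  proof (rule integrable_reg_lborel)
    show "(\<lambda>x. (1 + e * grad_norm x) ^ ?n) \<in> borel_measurable reg_lborel" by measurable
    fix x assume "radial x \<in> regular_boundary K"
    then have "0 < grad_norm x" "grad_norm x \<le> 1 / inr" using grad_norm_bounds by auto
    then show "\<bar>(1 + e * grad_norm x) ^ ?n\<bar> \<le> (1 + e * (1 / inr)) ^ ?n"
      using e mult_left_mono[of "grad_norm x" "1 / inr" e] by (auto simp: power_abs intro!: power_mono)
  qed
  have nonneg: "0 \<le> (1 + e * grad_norm x) ^ ?n" if "radial x \<in> regular_boundary K" for x
    using grad_norm_bounds(3)[OF that] e by simp
  have "ennreal (measure lebesgue ?S) = emeasure lborel ?S"
    using So emeasure_bounded_finite[OF So(2)] by (auto intro!: emeasure_eq_ennreal_measure[symmetric])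
  also have "\<dots> \<le> emeasure lborel ?Y"
  proof (rule emeasure_mono_AE)
    show "AE x in lborel. x \<in> ?S \<longrightarrow> x \<in> ?Y"
      using AE_radial_regular
    proof eventually_elim
      case (elim x)
      show ?case
      proof
        assume "x \<in> ?S"
        then obtain k z where kz: "x = k + z" "k \<in> interior K" "norm z < e" by (auto simp: msum_def)
        have k: "k \<in> K" using kz(2) interior_subset by blast
        have x: "x = k + e *\<^sub>R ((1 / e) *\<^sub>R z)" using kz e by simp
        have "norm ((1 / e) *\<^sub>R z) \<le> 1" using kz e by simp
        then show "x \<in> ?Y" using gauge_le_parallel[of k e "(1 / e) *\<^sub>R z"] elim k e x by simp
      qed
    qed
    let ?R = "restrict_space lborel {x. radial x \<in> regular_boundary K}"
    have [measurable]: "g \<in> borel_measurable ?R" by (intro measurable_restrict_space1) simp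
    have "{y \<in> space ?R. g y \<le> 1 + e * grad_norm y} \<in> sets ?R" by measurable
    then show "?Y \<in> sets lborel" by (subst (asm) sets_restrict_space_iff) (auto simp: space_restrict_space)
  qed
  also have "\<dots> \<le> (\<integral>\<^sup>+x. ennreal ((1 + e * grad_norm x) ^ ?n) \<partial>reg_lborel)"
    using e by (intro emeasure_sublevel_le) simp
  also have "\<dots> = ennreal (LINT x|reg_lborel. (1 + e * grad_norm x) ^ ?n)"
    using nonneg by (intro nn_integral_eq_integral int AE_reg_lborelI)
  finally have "measure lebesgue ?S \<le> (LINT x|reg_lborel. (1 + e * grad_norm x) ^ ?n)"
    using nonneg by (subst (asm) ennreal_le_iff) (intro integral_nonneg_AE AE_reg_lborelI)
  then show ?thesis using 1 by simp
qed

lemma integral_const_reg_lborel: "(LINT x|reg_lborel. c) = c * measure lebesgue K" for c :: real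
  using measure_regular_part by simp

text \<open>At \<open>e = 0\<close> both sides of \<open>brunn_minkowski_integral\<close> equal the
  volume of \<open>K\<close>; the claim compares their first-order terms.\<close>

theorem isoperimetric_integral:
  "measure lebesgue K / vrad K \<le> (LINT x|reg_lborel. grad_norm x)"
proof -
  let ?n = "DIM('a)"
  define a where "a = root ?n (measure lebesgue K)"
  define b where "b = root ?n (measure lebesgue (cball (0::'a) 1))"
  define J where "J = (LINT x|reg_lborel. grad_norm x)"
  have a: "0 < a" "a ^ ?n = measure lebesgue K" using measure_K_pos by (auto simp: a_def)
  have b: "0 < b" unfolding b_def by (rule real_root_gt_zero) (auto simp: content_cball)
  have an: "a ^ ?n = a * a ^ (?n - 1)" by (metis DIM_positive Suc_diff_1 power_Suc)
  have J0: "0 \<le> J"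
    unfolding J_def using grad_norm_bounds(3) by (intro integral_nonneg_AE AE_reg_lborelI) (simp add: less_imp_le)
  \<comment> \<open>Up to the factor \<open>n\<close>, the left side is the coefficient of
    \<open>e\<close> in the Brunn-Minkowski bound. On the right,
    \<open>grad_norm x \<le> 1 / inr\<close> bounds the higher terms uniformly, with a factor that
    tends to 1.\<close>
  have le: "b * a ^ (?n - 1) \<le> (1 + e / inr) ^ (?n - 1) * J" if e: "0 < e" for e
  proof -
    have "a ^ ?n + real ?n * (e * b) * a ^ (?n - 1) \<le> (a + e * b) ^ ?n"
      using a b e by (intro power_add_ge) auto
    also have "\<dots> \<le> (LINT x|reg_lborel. (1 + e * grad_norm x) ^ ?n)"
      unfolding a_def b_def by (rule brunn_minkowski_integral[OF e])
    also have "\<dots> \<le> (LINT x|reg_lborel. 1 + (real ?n * e * (1 + e / inr) ^ (?n - 1)) * grad_norm x)"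
    proof (rule integral_mono_AE')
      show "integrable reg_lborel (\<lambda>x. 1 + (real ?n * e * (1 + e / inr) ^ (?n - 1)) * grad_norm x)"
        using finite_measure.integrable_const[OF finite_regular_part] integrable_grad_norm by (intro Bochner_Integration.integrable_add) auto
      show "AE x in reg_lborel. (1 + e * grad_norm x) ^ ?n \<le> 1 + (real ?n * e * (1 + e / inr) ^ (?n - 1)) * grad_norm x"
      proof (rule AE_reg_lborelI)
        fix x assume elim: "radial x \<in> regular_boundary K"
        have p: "0 < grad_norm x" "grad_norm x \<le> 1 / inr" using grad_norm_bounds[OF elim] by auto
        have "(1 + e * grad_norm x) ^ ?n - 1 ^ ?n \<le> real ?n * (1 + e * grad_norm x - 1) * (1 + e * grad_norm x) ^ (?n - 1)"
          using p e by (intro power_diff_le) auto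
        also have "\<dots> \<le> real ?n * (1 + e * grad_norm x - 1) * (1 + e / inr) ^ (?n - 1)"
          using p e mult_left_mono[OF p(2), of e] by (intro mult_left_mono power_mono) auto
        finally show "(1 + e * grad_norm x) ^ ?n \<le> 1 + (real ?n * e * (1 + e / inr) ^ (?n - 1)) * grad_norm x"
          by (simp add: algebra_simps)
      qed
      show "AE x in reg_lborel. 0 \<le> 1 + (real ?n * e * (1 + e / inr) ^ (?n - 1)) * grad_norm x"
        using grad_norm_bounds(3) e inr
        by (intro AE_reg_lborelI add_nonneg_nonneg mult_nonneg_nonneg zero_le_power) (auto simp: less_imp_le)
    qed
    also have "\<dots> = a ^ ?n + (real ?n * e * (1 + e / inr) ^ (?n - 1)) * J"
      using finite_measure.integrable_const[OF finite_regular_part] integrable_grad_norm measure_regular_part a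
      by (subst Bochner_Integration.integral_add) (auto simp: J_def)
    finally have "(real ?n * e) * (b * a ^ (?n - 1)) \<le> (real ?n * e) * ((1 + e / inr) ^ (?n - 1) * J)"
      by (simp add: algebra_simps)
    then show ?thesis using e by (subst (asm) mult_le_cancel_left_pos) auto
  qed
  have "((\<lambda>e. (1 + e / inr) ^ (?n - 1) * J) \<longlongrightarrow> (1 + 0 / inr) ^ (?n - 1) * J) (at_right 0)"
    using inr by (intro tendsto_intros) auto
  moreover have "eventually (\<lambda>e. b * a ^ (?n - 1) \<le> (1 + e / inr) ^ (?n - 1) * J) (at_right 0)"
    using le by (intro eventually_at_right_less[THEN eventually_mono]) auto
  ultimately have "b * a ^ (?n - 1) \<le> (1 + 0 / inr) ^ (?n - 1) * J"
    by (intro tendsto_lowerbound) auto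
  moreover have "measure lebesgue K / vrad K = b * a ^ (?n - 1)"
  proof -
    have "vrad K = a / b" unfolding a_def b_def by (rule vrad_eq(1)[OF measure_K_pos])
    moreover have "measure lebesgue K = a * a ^ (?n - 1)" using a(2) an by simp
    ultimately show ?thesis using a(1) b by (simp del: measure_completion)
  qed
  ultimately show ?thesis by (simp add: J_def)
qed

lemma measurable_convex_grad_norm:
  assumes "convex_on {0<..} \<phi>"
  shows "(\<lambda>x. \<phi> (grad_norm x)) \<in> borel_measurable reg_lborel"
proof -
  have [measurable]: "(\<lambda>t. indicator {0<..} t *\<^sub>R \<phi> t) \<in> borel_measurable borel"
    using assms by (intro borel_measurable_continuous_on_indicator convex_on_continuous) auto
  have "(\<lambda>x. indicator {0<..} (grad_norm x) *\<^sub>R \<phi> (grad_norm x)) \<in> borel_measurable reg_lborel" by measurable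
  moreover have "indicator {0<..} (grad_norm x) *\<^sub>R \<phi> (grad_norm x) = \<phi> (grad_norm x)" if "x \<in> space reg_lborel" for x
    using that grad_norm_bounds(3)[of x] by (simp add: space_restrict_space regular_part_def)
  ultimately show ?thesis
    using measurable_cong[of reg_lborel "\<lambda>x. indicator {0<..} (grad_norm x) *\<^sub>R \<phi> (grad_norm x)" "\<lambda>x. \<phi> (grad_norm x)" borel]
    by blast
qed

text \<open>Monotonicity confines the integrand between the values of \<open>\<phi>\<close> at
  \<open>1 / outr\<close> and \<open>1 / inr\<close>, and the measure is finite.\<close>

lemma integrable_phi_grad_norm:
  assumes "convex_on {0<..} \<phi>" "mono_on {0<..} \<phi>"
  shows "integrable reg_lborel (\<lambda>x. \<phi> (grad_norm x))"
proof (rule integrable_reg_lborel[OF measurable_convex_grad_norm[OF assms(1)]])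
  fix x assume x: "radial x \<in> regular_boundary K"
  have "\<phi> (1 / outr) \<le> \<phi> (grad_norm x)" "\<phi> (grad_norm x) \<le> \<phi> (1 / inr)"
    using grad_norm_bounds[OF x] outr inr by (auto intro!: mono_onD[OF assms(2)])
  then show "\<bar>\<phi> (grad_norm x)\<bar> \<le> \<bar>\<phi> (1 / outr)\<bar> + \<bar>\<phi> (1 / inr)\<bar>" by linarith
qed

text \<open>The line integrates to at least \<open>\<phi> t0\<close> times the volume, as its slope
  is nonnegative and the mean of \<open>grad_norm\<close> is at least \<open>t0\<close>. The gap
  \<open>h\<close> between \<open>\<phi>\<close> and the line is nonnegative; equality makes its
  integral vanish, hence \<open>h\<close> itself almost everywhere, and strict convexity allows
  contact at \<open>t0\<close> only.\<close>

lemma orlicz_integral_ge: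
  assumes \<phi>: "convex_on {0<..} \<phi>" "mono_on {0<..} \<phi>"
  defines "t0 \<equiv> 1 / vrad K"
  shows "\<phi> t0 * measure lebesgue K \<le> (LINT x|reg_lborel. \<phi> (grad_norm x))"
    and "strictly_convex_on {0<..} \<phi> \<Longrightarrow> (LINT x|reg_lborel. \<phi> (grad_norm x)) = \<phi> t0 * measure lebesgue K \<Longrightarrow>
      AE x in reg_lborel. grad_norm x = t0"
proof -
  have t0: "0 < t0" using vrad_eq(2)[OF measure_K_pos] by (simp add: t0_def)
  obtain s where s: "0 \<le> s" "\<And>t. 0 < t \<Longrightarrow> \<phi> t0 + s * (t - t0) \<le> \<phi> t"
    "\<And>t. strictly_convex_on {0<..} \<phi> \<Longrightarrow> 0 < t \<Longrightarrow> t \<noteq> t0 \<Longrightarrow> \<phi> t0 + s * (t - t0) < \<phi> t"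
    using convex_on_supporting_line[OF \<phi> t0] by blast
  define h where "h x = \<phi> (grad_norm x) - (\<phi> t0 + s * (grad_norm x - t0))" for x
  have c: "integrable reg_lborel (\<lambda>x. c)" for c :: real
    by (rule finite_measure.integrable_const[OF finite_regular_part])
  have ip: "integrable reg_lborel (\<lambda>x. \<phi> (grad_norm x))" by (rule integrable_phi_grad_norm[OF \<phi>])
  have il: "integrable reg_lborel (\<lambda>x. \<phi> t0 + s * (grad_norm x - t0))"
    using c integrable_grad_norm by (intro Bochner_Integration.integrable_add Bochner_Integration.integrable_diff integrable_mult_right)
  have ih: "integrable reg_lborel h" unfolding h_def using ip il by (rule Bochner_Integration.integrable_diff)
  have h0: "AE x in reg_lborel. 0 \<le> h x" using s(2) grad_norm_bounds(3) by (intro AE_reg_lborelI) (simp add: h_def)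
  have "(LINT x|reg_lborel. \<phi> t0 + s * (grad_norm x - t0)) = \<phi> t0 * measure lebesgue K + s * ((LINT x|reg_lborel. grad_norm x) - t0 * measure lebesgue K)"
  proof -
    have "(LINT x|reg_lborel. \<phi> t0 + s * (grad_norm x - t0)) = (LINT x|reg_lborel. \<phi> t0) + (LINT x|reg_lborel. s * (grad_norm x - t0))"
      using c integrable_grad_norm by (intro Bochner_Integration.integral_add Bochner_Integration.integrable_diff integrable_mult_right)
    also have "(LINT x|reg_lborel. s * (grad_norm x - t0)) = s * (LINT x|reg_lborel. grad_norm x - t0)" by simp
    also have "(LINT x|reg_lborel. grad_norm x - t0) = (LINT x|reg_lborel. grad_norm x) - (LINT x|reg_lborel. t0)"
      using c integrable_grad_norm by (intro Bochner_Integration.integral_diff)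
    finally show ?thesis by (simp only: integral_const_reg_lborel)
  qed
  moreover have "(LINT x|reg_lborel. h x) = (LINT x|reg_lborel. \<phi> (grad_norm x)) - (LINT x|reg_lborel. \<phi> t0 + s * (grad_norm x - t0))"
    unfolding h_def using ip il by (rule Bochner_Integration.integral_diff)
  moreover have "0 \<le> s * ((LINT x|reg_lborel. grad_norm x) - t0 * measure lebesgue K)"
    using s(1) isoperimetric_integral by (intro mult_nonneg_nonneg) (simp_all add: t0_def del: measure_completion)
  moreover have hI: "0 \<le> (LINT x|reg_lborel. h x)" using h0 by (rule integral_nonneg_AE)
  ultimately have le: "\<phi> t0 * measure lebesgue K + (LINT x|reg_lborel. h x) \<le> (LINT x|reg_lborel. \<phi> (grad_norm x))"
    by linarith
  then show "\<phi> t0 * measure lebesgue K \<le> (LINT x|reg_lborel. \<phi> (grad_norm x))" using hI by linarith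
  assume sc: "strictly_convex_on {0<..} \<phi>" and eq: "(LINT x|reg_lborel. \<phi> (grad_norm x)) = \<phi> t0 * measure lebesgue K"
  have "(LINT x|reg_lborel. h x) = 0" using le eq hI by linarith
  then have "AE x in reg_lborel. h x = 0" using integral_nonneg_eq_0_iff_AE[OF ih h0] by simp
  moreover have "AE x in reg_lborel. h x = 0 \<longrightarrow> grad_norm x = t0"
  proof (rule AE_reg_lborelI, rule impI, rule ccontr)
    fix x assume "radial x \<in> regular_boundary K" "h x = 0" "grad_norm x \<noteq> t0"
    then show False using s(3)[OF sc, of "grad_norm x"] grad_norm_bounds(3)[of x] by (simp add: h_def)
  qed
  ultimately show "AE x in reg_lborel. grad_norm x = t0" by eventually_elim simp
qed

section \<open>Bodies with constant gradient norm\<close>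

text \<open>The inequality \<open>g x \<le> norm x / vrad K\<close> holds almost everywhere in
  \<open>K\<close>. Inside the interior it fails on an open set, which is null and therefore empty,
  and homogeneity extends it from a small ball to all points. The same argument, an open null set is
  empty, removes the part of the interior outside the ball.\<close>

lemma ball_if_pt_constant:
  assumes ae: "AE x in reg_lborel. grad_norm x = 1 / vrad K"
  shows "K = cball 0 (vrad K)"
proof -
  let ?v = "vrad K"
  have v: "0 < ?v" by (rule vrad_eq(2)[OF measure_K_pos])
  have mv: "measure lebesgue (cball (0::'a) ?v) = measure lebesgue K"
    unfolding measure_ball_scale(2)[OF v] by (rule vrad_eq(3)[OF measure_K_pos])
  have "AE x in lborel. x \<in> regular_part \<longrightarrow> grad_norm x = 1 / ?v"
    using ae by (subst (asm) AE_restrict_space_iff) auto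
  then have ae1: "AE x in lborel. x \<notin> {x \<in> interior K. norm x / ?v < g x}"
    using AE_radial_regular
  proof eventually_elim
    case (elim x)
    show ?case
    proof
      assume x: "x \<in> {x \<in> interior K. norm x / ?v < g x}"
      then have "x \<in> regular_part" using elim(2) interior_subset by (auto simp: regular_part_def)
      then have "grad_norm x = 1 / ?v" using elim by blast
      then show False using gauge_le_grad_norm[OF elim(2)] x by simp
    qed
  qed
  have "open {x. norm x / ?v < g x}" using v by (intro open_Collect_less continuous_gauge continuous_intros) auto
  then have op: "open {x \<in> interior K. norm x / ?v < g x}" by (simp add: Collect_conj_eq open_Int)
  have "emeasure lborel {x \<in> interior K. norm x / ?v < g x} = 0"
    using ae1 op by (subst (asm) AE_iff_measurable[OF _ refl]) auto
  then have "{x \<in> interior K. norm x / ?v < g x} = {}"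
    using emeasure_lborel_open_pos[OF op] by force
  then have small: "g x \<le> norm x / ?v" if "norm x < inr" for x
  proof -
    have "x \<in> interior K" using that inr interior_mono[OF inr(2)] by auto
    then show ?thesis using \<open>{x \<in> interior K. norm x / ?v < g x} = {}\<close> by force
  qed
  have sub: "cball 0 ?v \<subseteq> K"
  proof
    fix x :: 'a assume x: "x \<in> cball 0 ?v"
    \<comment> \<open>Brings every point of the ball to norm at most \<open>inr / 2\<close>, where
      \<open>small\<close> applies.\<close>
    define r where "r = inr / (2 * ?v)"
    have r: "0 < r" using inr v by (simp add: r_def)
    have "norm (r *\<^sub>R x) \<le> r * ?v" using x r by simp
    also have "\<dots> < inr" using v inr by (simp add: r_def)
    finally have "g (r *\<^sub>R x) \<le> norm (r *\<^sub>R x) / ?v" by (rule small)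
    then have "r * g x \<le> r * (norm x / ?v)" using r by (simp add: gauge_scaleR)
    then have "g x \<le> norm x / ?v" using r by (simp only: mult_le_cancel_left_pos)
    also have "\<dots> \<le> 1" using x v by simp
    finally show "x \<in> K" by (simp add: mem_K_iff)
  qed
  have "measure lebesgue (interior K - cball 0 ?v) = 0"
  proof -
    have "measure lebesgue (interior K - cball 0 ?v) \<le> measure lebesgue (K - cball 0 ?v)"
      using compact_K interior_subset
      by (intro measure_mono_fmeasurable fmeasurable.Diff) (auto intro: lmeasurable_compact)
    also have "\<dots> = measure lebesgue K - measure lebesgue (cball (0::'a) ?v)"
      using compact_K by (intro measurable_measure_Diff[OF _ _ sub]) (auto intro: lmeasurable_compact)
    also have "\<dots> = 0" using mv by simp
    finally show ?thesis using measure_nonneg[of lebesgue "interior K - cball 0 ?v"] by linarith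
  qed
  moreover have "open (interior K - cball 0 ?v)" by (intro open_Diff) auto
  moreover have "bounded (interior K - cball 0 ?v)"
    using bounded_subset[OF compact_imp_bounded[OF compact_K]] interior_subset by blast
  ultimately have "interior K - cball 0 ?v = {}" using measure_open_pos[of "interior K - cball 0 ?v"] by force
  then have "closure (interior K) \<subseteq> cball 0 ?v" by (intro closure_minimal) auto
  moreover have "closure (interior K) = K"
    using convex_closure_interior[OF convex_K] zero_K compact_imp_closed[OF compact_K] by auto
  ultimately show ?thesis using sub by blast
qed

lemma grad_norm_cball:
  assumes K: "K = cball 0 v" and x: "radial x \<in> regular_boundary K"
  shows "grad_norm x = 1 / v"
proof -
  let ?y = "radial x" and ?u = "gauss_map K (radial x)"
  note r = regular_boundaryD[OF x]
  have y: "norm ?y \<le> v" using eqset_imp_iff[OF K, of ?y] r(2) by simp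
  then have "0 \<le> v" using norm_ge_zero order_trans by blast
  then have "v *\<^sub>R ?u \<in> K" using r(4) eqset_imp_iff[OF K, of "v *\<^sub>R ?u"] by simp
  then have "v \<le> ?y \<bullet> ?u" using r(7)[of "v *\<^sub>R ?u"] r(4) by (simp add: dot_square_norm)
  moreover have "?y \<bullet> ?u \<le> v"
    using norm_cauchy_schwarz[of ?y ?u] r(4) y by simp
  ultimately show ?thesis by (simp add: grad_norm_def)
qed

lemma orlicz_surface_area_cball:
  assumes "convex_on {0<..} \<phi>" "K = cball 0 v"
  shows "orlicz_surface_area \<phi> K = \<kappa> * (\<phi> (1 / v) * measure lebesgue K)"
proof -
  have "(LINT x|reg_lborel. \<phi> (grad_norm x)) = (LINT x|reg_lborel. \<phi> (1 / v))"
    using grad_norm_cball[OF assms(2)]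
    by (intro Bochner_Integration.integral_cong refl) (simp add: space_restrict_space regular_part_def)
  then show ?thesis
    unfolding orlicz_surface_area_eq_integral[OF assms(1)] by (simp only: integral_const_reg_lborel)
qed

end

theorem theorem3p2:
  fixes K :: "(real ^ 'n) set" and \<phi> :: "real \<Rightarrow> real"
  assumes "convex_body K"
    and "0 \<in> interior K"
    and "\<And>t. 0 < t \<Longrightarrow> 0 < \<phi> t"
    and "mono_on {0<..} \<phi>"
    and "convex_on {0<..} \<phi>"
  shows "orlicz_surface_area \<phi> K \<ge> orlicz_surface_area \<phi> (ball_of K) \<and>
    (strictly_convex_on {0<..} \<phi> \<longrightarrow>
      (orlicz_surface_area \<phi> K = orlicz_surface_area \<phi> (ball_of K)
        \<longleftrightarrow> origin_symmetric_ball K))"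
proof -
  obtain \<kappa> :: real where \<kappa>: "0 < \<kappa>"
    "\<And>(u::real^'n) c E. norm u = 1 \<Longrightarrow> 0 < c \<Longrightarrow> E \<in> sets borel \<Longrightarrow> E \<subseteq> {x. x \<bullet> u = c} \<Longrightarrow>
      hausdorff_outer_measure (DIM(real^'n) - 1) E =
        ennreal (\<kappa> / c) * emeasure lborel {x. 0 < x \<bullet> u \<and> x \<bullet> u \<le> c \<and> (c / (x \<bullet> u)) *\<^sub>R x \<in> E}"
    by (rule hausdorff_hyperplane[where 'a = "real^'n"]) blast
  \<comment> \<open>One \<open>\<kappa>\<close> for every body: it multiplies both Orlicz surface
    areas and, being positive, cancels.\<close>
  have const: "normalized_body L \<kappa>" if "body L" for L :: "(real^'n) set"
    unfolding normalized_body_def normalized_body_axioms_def using that \<kappa> by blast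
  interpret K: normalized_body K \<kappa>
    using assms(1,2) by (intro const body.intro) (simp_all add: convex_body_def)
  let ?v = "vrad K"
  have v: "0 < ?v" by (rule vrad_eq(2)[OF K.measure_K_pos])
  have ball: "ball_of K = cball 0 ?v" unfolding ball_of_def by (rule scaleR_image_cball[OF v])
  have mv: "measure lebesgue (ball_of K) = measure lebesgue K"
    unfolding ball measure_ball_scale(2)[OF v] by (rule vrad_eq(3)[OF K.measure_K_pos])
  interpret B: normalized_body "ball_of K" \<kappa>
    using v by (intro const body.intro) (simp_all add: ball)
  have SB: "orlicz_surface_area \<phi> (ball_of K) = \<kappa> * (\<phi> (1 / ?v) * measure lebesgue K)"
    unfolding B.orlicz_surface_area_cball[OF assms(5) ball] mv ..
  have SK: "orlicz_surface_area \<phi> K = \<kappa> * (LINT x|K.reg_lborel. \<phi> (K.grad_norm x))"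
    by (rule K.orlicz_surface_area_eq_integral[OF assms(5)])
  note ge = K.orlicz_integral_ge[OF assms(5,4)]
  show ?thesis
  proof (intro conjI impI iffI)
    show "orlicz_surface_area \<phi> (ball_of K) \<le> orlicz_surface_area \<phi> K"
      unfolding SB SK using ge(1) \<kappa>(1) by (intro mult_left_mono) auto
  next
    assume sc: "strictly_convex_on {0<..} \<phi>" and eq: "orlicz_surface_area \<phi> K = orlicz_surface_area \<phi> (ball_of K)"
    then have "(LINT x|K.reg_lborel. \<phi> (K.grad_norm x)) = \<phi> (1 / ?v) * measure lebesgue K"
      unfolding SB SK using \<kappa>(1) by simp
    then have "K = cball 0 ?v" using ge(2)[OF sc] by (intro K.ball_if_pt_constant)
    then show "origin_symmetric_ball K"
      unfolding origin_symmetric_ball_def using v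
      by (intro exI[of _ ?v] conjI) (simp_all only: scaleR_image_cball[OF v])
  next
    assume "origin_symmetric_ball K"
    then obtain r where "0 < r" "K = (\<lambda>x. r *\<^sub>R x) ` cball 0 1"
      unfolding origin_symmetric_ball_def by blast
    then have r: "0 < r" "K = cball 0 r" by (simp_all only: scaleR_image_cball)
    \<comment> \<open>Comparing volumes shows that the radius of an origin-symmetric ball is its
      volume radius, so \<open>K\<close> and \<open>ball_of K\<close> are the same set.\<close>
    have "r ^ DIM(real^'n) * measure lebesgue (cball (0::real^'n) 1) = ?v ^ DIM(real^'n) * measure lebesgue (cball (0::real^'n) 1)"
      unfolding vrad_eq(3)[OF K.measure_K_pos] measure_ball_scale(2)[OF r(1), symmetric] r(2)[symmetric] ..
    moreover have "measure lebesgue (cball (0::real^'n) 1) \<noteq> 0"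
      by (simp add: content_cball less_imp_neq[OF unit_ball_vol_pos, symmetric])
    ultimately have "r ^ DIM(real^'n) = ?v ^ DIM(real^'n)" by simp
    then have "r = ?v" using r(1) v by (simp add: power_eq_iff_eq_base)
    then show "orlicz_surface_area \<phi> K = orlicz_surface_area \<phi> (ball_of K)" using ball r(2) by simp
  qed
qed

end
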